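(* Let $p\in[1,\infty)$ and let $d=(d(1),d(2),\ldots)$ be a sequence in $\{2,3,\ldots\}$. Let $\Omega$ be the set of countable ordinals. Then there exists a family $(\gamma_\kappa)_{\kappa\in\Omega}$ of nondecreasing sequences in $[1,\infty)$ such that whenever $\kappa,\lambda\in\Omega$ satisfy $\kappa<\lambda$, there is no nonzero continuous homomorphism from $B_d^{p,\gamma_\kappa}$ to $B_d^{p,\gamma_\lambda}$, but there is a unital continuous homomorphism from $B_d^{p,\gamma_\lambda}$ to $B_d^{p,\gamma_\kappa}$ with dense range.
   Context: $L(E)$ is the algebra of bounded operators on a Banach space $E$. $M_d^p=L(l_d^p)$ where $l_d^p=L^p(\{1,\ldots,d\})$ with normalized counting measure. For an integer $d\ge 1$ and $\gamma\in[1,\infty)$, let $I_{d,\gamma}$ be the countable set of all diagonal matrices in $M_d$ whose diagonal entries all lie in $[1,\gamma]\cap\mathbb Q$, and fix (once and for all) an arbitrary function $f_{d,\gamma}\colon I_{d,\gamma}\to(0,1]$ with $\sum_{i\in I_{d,\gamma}}f_{d,\gamma}(i)=1$. Let $X_{d,\gamma}=\{1,\ldots,d\}\times I_{d,\gamma}$ with the atomic probability measure $\mu_{d,\gamma}(\{(j,i)\})=d^{-1}f_{d,\gamma}(i)$. Identify $L(L^p(\{1,\ldots,d\}\times\{i\},\mu_{d,\gamma}))$ with $M_d^p$. Let $\rho_{d,\gamma}\colon M_d\to L(L^p(X_{d,\gamma},\mu_{d,\gamma}))$ be the $L^p$ direct sum over $i\in I_{d,\gamma}$ of the representations $a\mapsto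 iai^{-1}$ of $M_d$ on $L^p(\{1,\ldots,d\}\times\{i\},\mu_{d,\gamma})$. (So $\|\rho_{d,\gamma}(a)\|=\sup_v\|vav^{-1}\|_{M_d^p}$, the supremum over all diagonal matrices $v$ with entries in $[1,\gamma]$.) Given a sequence $d=(d(1),d(2),\ldots)$ in $\{2,3,\ldots\}$ and a sequence $\gamma=(\gamma(1),\gamma(2),\ldots)$ in $[1,\infty)$, let $(X,\mu)=\prod_{n=1}^\infty(X_{d(n),\gamma(n)},\mu_{d(n),\gamma(n)})$. Then $B_d^{p,\gamma}$ is the closed subalgebra of $L(L^p(X,\mu))$ generated by all operators $\rho_{d(1),\gamma(1)}(a_1)\otimes\cdots\otimes\rho_{d(n),\gamma(n)}(a_n)\otimes1$ with $n\ge0$ and $a_k\in M_{d(k)}$. Here, for operators $a$ on $L^p(Y_1)$ and $b$ on $L^p(Y_2)$, $a\otimes b$ is the bounded operator on $L^p(Y_1\times Y_2)$ with $(a\otimes b)(\xi\otimes\eta)=a\xi\otimes b\eta$, and $1$ is the identity on $L^p$ of the product of the remaining factors. (The algebra does not depend, up to isometric isomorphism, on the functions $f_{d,\gamma}$.) Homomorphisms are not required to be unital unless stated. *)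

theory Defs
  imports
    "HOL-Analysis.Analysis"
    "Jordan_Normal_Form.Matrix"
begin

section \<open>Normed spaces with explicit carrier, and their bounded operators\<close>

text \<open>The spaces \<open>L\<^sup>p(\<mu>)\<close> depend on a measure that varies inside the statement, so they cannot
  be types; a complex normed space is a record, and an operator is a function on the carrier,
  extensional outside it.\<close>

record 'v normed_space =
  vcarrier :: "'v set"
  vzero :: 'v
  vadd :: "'v \<Rightarrow> 'v \<Rightarrow> 'v"
  vscale :: "complex \<Rightarrow> 'v \<Rightarrow> 'v"
  vnorm :: "'v \<Rightarrow> real"

definition bounded_ops :: "'v normed_space \<Rightarrow> ('v \<Rightarrow> 'v) set" where
  "bounded_ops E = {T \<in> vcarrier E \<rightarrow>\<^sub>E vcarrier E.
     (\<forall>u\<in>vcarrier E. \<forall>v\<in>vcarrier E. T (vadd E u v) = vadd E (T u) (T v)) \<and>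
     (\<forall>c. \<forall>v\<in>vcarrier E. T (vscale E c v) = vscale E c (T v)) \<and>
     (\<exists>C. \<forall>v\<in>vcarrier E. vnorm E (T v) \<le> C * vnorm E v)}"

definition op_zero :: "'v normed_space \<Rightarrow> 'v \<Rightarrow> 'v" where
  "op_zero E = (\<lambda>v\<in>vcarrier E. vzero E)"

definition op_one :: "'v normed_space \<Rightarrow> 'v \<Rightarrow> 'v" where
  "op_one E = (\<lambda>v\<in>vcarrier E. v)"

definition op_add :: "'v normed_space \<Rightarrow> ('v \<Rightarrow> 'v) \<Rightarrow> ('v \<Rightarrow> 'v) \<Rightarrow> 'v \<Rightarrow> 'v" where
  "op_add E S T = (\<lambda>v\<in>vcarrier E. vadd E (S v) (T v))"

definition op_scale :: "'v normed_space \<Rightarrow> complex \<Rightarrow> ('v \<Rightarrow> 'v) \<Rightarrow> 'v \<Rightarrow> 'v" where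
  "op_scale E c T = (\<lambda>v\<in>vcarrier E. vscale E c (T v))"

definition op_mult :: "'v normed_space \<Rightarrow> ('v \<Rightarrow> 'v) \<Rightarrow> ('v \<Rightarrow> 'v) \<Rightarrow> 'v \<Rightarrow> 'v" where
  "op_mult E S T = compose (vcarrier E) S T"

definition op_norm :: "'v normed_space \<Rightarrow> ('v \<Rightarrow> 'v) \<Rightarrow> real" where
  "op_norm E T = Sup {vnorm E (T v) | v. v \<in> vcarrier E \<and> vnorm E v \<le> 1}"

text \<open>The guard only serves the locale \<open>Metric_space\<close>, which demands nonnegativity and symmetry
  of the distance for all arguments, inside the carrier or not.\<close>

definition op_dist :: "'v normed_space \<Rightarrow> ('v \<Rightarrow> 'v) \<Rightarrow> ('v \<Rightarrow> 'v) \<Rightarrow> real" where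
  "op_dist E S T = (if S \<in> bounded_ops E \<and> T \<in> bounded_ops E
     then op_norm E (op_add E S (op_scale E (-1) T)) else 0)"

definition norm_topology :: "'v normed_space \<Rightarrow> ('v \<Rightarrow> 'v) set \<Rightarrow> ('v \<Rightarrow> 'v) topology" where
  "norm_topology E A = Metric_space.mtopology A (op_dist E)"

definition closed_subalgebra :: "'v normed_space \<Rightarrow> ('v \<Rightarrow> 'v) set \<Rightarrow> bool" where
  "closed_subalgebra E A \<longleftrightarrow>
     A \<subseteq> bounded_ops E \<and> op_zero E \<in> A \<and>
     (\<forall>S\<in>A. \<forall>T\<in>A. op_add E S T \<in> A \<and> op_mult E S T \<in> A) \<and>
     (\<forall>c. \<forall>T\<in>A. op_scale E c T \<in> A) \<and>
     closedin (norm_topology E (bounded_ops E)) A"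

text \<open>In what follows \<open>A\<close> and \<open>A'\<close> are algebras of operators on \<open>E\<close> and \<open>E'\<close>.
  Homomorphisms need not be unital.\<close>

definition continuous_hom ::
  "'v normed_space \<Rightarrow> ('v \<Rightarrow> 'v) set \<Rightarrow> 'w normed_space \<Rightarrow> ('w \<Rightarrow> 'w) set \<Rightarrow>
    (('v \<Rightarrow> 'v) \<Rightarrow> ('w \<Rightarrow> 'w)) \<Rightarrow> bool" where
  "continuous_hom E A E' A' \<phi> \<longleftrightarrow>
     \<phi> \<in> A \<rightarrow> A' \<and>
     (\<forall>S\<in>A. \<forall>T\<in>A. \<phi> (op_add E S T) = op_add E' (\<phi> S) (\<phi> T)) \<and>
     (\<forall>S\<in>A. \<forall>T\<in>A. \<phi> (op_mult E S T) = op_mult E' (\<phi> S) (\<phi> T)) \<and>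
     (\<forall>c. \<forall>T\<in>A. \<phi> (op_scale E c T) = op_scale E' c (\<phi> T)) \<and>
     continuous_map (norm_topology E A) (norm_topology E' A') \<phi>"

definition nonzero_hom ::
  "('v \<Rightarrow> 'v) set \<Rightarrow> 'w normed_space \<Rightarrow> (('v \<Rightarrow> 'v) \<Rightarrow> ('w \<Rightarrow> 'w)) \<Rightarrow> bool" where
  "nonzero_hom A E' \<phi> \<longleftrightarrow> (\<exists>T\<in>A. \<phi> T \<noteq> op_zero E')"

definition unital_hom ::
  "'v normed_space \<Rightarrow> 'w normed_space \<Rightarrow> (('v \<Rightarrow> 'v) \<Rightarrow> ('w \<Rightarrow> 'w)) \<Rightarrow> bool" where
  "unital_hom E E' \<phi> \<longleftrightarrow> \<phi> (op_one E) = op_one E'"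

definition dense_range ::
  "('v \<Rightarrow> 'v) set \<Rightarrow> 'w normed_space \<Rightarrow> ('w \<Rightarrow> 'w) set \<Rightarrow> (('v \<Rightarrow> 'v) \<Rightarrow> ('w \<Rightarrow> 'w)) \<Rightarrow> bool" where
  "dense_range A E' A' \<phi> \<longleftrightarrow> norm_topology E' A' closure_of (\<phi> ` A) = A'"


section \<open>Complex \<open>L\<^sup>p\<close> spaces\<close>

definition Lp_fun :: "real \<Rightarrow> 'a measure \<Rightarrow> ('a \<Rightarrow> complex) set" where
  "Lp_fun p M = {f \<in> borel_measurable M. integrable M (\<lambda>x. norm (f x) powr p)}"

definition Lp_rel :: "real \<Rightarrow> 'a measure \<Rightarrow> (('a \<Rightarrow> complex) \<times> ('a \<Rightarrow> complex)) set" where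
  "Lp_rel p M = {(f, g). f \<in> Lp_fun p M \<and> g \<in> Lp_fun p M \<and> (AE x in M. f x = g x)}"

definition Lp_class :: "real \<Rightarrow> 'a measure \<Rightarrow> ('a \<Rightarrow> complex) \<Rightarrow> ('a \<Rightarrow> complex) set" where
  "Lp_class p M f = Lp_rel p M `` {f}"

text \<open>All uses of \<open>rep\<close> below are independent, up to null sets, of the chosen representative.\<close>

definition rep :: "('a \<Rightarrow> complex) set \<Rightarrow> 'a \<Rightarrow> complex" where
  "rep F = (SOME f. f \<in> F)"

definition Lp :: "real \<Rightarrow> 'a measure \<Rightarrow> ('a \<Rightarrow> complex) set normed_space" where
  "Lp p M = \<lparr>
     vcarrier = Lp_fun p M // Lp_rel p M,
     vzero = Lp_class p M (\<lambda>x. 0),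
     vadd = (\<lambda>F G. Lp_class p M (\<lambda>x. rep F x + rep G x)),
     vscale = (\<lambda>c F. Lp_class p M (\<lambda>x. c * rep F x)),
     vnorm = (\<lambda>F. (\<integral>x. norm (rep F x) powr p \<partial>M) powr (1 / p)) \<rparr>"


section \<open>The algebras \<open>B\<close>\<close>

text \<open>Indices \<open>1, \<dots>, d\<close> of the mathematics are \<open>0, \<dots>, d - 1\<close> here, as is the convention for matrices in
  this library, and sequences start at \<open>0\<close>.\<close>

definition diag_index :: "nat \<Rightarrow> real \<Rightarrow> complex mat set" where
  "diag_index d \<gamma> = {v \<in> carrier_mat d d. diagonal_mat v \<and>
     (\<forall>j<d. v $$ (j, j) \<in> complex_of_real ` ({1..\<gamma>} \<inter> \<rat>))}"

definition weight :: "nat \<Rightarrow> real \<Rightarrow> (complex mat \<Rightarrow> real) \<Rightarrow> bool" where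
  "weight d \<gamma> w \<longleftrightarrow> (\<forall>v\<in>diag_index d \<gamma>. 0 < w v \<and> w v \<le> 1) \<and> (w has_sum 1) (diag_index d \<gamma>)"

definition X_space :: "nat \<Rightarrow> real \<Rightarrow> (complex mat \<Rightarrow> real) \<Rightarrow> (nat \<times> complex mat) measure" where
  "X_space d \<gamma> w = point_measure ({..<d} \<times> diag_index d \<gamma>) (\<lambda>(j, v). ennreal (w v / real d))"

text \<open>For diagonal \<open>v\<close> with nonzero diagonal entries this is the inverse matrix.\<close>

definition diag_inv :: "nat \<Rightarrow> complex mat \<Rightarrow> complex mat" where
  "diag_inv d v = mat_diag d (\<lambda>j. 1 / v $$ (j, j))"

text \<open>On the summand \<open>{..<d} \<times> {v}\<close> the matrix \<open>a\<close> acts as \<open>v a v\<^sup>-\<^sup>1\<close>.\<close>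

definition rho :: "real \<Rightarrow> nat \<Rightarrow> real \<Rightarrow> (complex mat \<Rightarrow> real) \<Rightarrow> complex mat \<Rightarrow>
    (nat \<times> complex mat \<Rightarrow> complex) set \<Rightarrow> (nat \<times> complex mat \<Rightarrow> complex) set" where
  "rho p d \<gamma> w a = (\<lambda>F\<in>vcarrier (Lp p (X_space d \<gamma> w)). Lp_class p (X_space d \<gamma> w)
     (\<lambda>(j, v). \<Sum>k<d. (v * a * diag_inv d v) $$ (j, k) * rep F (k, v)))"

text \<open>The vector \<open>\<Xi> 0 \<otimes> \<dots> \<otimes> \<Xi> (n - 1) \<otimes> H\<close> in \<open>L\<^sup>p\<close> of the product of all \<open>N k\<close>, where \<open>H\<close> lives on
  the product of the factors with index at least \<open>n\<close>.\<close>

definition elem_tensor :: "real \<Rightarrow> (nat \<Rightarrow> 'a measure) \<Rightarrow> nat \<Rightarrow> (nat \<Rightarrow> ('a \<Rightarrow> complex) set) \<Rightarrow>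
    ((nat \<Rightarrow> 'a) \<Rightarrow> complex) set \<Rightarrow> ((nat \<Rightarrow> 'a) \<Rightarrow> complex) set" where
  "elem_tensor p N n \<Xi> H = Lp_class p (PiM UNIV N)
     (\<lambda>x. (\<Prod>k<n. rep (\<Xi> k) (x k)) * rep H (restrict x {n..}))"

text \<open>\<open>T\<close> is \<open>A 0 \<otimes> \<dots> \<otimes> A (n - 1) \<otimes> 1\<close>. Since the span of the elementary tensors is dense, there is
  at most one such \<open>T\<close>.\<close>

definition is_tensor_op :: "real \<Rightarrow> (nat \<Rightarrow> 'a measure) \<Rightarrow> nat \<Rightarrow>
    (nat \<Rightarrow> ('a \<Rightarrow> complex) set \<Rightarrow> ('a \<Rightarrow> complex) set) \<Rightarrow>
    (((nat \<Rightarrow> 'a) \<Rightarrow> complex) set \<Rightarrow> ((nat \<Rightarrow> 'a) \<Rightarrow> complex) set) \<Rightarrow> bool" where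
  "is_tensor_op p N n A T \<longleftrightarrow> T \<in> bounded_ops (Lp p (PiM UNIV N)) \<and>
     (\<forall>\<Xi> H. (\<forall>k<n. \<Xi> k \<in> vcarrier (Lp p (N k))) \<longrightarrow> H \<in> vcarrier (Lp p (PiM {n..} N)) \<longrightarrow>
        T (elem_tensor p N n \<Xi> H) = elem_tensor p N n (\<lambda>k. A k (\<Xi> k)) H)"

text \<open>The family \<open>w\<close> of weight functions is fixed once and for all, for all \<open>d\<close> and \<open>\<gamma>\<close>.\<close>

definition X_seq :: "(nat \<Rightarrow> real \<Rightarrow> complex mat \<Rightarrow> real) \<Rightarrow> (nat \<Rightarrow> nat) \<Rightarrow> (nat \<Rightarrow> real) \<Rightarrow>
    nat \<Rightarrow> (nat \<times> complex mat) measure" where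
  "X_seq w d \<gamma> n = X_space (d n) (\<gamma> n) (w (d n) (\<gamma> n))"

definition B_space :: "(nat \<Rightarrow> real \<Rightarrow> complex mat \<Rightarrow> real) \<Rightarrow> real \<Rightarrow> (nat \<Rightarrow> nat) \<Rightarrow> (nat \<Rightarrow> real) \<Rightarrow>
    ((nat \<Rightarrow> nat \<times> complex mat) \<Rightarrow> complex) set normed_space" where
  "B_space w p d \<gamma> = Lp p (PiM UNIV (X_seq w d \<gamma>))"

definition B_gens :: "(nat \<Rightarrow> real \<Rightarrow> complex mat \<Rightarrow> real) \<Rightarrow> real \<Rightarrow> (nat \<Rightarrow> nat) \<Rightarrow> (nat \<Rightarrow> real) \<Rightarrow>
    (((nat \<Rightarrow> nat \<times> complex mat) \<Rightarrow> complex) set \<Rightarrow> ((nat \<Rightarrow> nat \<times> complex mat) \<Rightarrow> complex) set) set" where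
  "B_gens w p d \<gamma> = {T. \<exists>n a. (\<forall>k<n. a k \<in> carrier_mat (d k) (d k)) \<and>
     is_tensor_op p (X_seq w d \<gamma>) n (\<lambda>k. rho p (d k) (\<gamma> k) (w (d k) (\<gamma> k)) (a k)) T}"

definition B_alg :: "(nat \<Rightarrow> real \<Rightarrow> complex mat \<Rightarrow> real) \<Rightarrow> real \<Rightarrow> (nat \<Rightarrow> nat) \<Rightarrow> (nat \<Rightarrow> real) \<Rightarrow>
    (((nat \<Rightarrow> nat \<times> complex mat) \<Rightarrow> complex) set \<Rightarrow> ((nat \<Rightarrow> nat \<times> complex mat) \<Rightarrow> complex) set) set" where
  "B_alg w p d \<gamma> = closed_subalgebra (B_space w p d \<gamma>) hull B_gens w p d \<gamma>"


section \<open>Countable ordinals\<close>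

text \<open>A countable ordinal is the order type of a well-order on a set of natural numbers. Here
  \<open>Well_order r\<close> is a well-order on \<open>Field r\<close>, which may be any set of naturals, finite or not.\<close>

definition countable_ordinals :: "nat rel set set" where
  "countable_ordinals = {r. Well_order r} // ordIso"

definition ordinal_less :: "nat rel set \<Rightarrow> nat rel set \<Rightarrow> bool" where
  "ordinal_less \<kappa> \<mu> \<longleftrightarrow> (\<exists>r\<in>\<kappa>. \<exists>s\<in>\<mu>. (r, s) \<in> ordLess)"

end

theory Submission
  imports Defs "HOL-Probability.Infinite_Product_Measure"
begin

text \<open>The family is chosen so that for \<open>\<kappa> < \<mu>\<close> eventually \<open>\<gamma>\<^sub>\<mu>(n)\<close> exceeds \<open>\<gamma>\<^sub>\<kappa>(n)\<close> and
  \<open>n (d(0) \<dots> d(n))\<^sup>2 (\<gamma>\<^sub>\<kappa>(0) \<dots> \<gamma>\<^sub>\<kappa>(n))\<^sup>2\<close>; only countably many functions have to be dominated at each step.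
  On the algebraic tensor product the \<open>\<kappa>\<close>-norm is then at most a constant times the \<open>\<mu>\<close>-norm, so that the
  identity extends to a homomorphism with dense range. Conversely, a nonzero homomorphism \<open>\<phi>\<close> from the
  \<open>\<kappa>\<close>-algebra to the \<open>\<mu>\<close>-algebra has \<open>\<phi>(1)\<close> close to an element of some finite level, and for large \<open>n\<close>
  it maps the matrix units of the first \<open>n + 1\<close> factors to matrix units of norm at most
  \<open>K = \<parallel>\<phi>\<parallel> \<gamma>\<^sub>\<kappa>(0) \<dots> \<gamma>\<^sub>\<kappa>(n)\<close>. An element of norm \<open>K\<close> has off-diagonal blocks of size at most
  \<open>K / \<gamma>\<^sub>\<mu>(n)\<close> with respect to the factors from \<open>n\<close> on, so compression to one diagonal block is
  multiplicative up to \<open>K\<^sup>2 / \<gamma>\<^sub>\<mu>(n)\<close> and almost fixes \<open>\<phi>(1)\<close>. This yields almost matrix units of size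
  \<open>d(0) \<dots> d(n)\<close> acting on a space of dimension \<open>d(0) \<dots> d(n - 1)\<close>, which is impossible.\<close>

section \<open>A transfinite sequence of rapidly growing functions\<close>

text \<open>The norm of an element of finite level is the supremum of finite-dimensional norms, one
  for each choice \<open>v\<close> of diagonal matrices, so both directions are decided on single
  fibres. In the negative direction only the norm \<open>C\<close> of a homomorphism can be used. It
  is unknown when the family is chosen, and the images of matrix units may need approximants of a
  level \<open>m\<close> far beyond \<open>n\<close>. The factor \<open>n\<close> in the growth
  condition eventually beats a multiple of \<open>C^2\<close>. Since the dominating sequence is
  nondecreasing, every factor from \<open>n\<close> to \<open>m - 1\<close> admits a diagonal entry
  of at least half its value at \<open>n\<close>; this isolates a block with only d(0)...d(n-1)
  coordinates, however large \<open>m\<close> is. An approximant of \<phi>(1) of level at most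
  \<open>n\<close> preserves this block and acts on it as at level \<open>n\<close>, so it cannot be
  small there on every fibre. The square of d(0)...d(n) comes from two sums over the matrix units,
  one in a linear dependence and one in \<phi>(1); the square of the lower sequence comes from the
  product of two elements of norm about \<open>C\<close> times d-independent weights.\<close>

lemma countable_ordinals_ordIso:
  assumes "\<kappa> \<in> countable_ordinals" "r \<in> \<kappa>" "s \<in> \<kappa>"
  shows "(r, s) \<in> ordIso"
proof -
  obtain t :: "nat rel" where "\<kappa> = ordIso `` {t}"
    using assms(1) unfolding countable_ordinals_def by (rule quotientE)
  then have "(t, r) \<in> ordIso" "(t, s) \<in> ordIso" using assms by auto
  then show ?thesis using ordIso_symmetric ordIso_transitive by blast
qed

lemma ordinal_less_iff:
  assumes "\<kappa> \<in> countable_ordinals" "\<mu> \<in> countable_ordinals" "r \<in> \<kappa>" "s \<in> \<mu>"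
  shows "ordinal_less \<kappa> \<mu> \<longleftrightarrow> (r, s) \<in> ordLess"
proof
  assume "ordinal_less \<kappa> \<mu>"
  then obtain r' s' where "r' \<in> \<kappa>" "s' \<in> \<mu>" "(r', s') \<in> ordLess" by (auto simp: ordinal_less_def)
  moreover have "(r, r') \<in> ordIso" "(s', s) \<in> ordIso"
    using countable_ordinals_ordIso assms \<open>r' \<in> \<kappa>\<close> \<open>s' \<in> \<mu>\<close> by auto
  ultimately show "(r, s) \<in> ordLess"
    using ordIso_ordLess_trans ordLess_ordIso_trans by blast
qed (use assms in \<open>auto simp: ordinal_less_def\<close>)

lemma countable_ordinals_nonempty: "\<kappa> \<in> countable_ordinals \<Longrightarrow> \<exists>r. r \<in> \<kappa>"
  by (auto simp: countable_ordinals_def quotient_def intro: ordIso_reflexive)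

text \<open>A choice of representatives embeds the relation on classes into \<open>ordLess\<close>,
  which is well-founded.\<close>

lemma wf_ordinal_less:
  "wf {(\<kappa>, \<mu>). \<kappa> \<in> countable_ordinals \<and> \<mu> \<in> countable_ordinals \<and> ordinal_less \<kappa> \<mu>}"
proof (rule wf_subset)
  show "wf (inv_image ordLess (\<lambda>\<kappa>::nat rel set. SOME r. r \<in> \<kappa>))"
    by (rule wf_inv_image[OF wf_ordLess])
  show "{(\<kappa>, \<mu>). \<kappa> \<in> countable_ordinals \<and> \<mu> \<in> countable_ordinals \<and> ordinal_less \<kappa> \<mu>}
    \<subseteq> inv_image ordLess (\<lambda>\<kappa>. SOME r. r \<in> \<kappa>)"
  proof clarify
    fix \<kappa> \<mu> assume *: "\<kappa> \<in> countable_ordinals" "\<mu> \<in> countable_ordinals" "ordinal_less \<kappa> \<mu>"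
    have "(SOME r. r \<in> \<kappa>) \<in> \<kappa>" "(SOME r. r \<in> \<mu>) \<in> \<mu>"
      using countable_ordinals_nonempty * by (auto intro: someI_ex)
    then show "(\<kappa>, \<mu>) \<in> inv_image ordLess (\<lambda>\<kappa>. SOME r. r \<in> \<kappa>)"
      using ordinal_less_iff * by auto
  qed
qed

text \<open>A well-order strictly below \<open>s\<close> is isomorphic to a proper initial segment
  of \<open>s\<close>, and these segments are indexed by natural numbers.\<close>

lemma countable_ordinals_below:
  assumes \<mu>: "\<mu> \<in> countable_ordinals"
  shows "countable {\<kappa> \<in> countable_ordinals. ordinal_less \<kappa> \<mu>}"
proof -
  obtain s where s: "s \<in> \<mu>" using countable_ordinals_nonempty[OF \<mu>] by auto
  have "{\<kappa> \<in> countable_ordinals. ordinal_less \<kappa> \<mu>} \<subseteq> range (\<lambda>a. ordIso `` {Restr s (underS s a)})"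
  proof clarify
    fix \<kappa> assume \<kappa>: "\<kappa> \<in> countable_ordinals" "ordinal_less \<kappa> \<mu>"
    obtain t :: "nat rel" where t: "\<kappa> = ordIso `` {t}" "Well_order t"
      using \<kappa>(1) unfolding countable_ordinals_def by (rule quotientE) simp
    then have "t \<in> \<kappa>" using ordIso_reflexive by auto
    then have "(t, s) \<in> ordLess" using ordinal_less_iff[OF \<kappa>(1) \<mu> _ s] \<kappa>(2) by blast
    moreover have "Well_order s" using calculation unfolding ordLess_def by auto
    ultimately obtain a where a: "(t, Restr s (underS s a)) \<in> ordIso"
      using ordLess_iff_ordIso_Restr[of s t] t(2) by auto
    have "\<kappa> = ordIso `` {Restr s (underS s a)}"
      unfolding t(1) using ordIso_transitive[OF a] ordIso_transitive[OF ordIso_symmetric[OF a]] by auto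
    then show "\<kappa> \<in> range (\<lambda>a. ordIso `` {Restr s (underS s a)})" by blast
  qed
  then show ?thesis by (rule countable_subset) simp
qed

text \<open>Well-founded recursion with a diagonal argument at each stage: one nondecreasing
  function eventually exceeds any countable list of functions. \<open>F\<close> takes the whole
  lower sequence as argument, since the growth condition at \<open>n\<close> involves all its values
  up to \<open>n\<close>.\<close>

lemma ordinal_family:
  fixes F :: "(nat \<Rightarrow> real) \<Rightarrow> nat \<Rightarrow> real"
  shows "\<exists>\<gamma> :: nat rel set \<Rightarrow> nat \<Rightarrow> real.
    (\<forall>\<kappa>\<in>countable_ordinals. mono (\<gamma> \<kappa>) \<and> (\<forall>n. 1 \<le> \<gamma> \<kappa> n)) \<and>
    (\<forall>\<kappa>\<in>countable_ordinals. \<forall>\<mu>\<in>countable_ordinals. ordinal_less \<kappa> \<mu> \<longrightarrow>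
      (\<forall>\<^sub>F n in sequentially. F (\<gamma> \<kappa>) n \<le> \<gamma> \<mu> n \<and> \<gamma> \<kappa> n \<le> \<gamma> \<mu> n))"
proof -
  let ?R = "{(\<kappa>, \<mu>). \<kappa> \<in> countable_ordinals \<and> \<mu> \<in> countable_ordinals \<and> ordinal_less \<kappa> \<mu>}"
  define P where "P g \<mu> f \<longleftrightarrow> mono f \<and> (\<forall>n. 1 \<le> f n) \<and>
    (\<forall>\<kappa>. (\<kappa>, \<mu>) \<in> ?R \<longrightarrow> (\<forall>\<^sub>F n in sequentially. F (g \<kappa>) n \<le> f n \<and> g \<kappa> n \<le> f n))"
    for g :: "nat rel set \<Rightarrow> nat \<Rightarrow> real" and \<mu> f
  have "\<exists>\<gamma>. \<forall>\<mu>. P \<gamma> \<mu> (\<gamma> \<mu>)"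
  proof (rule dependent_wf_choice[OF wf_ordinal_less])
    fix g g' :: "nat rel set \<Rightarrow> nat \<Rightarrow> real" and \<mu> f
    assume "\<And>z. (z, \<mu>) \<in> ?R \<Longrightarrow> g z = g' z"
    then show "P g \<mu> f = P g' \<mu> f" unfolding P_def by auto
  next
    fix \<mu> :: "nat rel set" and g :: "nat rel set \<Rightarrow> nat \<Rightarrow> real"
    let ?K = "{\<kappa>. (\<kappa>, \<mu>) \<in> ?R}"
    have K: "countable ?K"
    proof (cases "\<mu> \<in> countable_ordinals")
      case True
      then show ?thesis using countable_ordinals_below[OF True] by simp
    qed simp
    \<comment> \<open>If there are no predecessors the values of \<open>e\<close> are arbitrary;
      \<open>f\<close> is then still nondecreasing and at least 1, which is all that is asked. The
      sum runs over all \<open>i\<close> and \<open>m\<close> up to \<open>n\<close>: this makes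
      \<open>f\<close> nondecreasing, and the predecessor \<open>e i\<close> is dominated from index
      \<open>i\<close> on.\<close>
    define e where "e = from_nat_into ?K"
    define f where "f n = 1 + (\<Sum>i\<le>n. \<Sum>m\<le>n. \<bar>F (g (e i)) m\<bar> + \<bar>g (e i) m\<bar>)" for n
    have "mono f"
      unfolding f_def
      by (intro monoI add_left_mono order_trans[OF sum_mono sum_mono2] sum_mono2) (auto intro!: sum_nonneg)
    moreover have "1 \<le> f n" for n by (auto simp: f_def intro!: sum_nonneg)
    moreover have "\<forall>\<^sub>F n in sequentially. F (g \<kappa>) n \<le> f n \<and> g \<kappa> n \<le> f n" if "(\<kappa>, \<mu>) \<in> ?R" for \<kappa>
    proof -
      have "\<kappa> \<in> ?K" using that by simp
      from from_nat_into_surj[OF K this] obtain i where i: "e i = \<kappa>" unfolding e_def ..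
      have "\<bar>F (g \<kappa>) n\<bar> + \<bar>g \<kappa> n\<bar> \<le> f n" if "i \<le> n" for n
      proof -
        have "\<bar>F (g \<kappa>) n\<bar> + \<bar>g \<kappa> n\<bar> \<le> (\<Sum>m\<le>n. \<bar>F (g (e i)) m\<bar> + \<bar>g (e i) m\<bar>)"
          unfolding i by (rule member_le_sum) auto
        also have "\<dots> \<le> (\<Sum>i\<le>n. \<Sum>m\<le>n. \<bar>F (g (e i)) m\<bar> + \<bar>g (e i) m\<bar>)"
          using that by (intro member_le_sum[of i "{..n}" "\<lambda>i. \<Sum>m\<le>n. \<bar>F (g (e i)) m\<bar> + \<bar>g (e i) m\<bar>"])
            (auto intro!: sum_nonneg)
        finally show ?thesis by (simp add: f_def)
      qed
      then show ?thesis
        unfolding eventually_sequentially by (intro exI[of _ i]) (force)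
    qed
    ultimately show "\<exists>f. P g \<mu> f" unfolding P_def by blast
  qed
  then obtain \<gamma> where "\<And>\<mu>. P \<gamma> \<mu> (\<gamma> \<mu>)" by blast
  then show ?thesis unfolding P_def by (intro exI[of _ \<gamma>]) auto
qed

section \<open>Operators on normed spaces with carrier\<close>

locale cnormed =
  fixes E :: "'v normed_space"
  assumes zero_closed [simp, intro]: "vzero E \<in> vcarrier E"
    and add_closed [simp, intro]: "u \<in> vcarrier E \<Longrightarrow> v \<in> vcarrier E \<Longrightarrow> vadd E u v \<in> vcarrier E"
    and scale_closed [simp, intro]: "u \<in> vcarrier E \<Longrightarrow> vscale E c u \<in> vcarrier E"
    and add_assoc: "u \<in> vcarrier E \<Longrightarrow> v \<in> vcarrier E \<Longrightarrow> z \<in> vcarrier E \<Longrightarrow>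
      vadd E (vadd E u v) z = vadd E u (vadd E v z)"
    and add_commute: "u \<in> vcarrier E \<Longrightarrow> v \<in> vcarrier E \<Longrightarrow> vadd E u v = vadd E v u"
    and add_zero: "u \<in> vcarrier E \<Longrightarrow> vadd E u (vzero E) = u"
    and add_inv: "u \<in> vcarrier E \<Longrightarrow> vadd E u (vscale E (-1) u) = vzero E"
    and scale_scale: "u \<in> vcarrier E \<Longrightarrow> vscale E a (vscale E b u) = vscale E (a * b) u"
    and scale_one: "u \<in> vcarrier E \<Longrightarrow> vscale E 1 u = u"
    and scale_add: "u \<in> vcarrier E \<Longrightarrow> v \<in> vcarrier E \<Longrightarrow>
      vscale E a (vadd E u v) = vadd E (vscale E a u) (vscale E a v)"
    and add_scale: "u \<in> vcarrier E \<Longrightarrow> vscale E (a + b) u = vadd E (vscale E a u) (vscale E b u)"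
    and norm_nonneg [simp]: "u \<in> vcarrier E \<Longrightarrow> 0 \<le> vnorm E u"
    and norm_eq_zero: "u \<in> vcarrier E \<Longrightarrow> vnorm E u = 0 \<Longrightarrow> u = vzero E"
    and norm_add: "u \<in> vcarrier E \<Longrightarrow> v \<in> vcarrier E \<Longrightarrow> vnorm E (vadd E u v) \<le> vnorm E u + vnorm E v"
    and norm_scale: "u \<in> vcarrier E \<Longrightarrow> vnorm E (vscale E c u) = cmod c * vnorm E u"
begin

definition vdist :: "'v \<Rightarrow> 'v \<Rightarrow> real" where
  "vdist u v = vnorm E (vadd E u (vscale E (-1) v))"

lemma add_left_commute:
  "u \<in> vcarrier E \<Longrightarrow> v \<in> vcarrier E \<Longrightarrow> z \<in> vcarrier E \<Longrightarrow>
    vadd E u (vadd E v z) = vadd E v (vadd E u z)"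
  by (metis add_assoc add_commute)

lemma scale_zero_left: "u \<in> vcarrier E \<Longrightarrow> vscale E 0 u = vzero E"
  using add_scale[of u 1 "-1"] by (simp add: scale_one add_inv)

lemma scale_zero_right: "vscale E c (vzero E) = vzero E"
proof -
  have "vscale E c (vscale E 0 (vzero E)) = vscale E (c * 0) (vzero E)"
    by (rule scale_scale) simp
  then show ?thesis by (simp add: scale_zero_left)
qed

lemma norm_zero: "vnorm E (vzero E) = 0"
  using norm_scale[of "vzero E" 0] by (simp add: scale_zero_left)

lemma zero_add: "u \<in> vcarrier E \<Longrightarrow> vadd E (vzero E) u = u"
  using add_commute[of u "vzero E"] by (simp add: add_zero)

lemma add_inv_left: "u \<in> vcarrier E \<Longrightarrow> vadd E (vscale E (-1) u) u = vzero E"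
  using add_commute[of u "vscale E (-1) u"] by (simp add: add_inv)

lemma vdist_nonneg [simp]: "u \<in> vcarrier E \<Longrightarrow> v \<in> vcarrier E \<Longrightarrow> 0 \<le> vdist u v"
  by (simp add: vdist_def)

lemma vdist_zero_right: "u \<in> vcarrier E \<Longrightarrow> vdist u (vzero E) = vnorm E u"
  by (simp add: vdist_def scale_zero_right add_zero)

lemma vdist_self: "u \<in> vcarrier E \<Longrightarrow> vdist u u = 0"
  by (simp add: vdist_def add_inv norm_zero)

lemma vdist_eq_zero:
  assumes "u \<in> vcarrier E" "v \<in> vcarrier E" "vdist u v = 0"
  shows "u = v"
proof -
  have *: "vadd E u (vscale E (-1) v) = vzero E"
    using assms norm_eq_zero by (simp add: vdist_def)
  have "u = vadd E u (vadd E (vscale E (-1) v) v)"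
    using assms by (simp add: add_zero add_inv_left)
  also have "\<dots> = vadd E (vzero E) v"
    using assms by (simp flip: * add: add_assoc)
  finally show ?thesis using assms by (simp add: zero_add)
qed

lemma vdist_scale:
  assumes "u \<in> vcarrier E" "v \<in> vcarrier E"
  shows "vdist (vscale E c u) (vscale E c v) = cmod c * vdist u v"
proof -
  have "vadd E (vscale E c u) (vscale E (-1) (vscale E c v)) = vscale E c (vadd E u (vscale E (-1) v))"
    using assms by (simp add: scale_scale scale_add)
  then show ?thesis using assms by (simp add: vdist_def norm_scale)
qed

lemma vdist_commute:
  assumes "u \<in> vcarrier E" "v \<in> vcarrier E"
  shows "vdist u v = vdist v u"
proof -
  have "vdist u v = cmod (-1) * vdist u v" by simp
  also have "\<dots> = vdist (vscale E (-1) u) (vscale E (-1) v)"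
    using assms by (simp add: vdist_scale)
  also have "\<dots> = vdist v u"
    using assms by (simp add: vdist_def scale_scale scale_one add_commute)
  finally show ?thesis .
qed

lemma vdist_add:
  assumes "u \<in> vcarrier E" "v \<in> vcarrier E" "u' \<in> vcarrier E" "v' \<in> vcarrier E"
  shows "vdist (vadd E u v) (vadd E u' v') \<le> vdist u u' + vdist v v'"
proof -
  have "vadd E (vadd E u v) (vscale E (-1) (vadd E u' v')) =
        vadd E (vadd E u (vscale E (-1) u')) (vadd E v (vscale E (-1) v'))"
    using assms by (simp add: scale_add add_assoc add_left_commute)
  then show ?thesis using assms norm_add by (simp add: vdist_def)
qed

lemma vdist_triangle:
  assumes "u \<in> vcarrier E" "v \<in> vcarrier E" "z \<in> vcarrier E"
  shows "vdist u z \<le> vdist u v + vdist v z"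
proof -
  have "vadd E (vadd E u (vscale E (-1) v)) (vadd E v (vscale E (-1) z)) =
     vadd E u (vadd E (vadd E (vscale E (-1) v) v) (vscale E (-1) z))"
    using assms by (simp add: add_assoc)
  also have "\<dots> = vadd E u (vscale E (-1) z)"
    using assms by (simp add: add_inv_left zero_add)
  finally show ?thesis
    using assms norm_add[of "vadd E u (vscale E (-1) v)" "vadd E v (vscale E (-1) z)"]
    by (simp add: vdist_def)
qed

lemma norm_le_vdist: "u \<in> vcarrier E \<Longrightarrow> v \<in> vcarrier E \<Longrightarrow> vnorm E u \<le> vnorm E v + vdist u v"
  using vdist_triangle[of u v "vzero E"] by (simp add: vdist_zero_right)

definition op_bound :: "('v \<Rightarrow> 'v) \<Rightarrow> real \<Rightarrow> bool" where
  "op_bound T C \<longleftrightarrow> (\<forall>v\<in>vcarrier E. vnorm E (T v) \<le> C * vnorm E v)"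

lemma bounded_opsD:
  assumes "T \<in> bounded_ops E"
  shows "v \<in> vcarrier E \<Longrightarrow> T v \<in> vcarrier E"
    and "u \<in> vcarrier E \<Longrightarrow> v \<in> vcarrier E \<Longrightarrow> T (vadd E u v) = vadd E (T u) (T v)"
    and "v \<in> vcarrier E \<Longrightarrow> T (vscale E c v) = vscale E c (T v)"
    and "v \<notin> vcarrier E \<Longrightarrow> T v = undefined"
  using assms by (auto simp: bounded_ops_def PiE_def extensional_def)

lemma bounded_op_zero: "T \<in> bounded_ops E \<Longrightarrow> T (vzero E) = vzero E"
  using bounded_opsD(3)[of T "vzero E" 0] by (simp add: scale_zero_left bounded_opsD(1))

lemma bounded_op_vdist:
  assumes "T \<in> bounded_ops E" "u \<in> vcarrier E" "v \<in> vcarrier E"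
  shows "vdist (T u) (T v) = vnorm E (T (vadd E u (vscale E (-1) v)))"
  using assms by (simp add: vdist_def bounded_opsD)

lemma bounded_ops_eqI:
  assumes "S \<in> bounded_ops E" "T \<in> bounded_ops E" "\<And>v. v \<in> vcarrier E \<Longrightarrow> S v = T v"
  shows "S = T"
  using assms bounded_opsD(4) by (intro ext) metis

lemma bounded_opsI:
  assumes "T \<in> extensional (vcarrier E)"
    and "\<And>v. v \<in> vcarrier E \<Longrightarrow> T v \<in> vcarrier E"
    and "\<And>u v. u \<in> vcarrier E \<Longrightarrow> v \<in> vcarrier E \<Longrightarrow> T (vadd E u v) = vadd E (T u) (T v)"
    and "\<And>c v. v \<in> vcarrier E \<Longrightarrow> T (vscale E c v) = vscale E c (T v)"
    and "\<And>v. v \<in> vcarrier E \<Longrightarrow> vnorm E (T v) \<le> C * vnorm E v"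
  shows "T \<in> bounded_ops E"
proof -
  have "\<exists>C. \<forall>v\<in>vcarrier E. vnorm E (T v) \<le> C * vnorm E v" using assms(5) by blast
  then show ?thesis using assms(1-4) by (simp add: bounded_ops_def PiE_def)
qed

lemma op_norm_le:
  assumes "T \<in> bounded_ops E" "0 \<le> C" "op_bound T C"
  shows "op_norm E T \<le> C"
  unfolding op_norm_def
proof (rule cSup_least)
  show "{vnorm E (T v) |v. v \<in> vcarrier E \<and> vnorm E v \<le> 1} \<noteq> {}"
    using norm_zero by auto
  fix x assume "x \<in> {vnorm E (T v) |v. v \<in> vcarrier E \<and> vnorm E v \<le> 1}"
  then obtain v where v: "v \<in> vcarrier E" "vnorm E v \<le> 1" "x = vnorm E (T v)" by auto
  have "vnorm E (T v) \<le> C * vnorm E v" using assms v by (auto simp: op_bound_def)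
  also have "\<dots> \<le> C * 1" using v assms by (intro mult_left_mono) auto
  finally show "x \<le> C" using v by simp
qed

lemma op_norm_upper:
  assumes T: "T \<in> bounded_ops E" and v: "v \<in> vcarrier E" "vnorm E v \<le> 1"
  shows "vnorm E (T v) \<le> op_norm E T"
  unfolding op_norm_def
proof (rule cSup_upper)
  show "vnorm E (T v) \<in> {vnorm E (T v) |v. v \<in> vcarrier E \<and> vnorm E v \<le> 1}" using v by auto
  obtain C where C: "\<forall>v\<in>vcarrier E. vnorm E (T v) \<le> C * vnorm E v"
    using T by (auto simp: bounded_ops_def)
  show "bdd_above {vnorm E (T v) |v. v \<in> vcarrier E \<and> vnorm E v \<le> 1}"
  proof (rule bdd_aboveI[of _ "\<bar>C\<bar>"], clarify)
    fix u assume u: "u \<in> vcarrier E" "vnorm E u \<le> 1"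
    have "vnorm E (T u) \<le> C * vnorm E u" using C u by auto
    also have "\<dots> \<le> \<bar>C\<bar> * vnorm E u" using u by (intro mult_right_mono) auto
    also have "\<dots> \<le> \<bar>C\<bar> * 1" using u by (intro mult_left_mono) auto
    finally show "vnorm E (T u) \<le> \<bar>C\<bar>" by simp
  qed
qed

lemma op_norm_nonneg: "T \<in> bounded_ops E \<Longrightarrow> 0 \<le> op_norm E T"
  using op_norm_upper[of T "vzero E"] by (simp add: norm_zero bounded_op_zero)

lemma op_bound_op_norm:
  assumes T: "T \<in> bounded_ops E" shows "op_bound T (op_norm E T)"
  unfolding op_bound_def
proof
  fix v assume v: "v \<in> vcarrier E"
  show "vnorm E (T v) \<le> op_norm E T * vnorm E v"
  proof (cases "vnorm E v = 0")
    case True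
    then show ?thesis using v norm_eq_zero[of v] by (simp add: bounded_op_zero[OF T] norm_zero)
  next
    case False
    then have pos: "vnorm E v > 0" using v norm_nonneg[of v] by linarith
    let ?c = "complex_of_real (1 / vnorm E v)"
    have "vnorm E (T (vscale E ?c v)) \<le> op_norm E T"
      using v pos by (intro op_norm_upper[OF T]) (auto simp: norm_scale norm_divide)
    then show ?thesis
      using v pos by (simp add: bounded_opsD[OF T] norm_scale norm_divide field_simps)
  qed
qed

lemma norm_op_le: "T \<in> bounded_ops E \<Longrightarrow> v \<in> vcarrier E \<Longrightarrow> vnorm E (T v) \<le> op_norm E T * vnorm E v"
  using op_bound_op_norm by (auto simp: op_bound_def)

lemma op_zero_apply: "v \<in> vcarrier E \<Longrightarrow> op_zero E v = vzero E"
  and op_one_apply: "v \<in> vcarrier E \<Longrightarrow> op_one E v = v"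
  by (simp_all add: op_zero_def op_one_def)

lemma op_zero_in [simp]: "op_zero E \<in> bounded_ops E"
  by (rule bounded_opsI[where C = 0]) (auto simp: op_zero_def add_zero scale_zero_right norm_zero)

lemma op_one_in [simp]: "op_one E \<in> bounded_ops E"
  by (rule bounded_opsI[where C = 1]) (auto simp: op_one_def)

lemma op_add_in [simp]:
  assumes S: "S \<in> bounded_ops E" and T: "T \<in> bounded_ops E"
  shows "op_add E S T \<in> bounded_ops E"
proof (rule bounded_opsI[where C = "op_norm E S + op_norm E T"])
  fix v assume v: "v \<in> vcarrier E"
  have "vnorm E (op_add E S T v) \<le> vnorm E (S v) + vnorm E (T v)"
    using v S T by (simp add: op_add_def norm_add bounded_opsD)
  also have "\<dots> \<le> op_norm E S * vnorm E v + op_norm E T * vnorm E v"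
    using v S T by (intro add_mono norm_op_le) auto
  finally show "vnorm E (op_add E S T v) \<le> (op_norm E S + op_norm E T) * vnorm E v"
    by (simp add: algebra_simps)
qed (use S T in \<open>auto simp: op_add_def bounded_opsD scale_add add_assoc add_left_commute\<close>)

lemma op_scale_in [simp]:
  assumes S: "S \<in> bounded_ops E" shows "op_scale E c S \<in> bounded_ops E"
proof (rule bounded_opsI[where C = "cmod c * op_norm E S"])
  fix v assume v: "v \<in> vcarrier E"
  have "vnorm E (op_scale E c S v) = cmod c * vnorm E (S v)"
    using v S by (simp add: op_scale_def norm_scale bounded_opsD)
  also have "\<dots> \<le> cmod c * (op_norm E S * vnorm E v)"
    by (intro mult_left_mono norm_op_le S v) simp
  finally show "vnorm E (op_scale E c S v) \<le> cmod c * op_norm E S * vnorm E v"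
    by (simp add: mult.assoc)
next
  fix a v assume v: "v \<in> vcarrier E"
  then show "op_scale E c S (vscale E a v) = vscale E a (op_scale E c S v)"
    using S by (simp add: op_scale_def bounded_opsD scale_scale mult.commute[of a c])
qed (use S in \<open>simp_all add: op_scale_def bounded_opsD scale_add\<close>)

lemma op_mult_apply: "v \<in> vcarrier E \<Longrightarrow> op_mult E S T v = S (T v)"
  by (simp add: op_mult_def compose_def)

lemma op_mult_in [simp]:
  assumes S: "S \<in> bounded_ops E" and T: "T \<in> bounded_ops E"
  shows "op_mult E S T \<in> bounded_ops E"
proof (rule bounded_opsI[where C = "op_norm E S * op_norm E T"])
  fix v assume v: "v \<in> vcarrier E"
  have "vnorm E (S (T v)) \<le> op_norm E S * vnorm E (T v)"
    using v S T by (intro norm_op_le) (auto simp: bounded_opsD)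
  also have "\<dots> \<le> op_norm E S * (op_norm E T * vnorm E v)"
    using v S T by (intro mult_left_mono norm_op_le op_norm_nonneg)
  finally show "vnorm E (op_mult E S T v) \<le> op_norm E S * op_norm E T * vnorm E v"
    using v by (simp add: op_mult_apply algebra_simps)
qed (use S T in \<open>auto simp: op_mult_def compose_def bounded_opsD\<close>)

lemma op_dist_le:
  assumes S: "S \<in> bounded_ops E" and T: "T \<in> bounded_ops E" and C: "0 \<le> C"
    and "\<And>v. v \<in> vcarrier E \<Longrightarrow> vdist (S v) (T v) \<le> C * vnorm E v"
  shows "op_dist E S T \<le> C"
proof -
  have "op_norm E (op_add E S (op_scale E (-1) T)) \<le> C"
  proof (rule op_norm_le)
    show "op_bound (op_add E S (op_scale E (-1) T)) C"
      using assms by (simp add: op_bound_def vdist_def op_add_def op_scale_def)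
  qed (use S T C in auto)
  then show ?thesis using S T by (simp add: op_dist_def)
qed

lemma vdist_op_le:
  assumes S: "S \<in> bounded_ops E" and T: "T \<in> bounded_ops E" and v: "v \<in> vcarrier E"
  shows "vdist (S v) (T v) \<le> op_dist E S T * vnorm E v"
proof -
  have "vnorm E ((op_add E S (op_scale E (-1) T)) v) \<le> op_norm E (op_add E S (op_scale E (-1) T)) * vnorm E v"
    using assms by (intro norm_op_le) auto
  then show ?thesis using assms by (simp add: op_dist_def vdist_def op_add_def op_scale_def)
qed

lemma op_dist_nonneg [simp]: "0 \<le> op_dist E S T"
  by (simp add: op_dist_def op_norm_nonneg)

lemma op_dist_self: "S \<in> bounded_ops E \<Longrightarrow> op_dist E S S = 0"
  by (intro antisym op_dist_le) (auto simp: vdist_self bounded_opsD)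

lemma op_dist_eq_zero:
  assumes "S \<in> bounded_ops E" "T \<in> bounded_ops E" "op_dist E S T = 0"
  shows "S = T"
proof (rule bounded_ops_eqI[OF assms(1,2)])
  fix v assume v: "v \<in> vcarrier E"
  have m: "S v \<in> vcarrier E" "T v \<in> vcarrier E" using assms(1,2) v by (auto dest: bounded_opsD(1))
  have "vdist (S v) (T v) \<le> 0" using vdist_op_le[OF assms(1,2) v] assms(3) by simp
  then have "vdist (S v) (T v) = 0" using vdist_nonneg[OF m] by linarith
  then show "S v = T v" by (rule vdist_eq_zero[OF m])
qed

lemma op_dist_commute: "op_dist E S T = op_dist E T S"
proof -
  have "op_dist E S T \<le> op_dist E T S" if "S \<in> bounded_ops E" "T \<in> bounded_ops E" for S T
  proof (rule op_dist_le[OF that])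
    fix v assume v: "v \<in> vcarrier E"
    then show "vdist (S v) (T v) \<le> op_dist E T S * vnorm E v"
      using vdist_op_le[OF that(2,1) v] vdist_commute[of "S v" "T v"] that by (simp add: bounded_opsD)
  qed (use that in \<open>simp add: op_dist_def op_norm_nonneg\<close>)
  then show ?thesis
    by (cases "S \<in> bounded_ops E \<and> T \<in> bounded_ops E") (auto simp: op_dist_def intro: antisym)
qed

lemma op_dist_triangle:
  assumes "S \<in> bounded_ops E" "T \<in> bounded_ops E" "U \<in> bounded_ops E"
  shows "op_dist E S U \<le> op_dist E S T + op_dist E T U"
proof (rule op_dist_le)
  fix v assume v: "v \<in> vcarrier E"
  have "vdist (S v) (U v) \<le> vdist (S v) (T v) + vdist (T v) (U v)"
    using assms v by (intro vdist_triangle) (auto simp: bounded_opsD)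
  also have "\<dots> \<le> op_dist E S T * vnorm E v + op_dist E T U * vnorm E v"
    using assms v by (intro add_mono vdist_op_le)
  finally show "vdist (S v) (U v) \<le> (op_dist E S T + op_dist E T U) * vnorm E v"
    by (simp add: algebra_simps)
qed (use assms in auto)

lemma Metric_space_ops: "A \<subseteq> bounded_ops E \<Longrightarrow> Metric_space A (op_dist E)"
  by standard (auto simp: op_dist_commute op_dist_triangle subset_eq op_dist_self op_dist_eq_zero)

lemma op_dist_add:
  assumes "S \<in> bounded_ops E" "T \<in> bounded_ops E" "S' \<in> bounded_ops E" "T' \<in> bounded_ops E"
  shows "op_dist E (op_add E S T) (op_add E S' T') \<le> op_dist E S S' + op_dist E T T'"
proof (rule op_dist_le)
  fix v assume v: "v \<in> vcarrier E"
  have "vdist (vadd E (S v) (T v)) (vadd E (S' v) (T' v)) \<le> vdist (S v) (S' v) + vdist (T v) (T' v)"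
    using assms v by (intro vdist_add) (auto simp: bounded_opsD)
  also have "\<dots> \<le> op_dist E S S' * vnorm E v + op_dist E T T' * vnorm E v"
    using assms v by (intro add_mono vdist_op_le)
  finally show "vdist (op_add E S T v) (op_add E S' T' v) \<le> (op_dist E S S' + op_dist E T T') * vnorm E v"
    using v by (simp add: algebra_simps op_add_def)
qed (use assms in auto)

lemma op_dist_scale:
  assumes "S \<in> bounded_ops E" "T \<in> bounded_ops E"
  shows "op_dist E (op_scale E c S) (op_scale E c T) \<le> cmod c * op_dist E S T"
proof (rule op_dist_le)
  fix v assume v: "v \<in> vcarrier E"
  then show "vdist (op_scale E c S v) (op_scale E c T v) \<le> cmod c * op_dist E S T * vnorm E v"
    using assms vdist_op_le[OF assms v]
    by (simp add: op_scale_def vdist_scale bounded_opsD mult.assoc mult_left_mono)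
qed (use assms in auto)

lemma op_dist_mult:
  assumes "S \<in> bounded_ops E" "T \<in> bounded_ops E" "S' \<in> bounded_ops E" "T' \<in> bounded_ops E"
  shows "op_dist E (op_mult E S T) (op_mult E S' T') \<le> op_dist E S S' * op_norm E T + op_norm E S' * op_dist E T T'"
proof (rule op_dist_le)
  fix v assume v: "v \<in> vcarrier E"
  have "vdist (S (T v)) (S' (T' v)) \<le> vdist (S (T v)) (S' (T v)) + vdist (S' (T v)) (S' (T' v))"
    using assms v by (intro vdist_triangle) (auto simp: bounded_opsD)
  also have "vdist (S (T v)) (S' (T v)) \<le> op_dist E S S' * (op_norm E T * vnorm E v)"
    using assms v by (intro order_trans[OF vdist_op_le] mult_left_mono norm_op_le) (auto simp: bounded_opsD)
  also have "vdist (S' (T v)) (S' (T' v)) \<le> op_norm E S' * vdist (T v) (T' v)"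
    using assms v by (simp add: bounded_op_vdist bounded_opsD(1)[of T] bounded_opsD(1)[of T'])
      (simp add: vdist_def norm_op_le bounded_opsD(1))
  also have "\<dots> \<le> op_norm E S' * (op_dist E T T' * vnorm E v)"
    using assms v by (intro mult_left_mono vdist_op_le op_norm_nonneg)
  finally show "vdist (op_mult E S T v) (op_mult E S' T' v) \<le>
      (op_dist E S S' * op_norm E T + op_norm E S' * op_dist E T T') * vnorm E v"
    using v by (simp add: algebra_simps op_mult_apply)
qed (use assms in \<open>auto intro!: add_nonneg_nonneg mult_nonneg_nonneg op_norm_nonneg\<close>)

lemma op_norm_le_dist:
  assumes "S \<in> bounded_ops E" "T \<in> bounded_ops E"
  shows "op_norm E S \<le> op_norm E T + op_dist E S T"
proof (rule op_norm_le)
  show "op_bound S (op_norm E T + op_dist E S T)"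
    unfolding op_bound_def
  proof
    fix v assume v: "v \<in> vcarrier E"
    have "vnorm E (S v) \<le> vnorm E (T v) + vdist (S v) (T v)"
      using assms v by (intro norm_le_vdist) (auto simp: bounded_opsD)
    also have "\<dots> \<le> op_norm E T * vnorm E v + op_dist E S T * vnorm E v"
      using assms v by (intro add_mono norm_op_le vdist_op_le)
    finally show "vnorm E (S v) \<le> (op_norm E T + op_dist E S T) * vnorm E v"
      by (simp add: algebra_simps)
  qed
qed (use assms in \<open>auto intro!: add_nonneg_nonneg op_norm_nonneg\<close>)

lemma op_norm_op_zero: "op_norm E (op_zero E) = 0"
  by (intro antisym op_norm_le op_norm_nonneg) (auto simp: op_bound_def op_zero_apply norm_zero)

lemma op_dist_zero:
  assumes "S \<in> bounded_ops E" shows "op_dist E S (op_zero E) = op_norm E S"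
proof (rule antisym)
  show "op_dist E S (op_zero E) \<le> op_norm E S"
    using assms by (intro op_dist_le op_norm_nonneg)
      (auto simp: op_zero_apply vdist_zero_right bounded_opsD norm_op_le)
  show "op_norm E S \<le> op_dist E S (op_zero E)"
    using op_norm_le_dist[OF assms op_zero_in] by (simp add: op_norm_op_zero)
qed

lemma op_norm_mult_le:
  assumes "S \<in> bounded_ops E" "T \<in> bounded_ops E"
  shows "op_norm E (op_mult E S T) \<le> op_norm E S * op_norm E T"
proof (rule op_norm_le)
  show "op_bound (op_mult E S T) (op_norm E S * op_norm E T)"
    unfolding op_bound_def
  proof
    fix v assume v: "v \<in> vcarrier E"
    have "vnorm E (S (T v)) \<le> op_norm E S * vnorm E (T v)"
      using assms v by (intro norm_op_le) (auto simp: bounded_opsD)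
    also have "\<dots> \<le> op_norm E S * (op_norm E T * vnorm E v)"
      using assms v by (intro mult_left_mono norm_op_le op_norm_nonneg)
    finally show "vnorm E (op_mult E S T v) \<le> op_norm E S * op_norm E T * vnorm E v"
      using v by (simp add: op_mult_apply algebra_simps)
  qed
qed (use assms op_norm_nonneg in auto)

lemma op_norm_scale_le:
  assumes "S \<in> bounded_ops E"
  shows "op_norm E (op_scale E c S) \<le> cmod c * op_norm E S"
proof (rule op_norm_le)
  show "op_bound (op_scale E c S) (cmod c * op_norm E S)"
    using assms by (auto simp: op_bound_def op_scale_def norm_scale bounded_opsD mult.assoc
        intro!: mult_left_mono norm_op_le)
qed (use assms op_norm_nonneg in auto)

lemma op_mult_one_left: "T \<in> bounded_ops E \<Longrightarrow> op_mult E (op_one E) T = T"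
  by (intro bounded_ops_eqI) (auto simp: op_mult_apply op_one_apply bounded_opsD)

text \<open>Submultiplicativity gives norm(e) \<le> norm(e)^2. This keeps the image of the unit away
  from 0 in the negative direction.\<close>

lemma op_norm_idempotent:
  assumes "e \<in> bounded_ops E" "op_mult E e e = e" "e \<noteq> op_zero E"
  shows "1 \<le> op_norm E e"
proof -
  have "op_norm E e \<noteq> 0"
    using op_dist_eq_zero[of e "op_zero E"] assms by (auto simp: op_dist_zero)
  then have "op_norm E e > 0" using op_norm_nonneg[OF assms(1)] by linarith
  moreover have "op_norm E e * 1 \<le> op_norm E e * op_norm E e"
    using op_norm_mult_le[of e e] assms by simp
  ultimately show ?thesis by simp
qed

lemma op_add_continuous:
  assumes "S \<in> bounded_ops E" "T \<in> bounded_ops E" "\<epsilon> > 0"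
  shows "\<exists>\<delta>>0. \<forall>S'\<in>bounded_ops E. \<forall>T'\<in>bounded_ops E. op_dist E S S' < \<delta> \<longrightarrow> op_dist E T T' < \<delta> \<longrightarrow>
    op_dist E (op_add E S T) (op_add E S' T') < \<epsilon>"
proof (intro exI[of _ "\<epsilon>/2"] conjI ballI impI)
  fix S' T' assume "S' \<in> bounded_ops E" "T' \<in> bounded_ops E" "op_dist E S S' < \<epsilon>/2" "op_dist E T T' < \<epsilon>/2"
  then show "op_dist E (op_add E S T) (op_add E S' T') < \<epsilon>"
    using op_dist_add[OF assms(1,2), of S' T'] by simp
qed (use assms in auto)

lemma op_mult_continuous:
  assumes ST: "S \<in> bounded_ops E" "T \<in> bounded_ops E" and "\<epsilon> > 0"
  shows "\<exists>\<delta>>0. \<forall>S'\<in>bounded_ops E. \<forall>T'\<in>bounded_ops E. op_dist E S S' < \<delta> \<longrightarrow> op_dist E T T' < \<delta> \<longrightarrow>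
    op_dist E (op_mult E S T) (op_mult E S' T') < \<epsilon>"
proof -
  define K where "K = 1 + op_norm E S + op_norm E T"
  \<comment> \<open>The cap 1 keeps the norm of \<open>S'\<close> below \<open>K\<close>; the other
    bound makes \<open>2 * K * \<delta>\<close> at most \<open>\<epsilon>\<close>.\<close>
  define \<delta> where "\<delta> = min 1 (\<epsilon> / (2 * K))"
  have K: "K \<ge> 1" "op_norm E T \<le> K" "op_norm E S + 1 \<le> K"
    using ST op_norm_nonneg by (auto simp: K_def)
  have \<delta>: "\<delta> > 0" "\<delta> \<le> 1" "\<delta> * (2 * K) \<le> \<epsilon>"
    using K \<open>\<epsilon> > 0\<close> by (auto simp: \<delta>_def min_def field_simps)
  have "op_dist E (op_mult E S T) (op_mult E S' T') < \<epsilon>"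
    if b: "S' \<in> bounded_ops E" "T' \<in> bounded_ops E" and S': "op_dist E S S' < \<delta>" and T': "op_dist E T T' < \<delta>" for S' T'
  proof -
    have "op_norm E S' \<le> K"
      using op_norm_le_dist[OF b(1) ST(1)] S' \<delta> K by (simp add: op_dist_commute)
    have "op_dist E (op_mult E S T) (op_mult E S' T') \<le> op_dist E S S' * op_norm E T + op_norm E S' * op_dist E T T'"
      using ST b by (intro op_dist_mult) auto
    also have "\<dots> \<le> op_dist E S S' * K + K * op_dist E T T'"
      using K \<open>op_norm E S' \<le> K\<close> op_norm_nonneg[OF ST(2)] by (intro add_mono mult_mono) auto
    also have "\<dots> = K * (op_dist E S S' + op_dist E T T')" by (simp add: algebra_simps)
    also have "\<dots> < K * (2 * \<delta>)" using K S' T' by (intro mult_strict_left_mono) auto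
    also have "\<dots> \<le> \<epsilon>" using \<delta> by (simp add: algebra_simps)
    finally show ?thesis .
  qed
  then show ?thesis using \<delta> by blast
qed

lemma op_scale_continuous:
  assumes "T \<in> bounded_ops E" "\<epsilon> > 0"
  shows "\<exists>\<delta>>0. \<forall>S\<in>bounded_ops E. op_dist E T S < \<delta> \<longrightarrow> op_dist E (op_scale E c T) (op_scale E c S) < \<epsilon>"
proof (intro exI[of _ "\<epsilon> / (cmod c + 1)"] conjI ballI impI)
  fix S assume S: "S \<in> bounded_ops E" "op_dist E T S < \<epsilon> / (cmod c + 1)"
  have "op_dist E (op_scale E c T) (op_scale E c S) \<le> cmod c * op_dist E T S"
    using S assms by (intro op_dist_scale) auto
  also have "\<dots> \<le> (cmod c + 1) * op_dist E T S" by (intro mult_right_mono) auto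
  also have "\<dots> < \<epsilon>" using S by (simp add: pos_less_divide_eq add_nonneg_pos mult.commute)
  finally show "op_dist E (op_scale E c T) (op_scale E c S) < \<epsilon>" .
qed (use assms in \<open>simp add: add_nonneg_pos\<close>)

definition op_closure :: "('v \<Rightarrow> 'v) set \<Rightarrow> ('v \<Rightarrow> 'v) set" where
  "op_closure A = {T \<in> bounded_ops E. \<forall>\<epsilon>>0. \<exists>S\<in>A. op_dist E T S < \<epsilon>}"

lemma op_closure_bounded: "op_closure A \<subseteq> bounded_ops E"
  by (auto simp: op_closure_def)

lemma op_closure_subset: "A \<subseteq> bounded_ops E \<Longrightarrow> A \<subseteq> op_closure A"
  unfolding op_closure_def by (force simp: op_dist_self)

lemma op_closure_minimal:
  assumes "closedin (norm_topology E (bounded_ops E)) D" "A \<subseteq> D"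
  shows "op_closure A \<subseteq> D"
proof
  interpret Metric_space "bounded_ops E" "op_dist E" by (rule Metric_space_ops) simp
  fix T assume T: "T \<in> op_closure A"
  show "T \<in> D"
  proof (rule ccontr)
    assume "T \<notin> D"
    then obtain r where "r > 0" "disjnt D (mball T r)"
      using assms(1) T unfolding norm_topology_def closedin_metric op_closure_def by blast
    moreover obtain S where "S \<in> A" "op_dist E T S < r" using T \<open>r > 0\<close> by (auto simp: op_closure_def)
    moreover have "D \<subseteq> bounded_ops E" using assms(1) closedin_metric by (auto simp: norm_topology_def)
    ultimately show False using assms(2) T by (auto simp: disjnt_iff op_closure_def)
  qed
qed

lemma closed_subalgebra_closure:
  assumes A: "A \<subseteq> bounded_ops E" "op_zero E \<in> A"
    and add: "\<And>S T. S \<in> A \<Longrightarrow> T \<in> A \<Longrightarrow> op_add E S T \<in> A"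
    and mult: "\<And>S T. S \<in> A \<Longrightarrow> T \<in> A \<Longrightarrow> op_mult E S T \<in> A"
    and scale: "\<And>c T. T \<in> A \<Longrightarrow> op_scale E c T \<in> A"
  shows "closed_subalgebra E (op_closure A)"
  unfolding closed_subalgebra_def
proof (intro conjI ballI allI)
  show "op_closure A \<subseteq> bounded_ops E" by (rule op_closure_bounded)
  show "op_zero E \<in> op_closure A" using op_closure_subset[OF A(1)] A(2) by auto
next
  fix S T assume "S \<in> op_closure A" "T \<in> op_closure A"
  then have ST: "S \<in> bounded_ops E" "T \<in> bounded_ops E"
    and S: "\<And>\<epsilon>. \<epsilon> > 0 \<Longrightarrow> \<exists>S'\<in>A. op_dist E S S' < \<epsilon>"
    and T: "\<And>\<epsilon>. \<epsilon> > 0 \<Longrightarrow> \<exists>T'\<in>A. op_dist E T T' < \<epsilon>"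
    by (auto simp: op_closure_def)
  show "op_add E S T \<in> op_closure A"
    unfolding op_closure_def using ST
  proof safe
    fix \<epsilon> :: real assume "\<epsilon> > 0"
    then obtain \<delta> where \<delta>: "\<delta> > 0" "\<And>S' T'. S' \<in> bounded_ops E \<Longrightarrow> T' \<in> bounded_ops E \<Longrightarrow>
        op_dist E S S' < \<delta> \<Longrightarrow> op_dist E T T' < \<delta> \<Longrightarrow> op_dist E (op_add E S T) (op_add E S' T') < \<epsilon>"
      using op_add_continuous[OF ST, of \<epsilon>] by blast
    obtain S' T' where "S' \<in> A" "T' \<in> A" "op_dist E S S' < \<delta>" "op_dist E T T' < \<delta>"
      using S T \<delta>(1) by blast
    then show "\<exists>U\<in>A. op_dist E (op_add E S T) U < \<epsilon>"
      using A(1) add \<delta>(2)[of S' T'] by (intro bexI[of _ "op_add E S' T'"]) auto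
  qed simp
  show "op_mult E S T \<in> op_closure A"
    unfolding op_closure_def using ST
  proof safe
    fix \<epsilon> :: real assume "\<epsilon> > 0"
    then obtain \<delta> where \<delta>: "\<delta> > 0" "\<And>S' T'. S' \<in> bounded_ops E \<Longrightarrow> T' \<in> bounded_ops E \<Longrightarrow>
        op_dist E S S' < \<delta> \<Longrightarrow> op_dist E T T' < \<delta> \<Longrightarrow> op_dist E (op_mult E S T) (op_mult E S' T') < \<epsilon>"
      using op_mult_continuous[OF ST, of \<epsilon>] by blast
    obtain S' T' where "S' \<in> A" "T' \<in> A" "op_dist E S S' < \<delta>" "op_dist E T T' < \<delta>"
      using S T \<delta>(1) by blast
    then show "\<exists>U\<in>A. op_dist E (op_mult E S T) U < \<epsilon>"
      using A(1) mult \<delta>(2)[of S' T'] by (intro bexI[of _ "op_mult E S' T'"]) auto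
  qed simp
next
  fix c T assume "T \<in> op_closure A"
  then have T': "T \<in> bounded_ops E"
    and T: "\<And>\<epsilon>. \<epsilon> > 0 \<Longrightarrow> \<exists>T'\<in>A. op_dist E T T' < \<epsilon>"
    by (auto simp: op_closure_def)
  show "op_scale E c T \<in> op_closure A"
    unfolding op_closure_def using T'
  proof safe
    fix \<epsilon> :: real assume "\<epsilon> > 0"
    then obtain \<delta> where \<delta>: "\<delta> > 0" "\<And>S. S \<in> bounded_ops E \<Longrightarrow>
        op_dist E T S < \<delta> \<Longrightarrow> op_dist E (op_scale E c T) (op_scale E c S) < \<epsilon>"
      using op_scale_continuous[OF T', of \<epsilon> c] by blast
    obtain S where "S \<in> A" "op_dist E T S < \<delta>" using T \<delta>(1) by blast
    then show "\<exists>U\<in>A. op_dist E (op_scale E c T) U < \<epsilon>"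
      using A(1) scale \<delta>(2)[of S] by (intro bexI[of _ "op_scale E c S"]) auto
  qed simp
next
  interpret Metric_space "bounded_ops E" "op_dist E" by (rule Metric_space_ops) simp
  have "op_closure A = mtopology closure_of A"
    unfolding op_closure_def metric_closure_of using A by fastforce
  then show "closedin (norm_topology E (bounded_ops E)) (op_closure A)"
    by (simp add: norm_topology_def)
qed

text \<open>The last hypothesis says that \<open>A\<close> is already reached from \<open>G\<close>
  without limits. A closed subalgebra that contains \<open>A\<close> also contains its closure, so
  the hull lies between the closure and itself.\<close>

lemma closed_subalgebra_hull_eq:
  assumes "closed_subalgebra E (op_closure A)" "A \<subseteq> bounded_ops E" "G \<subseteq> A"
    and "\<And>D. closed_subalgebra E D \<Longrightarrow> G \<subseteq> D \<Longrightarrow> A \<subseteq> D"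
  shows "closed_subalgebra E hull G = op_closure A"
proof
  show "closed_subalgebra E hull G \<subseteq> op_closure A"
    using assms(1,3) op_closure_subset[OF assms(2)] by (intro hull_minimal) auto
  show "op_closure A \<subseteq> closed_subalgebra E hull G"
  proof (unfold hull_def, rule Inter_greatest)
    fix D assume "D \<in> {t. closed_subalgebra E t \<and> G \<subseteq> t}"
    then show "op_closure A \<subseteq> D"
      using assms(4)[of D] by (intro op_closure_minimal) (auto simp: closed_subalgebra_def)
  qed
qed

end

section \<open>Completeness, tested on geometrically fast sequences\<close>

locale cbanach = cnormed +
  assumes complete: "(\<And>n. f n \<in> vcarrier E) \<Longrightarrow> (\<And>n. vdist (f (Suc n)) (f n) \<le> C * (1/2) ^ n) \<Longrightarrow>
    \<exists>g\<in>vcarrier E. (\<lambda>n. vdist (f n) g) \<longlonglongrightarrow> 0"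
begin

text \<open>Sum of the geometric tail. The explicit rate matters: applied to the values of a
  sequence of operators it is uniform on the unit ball.\<close>

lemma vdist_tail_le:
  assumes f: "\<And>n. f n \<in> vcarrier E" "\<And>n. vdist (f (Suc n)) (f n) \<le> C * (1/2) ^ n"
    and g: "g \<in> vcarrier E" "(\<lambda>n. vdist (f n) g) \<longlonglongrightarrow> 0"
  shows "vdist (f n) g \<le> 2 * C * (1/2) ^ n"
proof -
  have fin: "vdist (f n) (f (n + k)) \<le> 2 * C * (1/2) ^ n - 2 * C * (1/2) ^ (n + k)" for k
  proof (induction k)
    case (Suc k)
    have "vdist (f n) (f (n + Suc k)) \<le> vdist (f n) (f (n + k)) + vdist (f (n + k)) (f (Suc (n + k)))"
      using f vdist_triangle by simp
    also have "vdist (f (n + k)) (f (Suc (n + k))) \<le> C * (1/2) ^ (n + k)"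
      using f(2)[of "n + k"] vdist_commute[of "f (n + k)" "f (Suc (n + k))"] f(1) by simp
    finally show ?case using Suc by simp
  qed (simp add: vdist_self f)
  have C: "C \<ge> 0" using order_trans[OF vdist_nonneg[of "f (Suc 0)" "f 0"] f(2)[of 0]] f(1) by simp
  have "vdist (f n) g \<le> 2 * C * (1/2) ^ n + vdist (f (k + n)) g" for k
  proof -
    have "vdist (f n) g \<le> vdist (f n) (f (n + k)) + vdist (f (n + k)) g"
      using f g vdist_triangle by simp
    moreover have "0 \<le> 2 * C * (1/2) ^ (n + k)" using C by simp
    ultimately show ?thesis using fin[of k] by (simp only: add.commute[of k n])
  qed
  moreover have "(\<lambda>k. 2 * C * (1/2) ^ n + vdist (f (k + n)) g) \<longlonglongrightarrow> 2 * C * (1/2) ^ n + 0"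
    using g(2) by (intro tendsto_intros LIMSEQ_ignore_initial_segment)
  ultimately show ?thesis
    by (intro LIMSEQ_le_const[of _ "2 * C * (1/2) ^ n"]) auto
qed

lemma vdist_limit_unique:
  assumes "\<And>n. f n \<in> vcarrier E" "g \<in> vcarrier E" "h \<in> vcarrier E"
    and "(\<lambda>n. vdist (f n) g) \<longlonglongrightarrow> 0" "(\<lambda>n. vdist (f n) h) \<longlonglongrightarrow> 0"
  shows "g = h"
proof -
  have "vdist g h \<le> vdist (f n) g + vdist (f n) h" for n
    using vdist_triangle[of g "f n" h] vdist_commute[of g "f n"] assms by simp
  moreover have "(\<lambda>n. vdist (f n) g + vdist (f n) h) \<longlonglongrightarrow> 0"
    using tendsto_add[OF assms(4,5)] by simp
  ultimately have "vdist g h \<le> 0" by (intro LIMSEQ_le_const[of _ 0]) auto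
  then show ?thesis using vdist_nonneg[OF assms(2,3)] vdist_eq_zero[OF assms(2,3)] by linarith
qed

text \<open>The pointwise limit exists by completeness of the space and is linear by uniqueness of
  limits; the geometric tail estimate, uniform on the unit ball, makes it bounded and turns
  pointwise convergence into norm convergence.\<close>

lemma bounded_ops_complete:
  assumes T: "\<And>n. T n \<in> bounded_ops E" and fast: "\<And>n. op_dist E (T (Suc n)) (T n) \<le> C * (1/2) ^ n"
  shows "\<exists>S\<in>bounded_ops E. (\<lambda>n. op_dist E (T n) S) \<longlonglongrightarrow> 0"
proof -
  have C: "C \<ge> 0" using fast[of 0] op_dist_nonneg by (metis mult.right_neutral order_trans power_0)
  have fast': "vdist (T (Suc n) v) (T n v) \<le> (C * vnorm E v) * (1/2) ^ n" if v: "v \<in> vcarrier E" for v n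
    using vdist_op_le[OF T T v, of "Suc n" n] mult_right_mono[OF fast[of n] norm_nonneg[OF v]]
    by (simp add: algebra_simps)
  have "\<exists>g\<in>vcarrier E. (\<lambda>n. vdist (T n v) g) \<longlonglongrightarrow> 0" if "v \<in> vcarrier E" for v
    using complete[of "\<lambda>n. T n v" "C * vnorm E v"] fast'[OF that] bounded_opsD(1)[OF T that] by simp
  then obtain S0 where S0: "\<And>v. v \<in> vcarrier E \<Longrightarrow> S0 v \<in> vcarrier E"
      "\<And>v. v \<in> vcarrier E \<Longrightarrow> (\<lambda>n. vdist (T n v) (S0 v)) \<longlonglongrightarrow> 0" by metis
  define S where "S = restrict S0 (vcarrier E)"
  have S: "S v \<in> vcarrier E" "(\<lambda>n. vdist (T n v) (S v)) \<longlonglongrightarrow> 0" if "v \<in> vcarrier E" for v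
    using S0 that by (auto simp: S_def)
  have tail: "vdist (T n v) (S v) \<le> 2 * C * (1/2) ^ n * vnorm E v" if "v \<in> vcarrier E" for v n
    using vdist_tail_le[of "\<lambda>n. T n v" "C * vnorm E v" "S v" n] S[OF that] fast'[OF that] T that
    by (simp add: bounded_opsD algebra_simps)
  have Sb: "S \<in> bounded_ops E"
  proof (rule bounded_opsI[where C = "op_norm E (T 0) + 2 * C"])
    fix u v assume uv: "u \<in> vcarrier E" "v \<in> vcarrier E"
    show "S (vadd E u v) = vadd E (S u) (S v)"
    proof (rule vdist_limit_unique[of "\<lambda>n. T n (vadd E u v)"])
      show "(\<lambda>n. vdist (T n (vadd E u v)) (vadd E (S u) (S v))) \<longlonglongrightarrow> 0"
      proof (rule tendsto_sandwich[OF _ _ tendsto_const])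
        show "(\<lambda>n. vdist (T n u) (S u) + vdist (T n v) (S v)) \<longlonglongrightarrow> 0"
          using tendsto_add[OF S(2)[OF uv(1)] S(2)[OF uv(2)]] by simp
        show "\<forall>\<^sub>F n in sequentially. vdist (T n (vadd E u v)) (vadd E (S u) (S v)) \<le> vdist (T n u) (S u) + vdist (T n v) (S v)"
          using T S(1) uv by (intro always_eventually allI) (simp add: bounded_opsD vdist_add)
      qed (use T S(1) uv in \<open>simp add: bounded_opsD\<close>)
      show "(\<lambda>n. vdist (T n (vadd E u v)) (S (vadd E u v))) \<longlonglongrightarrow> 0"
        using S(2) uv by blast
    qed (use T S(1) uv in \<open>auto intro: bounded_opsD(1)\<close>)
  next
    fix c v assume v: "v \<in> vcarrier E"
    show "S (vscale E c v) = vscale E c (S v)"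
    proof (rule vdist_limit_unique[of "\<lambda>n. T n (vscale E c v)"])
      show "(\<lambda>n. vdist (T n (vscale E c v)) (vscale E c (S v))) \<longlonglongrightarrow> 0"
        using tendsto_mult_left[OF S(2)[OF v], of "cmod c"] T S v by (simp add: bounded_opsD vdist_scale)
      show "(\<lambda>n. vdist (T n (vscale E c v)) (S (vscale E c v))) \<longlonglongrightarrow> 0"
        using S(2) v by blast
    qed (use T S(1) v in \<open>auto intro: bounded_opsD(1)\<close>)
  next
    fix v assume v: "v \<in> vcarrier E"
    have "vnorm E (S v) \<le> vnorm E (T 0 v) + vdist (S v) (T 0 v)"
      using v S T by (intro norm_le_vdist) (auto simp: bounded_opsD)
    also have "\<dots> \<le> op_norm E (T 0) * vnorm E v + 2 * C * vnorm E v"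
      using tail[OF v, of 0] norm_op_le[OF T v] vdist_commute[of "S v" "T 0 v"] S v T
      by (simp add: bounded_opsD add_mono)
    finally show "vnorm E (S v) \<le> (op_norm E (T 0) + 2 * C) * vnorm E v" by (simp add: algebra_simps)
  qed (use S in \<open>auto simp: S_def\<close>)
  have "op_dist E (T n) S \<le> 2 * C * (1/2) ^ n" for n
    using tail C T Sb by (intro op_dist_le) auto
  moreover have lim: "(\<lambda>n. 2 * C * (1/2) ^ n) \<longlonglongrightarrow> 0"
    by (intro tendsto_mult_right_zero LIMSEQ_realpow_zero) auto
  ultimately have "(\<lambda>n. op_dist E (T n) S) \<longlonglongrightarrow> 0"
    by (intro tendsto_sandwich[OF _ _ tendsto_const lim] always_eventually allI) auto
  then show ?thesis using Sb by blast
qed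

end

text \<open>The closure of the set of pairs \<open>(O1 i, O2 i)\<close> is the graph of the
  extension: \<open>bound\<close> makes it single-valued and Lipschitz, and completeness of the
  target makes it total on the closure. Indexing both families by the same type avoids a preliminary
  check that \<open>O1 i\<close> determines \<open>O2 i\<close>; this follows from
  \<open>bound\<close> applied to a difference.\<close>

lemma hom_extension:
  fixes E :: "'v normed_space" and E' :: "'w normed_space"
    and O1 :: "'i \<Rightarrow> 'v \<Rightarrow> 'v" and O2 :: "'i \<Rightarrow> 'w \<Rightarrow> 'w"
  assumes "cnormed E" "cbanach E'"
    and O1: "\<And>i. O1 i \<in> bounded_ops E" and O2: "\<And>i. O2 i \<in> bounded_ops E'"
    and add: "\<And>i j. \<exists>k. O1 k = op_add E (O1 i) (O1 j) \<and> O2 k = op_add E' (O2 i) (O2 j)"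
    and mult: "\<And>i j. \<exists>k. O1 k = op_mult E (O1 i) (O1 j) \<and> O2 k = op_mult E' (O2 i) (O2 j)"
    and scale: "\<And>c i. \<exists>k. O1 k = op_scale E c (O1 i) \<and> O2 k = op_scale E' c (O2 i)"
    and bound: "\<And>i. op_norm E' (O2 i) \<le> M * op_norm E (O1 i)" and M: "0 \<le> M"
  shows "\<exists>\<phi>. continuous_hom E (cnormed.op_closure E (range O1)) E' (cnormed.op_closure E' (range O2)) \<phi> \<and>
     (\<forall>i. \<phi> (O1 i) = O2 i) \<and>
     dense_range (cnormed.op_closure E (range O1)) E' (cnormed.op_closure E' (range O2)) \<phi>"
proof -
  interpret E: cnormed E by fact
  interpret E': cbanach E' by fact
  let ?A = "E.op_closure (range O1)" and ?A' = "E'.op_closure (range O2)"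
  define R where "R T S \<longleftrightarrow> T \<in> bounded_ops E \<and> S \<in> bounded_ops E' \<and>
    (\<forall>\<epsilon>>0. \<exists>i. op_dist E T (O1 i) < \<epsilon> \<and> op_dist E' S (O2 i) < \<epsilon>)" for T S
  have bound2: "op_dist E' (O2 i) (O2 j) \<le> M * op_dist E (O1 i) (O1 j)" for i j
  proof -
    obtain k where k: "O1 k = op_scale E (-1) (O1 j)" "O2 k = op_scale E' (-1) (O2 j)" using scale by blast
    obtain l where l: "O1 l = op_add E (O1 i) (O1 k)" "O2 l = op_add E' (O2 i) (O2 k)" using add by blast
    show ?thesis using bound[of l] O1 O2 by (simp add: op_dist_def l k)
  qed
  have R_dist: "op_dist E' S S' \<le> M * op_dist E T T'" if R: "R T S" "R T' S'" for T S T' S'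
  proof (rule field_le_epsilon)
    fix \<epsilon> :: real assume "\<epsilon> > 0"
    define \<delta> where "\<delta> = \<epsilon> / (2 * M + 2)"
    have \<delta>: "\<delta> > 0" "(2 * M + 2) * \<delta> = \<epsilon>" using M \<open>\<epsilon> > 0\<close> by (auto simp: \<delta>_def)
    obtain i where i: "op_dist E T (O1 i) < \<delta>" "op_dist E' S (O2 i) < \<delta>" using R \<delta> by (auto simp: R_def)
    obtain j where j: "op_dist E T' (O1 j) < \<delta>" "op_dist E' S' (O2 j) < \<delta>" using R \<delta> by (auto simp: R_def)
    have b: "T \<in> bounded_ops E" "T' \<in> bounded_ops E" "S \<in> bounded_ops E'" "S' \<in> bounded_ops E'"
      using R by (auto simp: R_def)
    have "op_dist E (O1 i) (O1 j) \<le> op_dist E (O1 i) T + op_dist E T T' + op_dist E T' (O1 j)"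
      using E.op_dist_triangle[OF O1[of i] b(1) O1[of j]] E.op_dist_triangle[OF b(1,2) O1[of j]] by simp
    also have "\<dots> \<le> op_dist E T T' + 2 * \<delta>" using i j by (simp add: E.op_dist_commute[of "O1 i"])
    finally have 1: "M * op_dist E (O1 i) (O1 j) \<le> M * (op_dist E T T' + 2 * \<delta>)" using M by (rule mult_left_mono)
    have "op_dist E' S S' \<le> op_dist E' S (O2 i) + op_dist E' (O2 i) (O2 j) + op_dist E' (O2 j) S'"
      using E'.op_dist_triangle[OF b(3) O2[of i] b(4)] E'.op_dist_triangle[OF O2[of i] O2[of j] b(4)] by simp
    also have "\<dots> \<le> M * (op_dist E T T' + 2 * \<delta>) + 2 * \<delta>"
      using i j 1 bound2[of i j] by (simp add: E'.op_dist_commute[of "O2 j"])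
    also have "\<dots> = M * op_dist E T T' + \<epsilon>" by (simp flip: \<delta>(2) add: algebra_simps)
    finally show "op_dist E' S S' \<le> M * op_dist E T T' + \<epsilon>" .
  qed
  have R_unique: "S = S'" if "R T S" "R T S'" for T S S'
  proof -
    have b: "T \<in> bounded_ops E" "S \<in> bounded_ops E'" "S' \<in> bounded_ops E'" using that by (auto simp: R_def)
    have "op_dist E' S S' \<le> 0" using R_dist[OF that] E.op_dist_self[OF b(1)] by simp
    then show ?thesis using E'.op_dist_eq_zero[OF b(2,3)] E'.op_dist_nonneg[of S S'] by linarith
  qed
  have R_total: "\<exists>S. R T S" if T: "T \<in> ?A" for T
  proof -
    have Tb: "T \<in> bounded_ops E" using T E.op_closure_bounded by auto
    \<comment> \<open>Approximants at a geometric rate, so that their partners in the target form a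
      fast sequence with constant \<open>2 * M\<close>.\<close>
    have "\<exists>i. op_dist E T (O1 i) < (1/2) ^ n" for n
    proof -
      have "(0::real) < (1/2) ^ n" by simp
      then show ?thesis using T unfolding E.op_closure_def by blast
    qed
    then obtain i where i: "\<And>n. op_dist E T (O1 (i n)) < (1/2) ^ n" by metis
    have "op_dist E' (O2 (i (Suc n))) (O2 (i n)) \<le> (2 * M) * (1/2) ^ n" for n
    proof -
      have "op_dist E (O1 (i (Suc n))) (O1 (i n)) \<le> op_dist E (O1 (i (Suc n))) T + op_dist E T (O1 (i n))"
        by (intro E.op_dist_triangle O1 Tb)
      also have "\<dots> \<le> (1/2) ^ Suc n + (1/2) ^ n"
        using i[of n] i[of "Suc n"] by (simp add: E.op_dist_commute[of _ T])
      also have "\<dots> \<le> 2 * (1/2) ^ n" by simp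
      finally show ?thesis
        using order_trans[OF bound2 mult_left_mono[OF _ M]] by (simp add: mult.assoc mult.left_commute)
    qed
    then obtain S where S: "S \<in> bounded_ops E'" "(\<lambda>n. op_dist E' (O2 (i n)) S) \<longlonglongrightarrow> 0"
      using E'.bounded_ops_complete[of "\<lambda>n. O2 (i n)" "2 * M"] O2 by auto
    have "\<exists>i. op_dist E T (O1 i) < \<epsilon> \<and> op_dist E' S (O2 i) < \<epsilon>" if "\<epsilon> > 0" for \<epsilon>
    proof -
      have "\<forall>\<^sub>F n in sequentially. op_dist E' (O2 (i n)) S < \<epsilon>"
        using order_tendstoD(2)[OF S(2) \<open>\<epsilon> > 0\<close>] .
      moreover have "(\<lambda>n. (1/2::real) ^ n) \<longlonglongrightarrow> 0" by (intro LIMSEQ_realpow_zero) auto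
      then have "\<forall>\<^sub>F n in sequentially. (1/2) ^ n < \<epsilon>" using \<open>\<epsilon> > 0\<close> by (rule order_tendstoD(2))
      ultimately have "\<forall>\<^sub>F n in sequentially. op_dist E T (O1 (i n)) < \<epsilon> \<and> op_dist E' S (O2 (i n)) < \<epsilon>"
        by eventually_elim (use i in \<open>auto simp: E'.op_dist_commute[of S] intro: less_trans\<close>)
      then show ?thesis by (auto dest: eventually_happens)
    qed
    then have "R T S" using Tb S by (auto simp: R_def)
    then show ?thesis by (rule exI[of _ S])
  qed
  define \<phi> where "\<phi> T = (SOME S. R T S)" for T
  have \<phi>: "R T (\<phi> T)" if "T \<in> ?A" for T
    unfolding \<phi>_def using R_total[OF that] by (rule someI_ex)
  have \<phi>_eq: "\<phi> T = S" if "R T S" for T S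
    unfolding \<phi>_def using that R_unique by (intro some_equality) auto
  \<comment> \<open>One argument for sums, products and scalar multiples: the closure of the set of
    pairs inherits every operation that is continuous on both sides and under which the pairs
    themselves are closed.\<close>
  have R_binary: "R (op1 T T') (op2 S S')"
    if R: "R T S" "R T' S'"
      and b: "op1 T T' \<in> bounded_ops E" "op2 S S' \<in> bounded_ops E'"
      and cont1: "\<And>\<epsilon>. \<epsilon> > 0 \<Longrightarrow> \<exists>\<delta>>0. \<forall>U\<in>bounded_ops E. \<forall>V\<in>bounded_ops E.
        op_dist E T U < \<delta> \<longrightarrow> op_dist E T' V < \<delta> \<longrightarrow> op_dist E (op1 T T') (op1 U V) < \<epsilon>"
      and cont2: "\<And>\<epsilon>. \<epsilon> > 0 \<Longrightarrow> \<exists>\<delta>>0. \<forall>U\<in>bounded_ops E'. \<forall>V\<in>bounded_ops E'.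
        op_dist E' S U < \<delta> \<longrightarrow> op_dist E' S' V < \<delta> \<longrightarrow> op_dist E' (op2 S S') (op2 U V) < \<epsilon>"
      and closed: "\<And>i j. \<exists>k. O1 k = op1 (O1 i) (O1 j) \<and> O2 k = op2 (O2 i) (O2 j)"
    for op1 op2 T S T' S'
    unfolding R_def
  proof (intro conjI allI impI b)
    fix \<epsilon> :: real assume \<epsilon>: "\<epsilon> > 0"
    obtain \<delta> where \<delta>: "\<delta> > 0" "\<And>U V. U \<in> bounded_ops E \<Longrightarrow> V \<in> bounded_ops E \<Longrightarrow>
        op_dist E T U < \<delta> \<Longrightarrow> op_dist E T' V < \<delta> \<Longrightarrow> op_dist E (op1 T T') (op1 U V) < \<epsilon>"
      using cont1[OF \<epsilon>] by blast
    obtain \<delta>' where \<delta>': "\<delta>' > 0" "\<And>U V. U \<in> bounded_ops E' \<Longrightarrow> V \<in> bounded_ops E' \<Longrightarrow>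
        op_dist E' S U < \<delta>' \<Longrightarrow> op_dist E' S' V < \<delta>' \<Longrightarrow> op_dist E' (op2 S S') (op2 U V) < \<epsilon>"
      using cont2[OF \<epsilon>] by blast
    have m: "min \<delta> \<delta>' > 0" using \<delta> \<delta>' by simp
    obtain i where i: "op_dist E T (O1 i) < min \<delta> \<delta>'" "op_dist E' S (O2 i) < min \<delta> \<delta>'"
      using R(1) m by (auto simp only: R_def)
    obtain j where j: "op_dist E T' (O1 j) < min \<delta> \<delta>'" "op_dist E' S' (O2 j) < min \<delta> \<delta>'"
      using R(2) m by (auto simp only: R_def)
    obtain k where "O1 k = op1 (O1 i) (O1 j)" "O2 k = op2 (O2 i) (O2 j)" using closed by blast
    then have "op_dist E (op1 T T') (O1 k) < \<epsilon>" "op_dist E' (op2 S S') (O2 k) < \<epsilon>"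
      using \<delta>(2)[of "O1 i" "O1 j"] \<delta>'(2)[of "O2 i" "O2 j"] i j O1 O2 by auto
    then show "\<exists>i. op_dist E (op1 T T') (O1 i) < \<epsilon> \<and> op_dist E' (op2 S S') (O2 i) < \<epsilon>" by blast
  qed
  have R_bounded: "T \<in> bounded_ops E" "S \<in> bounded_ops E'" if "R T S" for T S
    using that by (auto simp: R_def)
  have R_add: "R (op_add E T T') (op_add E' S S')" if R: "R T S" "R T' S'" for T S T' S'
    by (rule R_binary[OF R, of "op_add E" "op_add E'"])
       (use R_bounded[OF R(1)] R_bounded[OF R(2)] add E.op_add_continuous E'.op_add_continuous in simp_all)
  have R_mult: "R (op_mult E T T') (op_mult E' S S')" if R: "R T S" "R T' S'" for T S T' S'
    by (rule R_binary[OF R, of "op_mult E" "op_mult E'"])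
       (use R_bounded[OF R(1)] R_bounded[OF R(2)] mult E.op_mult_continuous E'.op_mult_continuous in simp_all)
  \<comment> \<open>Multiplication by a scalar is fed into \<open>R_binary\<close> as an operation
    that ignores its second argument.\<close>
  have R_scale: "R (op_scale E c T) (op_scale E' c S)" if R: "R T S" for c T S
  proof (rule R_binary[OF R R, of "\<lambda>U V. op_scale E c U" "\<lambda>U V. op_scale E' c U"])
    fix \<epsilon> :: real assume \<epsilon>: "\<epsilon> > 0"
    obtain \<delta> where "\<delta> > 0" "\<forall>U\<in>bounded_ops E. op_dist E T U < \<delta> \<longrightarrow> op_dist E (op_scale E c T) (op_scale E c U) < \<epsilon>"
      using E.op_scale_continuous[OF R_bounded(1)[OF R] \<epsilon>, of c] by blast
    then show "\<exists>\<delta>>0. \<forall>U\<in>bounded_ops E. \<forall>V\<in>bounded_ops E. op_dist E T U < \<delta> \<longrightarrow> op_dist E T V < \<delta> \<longrightarrow>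
        op_dist E (op_scale E c T) (op_scale E c U) < \<epsilon>"
      by (intro exI[of _ \<delta>]) auto
    obtain \<delta> where "\<delta> > 0" "\<forall>U\<in>bounded_ops E'. op_dist E' S U < \<delta> \<longrightarrow> op_dist E' (op_scale E' c S) (op_scale E' c U) < \<epsilon>"
      using E'.op_scale_continuous[OF R_bounded(2)[OF R] \<epsilon>, of c] by blast
    then show "\<exists>\<delta>>0. \<forall>U\<in>bounded_ops E'. \<forall>V\<in>bounded_ops E'. op_dist E' S U < \<delta> \<longrightarrow> op_dist E' S V < \<delta> \<longrightarrow>
        op_dist E' (op_scale E' c S) (op_scale E' c U) < \<epsilon>"
      by (intro exI[of _ \<delta>]) auto
  qed (use R_bounded[OF R] scale in auto)
  have R_gen: "R (O1 i) (O2 i)" for i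
    unfolding R_def using O1 O2 by (auto simp: E.op_dist_self E'.op_dist_self intro!: exI[of _ i])
  have \<phi>_in: "\<phi> T \<in> ?A'" if "T \<in> ?A" for T
    using \<phi>[OF that] unfolding R_def E'.op_closure_def by blast
  have Ab: "?A \<subseteq> bounded_ops E" "?A' \<subseteq> bounded_ops E'" by (simp_all add: E.op_closure_bounded E'.op_closure_bounded)
  interpret M1: Metric_space ?A "op_dist E" using Ab by (intro E.Metric_space_ops)
  interpret M2: Metric_space ?A' "op_dist E'" using Ab by (intro E'.Metric_space_ops)
  have "continuous_map (norm_topology E ?A) (norm_topology E' ?A') \<phi>"
    unfolding norm_topology_def M1.metric_continuous_map[OF M2.Metric_space_axioms]
  proof safe
    fix T and \<epsilon> :: real assume T: "T \<in> ?A" and \<epsilon>: "\<epsilon> > 0"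
    have "op_dist E' (\<phi> T) (\<phi> S) < \<epsilon>" if "S \<in> ?A" "op_dist E T S < \<epsilon> / (M + 1)" for S
    proof -
      have "op_dist E' (\<phi> T) (\<phi> S) \<le> M * op_dist E T S" using R_dist \<phi> T that by auto
      also have "\<dots> \<le> (M + 1) * op_dist E T S" by (intro mult_right_mono) auto
      also have "\<dots> < \<epsilon>" using that M by (simp add: pos_less_divide_eq add_nonneg_pos mult.commute)
      finally show ?thesis .
    qed
    then show "\<exists>\<delta>>0. \<forall>x. x \<in> ?A \<and> op_dist E T x < \<delta> \<longrightarrow> op_dist E' (\<phi> T) (\<phi> x) < \<epsilon>"
      using M \<epsilon> by (intro exI[of _ "\<epsilon> / (M + 1)"]) auto
  qed (use \<phi>_in in auto)
  then have "continuous_hom E ?A E' ?A' \<phi>"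
    unfolding continuous_hom_def using \<phi>_in \<phi>_eq R_add R_mult R_scale \<phi> by auto
  moreover have "dense_range ?A E' ?A' \<phi>"
    unfolding dense_range_def norm_topology_def M2.metric_closure_of
  proof safe
    fix T and r :: real assume T: "T \<in> ?A'" and "r > 0"
    then obtain i where i: "op_dist E' T (O2 i) < r" unfolding E'.op_closure_def by blast
    have "O1 i \<in> ?A" "O2 i \<in> ?A'"
      using E.op_closure_subset[of "range O1"] E'.op_closure_subset[of "range O2"] O1 O2 by auto
    then show "\<exists>y\<in>\<phi> ` ?A. y \<in> M2.mball T r"
      using i T \<phi>_eq[OF R_gen[of i]] by (intro bexI[of _ "O2 i"]) force+
  qed
  ultimately show ?thesis using \<phi>_eq[OF R_gen] by blast
qed

section \<open>Completeness of \<open>L\<^sup>p\<close>\<close>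

definition pnorm :: "real \<Rightarrow> 'a measure \<Rightarrow> ('a \<Rightarrow> complex) \<Rightarrow> real" where
  "pnorm p M f = (\<integral>x. norm (f x) powr p \<partial>M) powr (1 / p)"

text \<open>If \<open>x\<close> or \<open>y\<close> vanishes, the claim comes down to
  \<open>s powr p \<le> s\<close> (or the same for \<open>1 - s\<close>) on the unit interval; the
  remaining cases are convexity of the power function on positive arguments.\<close>

lemma powr_convex_combination:
  fixes x y s p :: real
  assumes "1 \<le> p" "0 \<le> x" "0 \<le> y" "0 \<le> s" "s \<le> 1"
  shows "((1 - s) * x + s * y) powr p \<le> (1 - s) * x powr p + s * y powr p"
proof (cases "x = 0 \<or> y = 0 \<or> s = 0 \<or> s = 1")
  case True
  have le: "t powr p \<le> t" if "0 \<le> t" "t \<le> 1" for t :: real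
    using powr_mono'[of 1 p t] that assms by (cases "t = 0") auto
  show ?thesis
    using True assms le[of s] le[of "1 - s"] by (auto simp: powr_mult intro!: mult_right_mono)
next
  case False
  then show ?thesis
    using convex_onD[OF powr_convex[OF assms(1)], of s x y] assms by simp
qed

context
  fixes p :: real
  assumes p: "1 \<le> p"
begin

lemma Lp_fun_measurable: "f \<in> Lp_fun p M \<Longrightarrow> f \<in> borel_measurable M"
  by (simp add: Lp_fun_def)

lemma Lp_fun_integrable: "f \<in> Lp_fun p M \<Longrightarrow> integrable M (\<lambda>x. norm (f x) powr p)"
  by (simp add: Lp_fun_def)

lemma Lp_fun_zero: "(\<lambda>x. 0) \<in> Lp_fun p M"
  by (simp add: Lp_fun_def)

lemma Lp_fun_scale: "f \<in> Lp_fun p M \<Longrightarrow> (\<lambda>x. c * f x) \<in> Lp_fun p M"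
  by (auto simp: Lp_fun_def norm_mult powr_mult)

lemma norm_add_powr_le: "norm (a + b :: complex) powr p \<le> 2 powr p * (norm a powr p + norm b powr p)"
proof -
  have "norm (a + b) powr p \<le> (2 * max (norm a) (norm b)) powr p"
    using norm_triangle_ineq[of a b] p by (intro powr_mono2) auto
  also have "\<dots> = 2 powr p * (max (norm a) (norm b)) powr p" by (simp add: powr_mult)
  also have "\<dots> \<le> 2 powr p * (norm a powr p + norm b powr p)"
    by (intro mult_left_mono) (auto simp: max_def)
  finally show ?thesis .
qed

lemma Lp_fun_add:
  assumes "f \<in> Lp_fun p M" "g \<in> Lp_fun p M"
  shows "(\<lambda>x. f x + g x) \<in> Lp_fun p M"
proof -
  note [measurable] = assms[THEN Lp_fun_measurable]
  have "integrable M (\<lambda>x. norm (f x + g x) powr p)"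
  proof (rule Bochner_Integration.integrable_bound)
    show "integrable M (\<lambda>x. 2 powr p * (norm (f x) powr p + norm (g x) powr p))"
      using assms by (intro integrable_mult_right Bochner_Integration.integrable_add Lp_fun_integrable)
    show "AE x in M. norm (norm (f x + g x) powr p) \<le> norm (2 powr p * (norm (f x) powr p + norm (g x) powr p))"
      using norm_add_powr_le by (intro AE_I2) simp
  qed measurable
  then show ?thesis by (simp add: Lp_fun_def)
qed

lemma Lp_fun_uminus: "f \<in> Lp_fun p M \<Longrightarrow> (\<lambda>x. - f x) \<in> Lp_fun p M"
  using Lp_fun_scale[of f M "-1"] by simp

lemma Lp_fun_diff:
  assumes "f \<in> Lp_fun p M" "g \<in> Lp_fun p M"
  shows "(\<lambda>x. f x - g x) \<in> Lp_fun p M"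
  using Lp_fun_add[OF assms(1) Lp_fun_scale[OF assms(2), of "-1"]] by simp

lemma Lp_fun_sum:
  assumes "finite I" "\<And>i. i \<in> I \<Longrightarrow> f i \<in> Lp_fun p M"
  shows "(\<lambda>x. \<Sum>i\<in>I. f i x) \<in> Lp_fun p M"
  using assms by (induction I) (auto simp: Lp_fun_zero Lp_fun_add)

lemma Lp_fun_iff_nn:
  "f \<in> Lp_fun p M \<longleftrightarrow> f \<in> borel_measurable M \<and> (\<integral>\<^sup>+x. ennreal (norm (f x) powr p) \<partial>M) < \<infinity>"
  by (auto simp: Lp_fun_def integrable_iff_bounded)

lemma pnorm_nonneg [simp]: "0 \<le> pnorm p M f"
  by (simp add: pnorm_def)

lemma pnorm_powr: "pnorm p M f powr p = (\<integral>x. norm (f x) powr p \<partial>M)"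
  using p by (simp add: pnorm_def powr_powr)

lemma pnorm_nn: "f \<in> Lp_fun p M \<Longrightarrow> ennreal (pnorm p M f powr p) = (\<integral>\<^sup>+x. ennreal (norm (f x) powr p) \<partial>M)"
  unfolding pnorm_powr by (rule nn_integral_eq_integral[symmetric]) (auto simp: Lp_fun_def)

lemma powr_le_iff: "0 \<le> x \<Longrightarrow> 0 \<le> y \<Longrightarrow> x powr p \<le> y powr p \<longleftrightarrow> (x::real) \<le> y"
  using p powr_mono2[of p x y] powr_less_mono2[of p y x] by force

lemma pnorm_le_iff_nn:
  assumes "f \<in> Lp_fun p M" "0 \<le> C"
  shows "pnorm p M f \<le> C \<longleftrightarrow> (\<integral>\<^sup>+x. ennreal (norm (f x) powr p) \<partial>M) \<le> ennreal (C powr p)"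
  using assms by (simp flip: pnorm_nn add: powr_le_iff)

lemma Lp_fun_nn_bound:
  assumes "f \<in> borel_measurable M" "(\<integral>\<^sup>+x. ennreal (norm (f x) powr p) \<partial>M) \<le> ennreal (C powr p)" "0 \<le> C"
  shows "f \<in> Lp_fun p M" "pnorm p M f \<le> C"
proof -
  show "f \<in> Lp_fun p M" using assms by (auto simp: Lp_fun_iff_nn intro: le_less_trans)
  then show "pnorm p M f \<le> C" using assms by (simp add: pnorm_le_iff_nn)
qed

lemma pnorm_cong_AE:
  assumes "f \<in> borel_measurable M" "g \<in> borel_measurable M" "AE x in M. f x = g x"
  shows "pnorm p M f = pnorm p M g"
  unfolding pnorm_def using assms by (intro arg_cong2[where f = "(powr)"] integral_cong_AE) auto

lemma pnorm_zero: "pnorm p M (\<lambda>x. 0) = 0"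
  by (simp add: pnorm_def)

lemma pnorm_scale: "pnorm p M (\<lambda>x. c * f x) = norm c * pnorm p M f"
  using p by (simp add: pnorm_def norm_mult powr_mult powr_powr)

lemma pnorm_eq_zero_AE:
  assumes "f \<in> Lp_fun p M" "pnorm p M f = 0"
  shows "AE x in M. f x = 0"
proof -
  note [measurable] = Lp_fun_measurable[OF assms(1)]
  have "(\<integral>\<^sup>+x. ennreal (norm (f x) powr p) \<partial>M) = 0"
    using pnorm_nn[OF assms(1)] assms(2) by simp
  then have "AE x in M. ennreal (norm (f x) powr p) = 0"
    by (subst (asm) nn_integral_0_iff_AE) auto
  then show ?thesis by eventually_elim simp
qed

text \<open>Minkowski's inequality from convexity. With a and b the two norms, (f + g) / (a + b) is
  pointwise dominated by the convex combination of |f| / a and |g| / b with weights a / (a + b) and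
  b / (a + b), and both of these functions have norm 1.\<close>

lemma pnorm_add:
  assumes f: "f \<in> Lp_fun p M" and g: "g \<in> Lp_fun p M"
  shows "pnorm p M (\<lambda>x. f x + g x) \<le> pnorm p M f + pnorm p M g"
proof -
  note [measurable] = f[THEN Lp_fun_measurable] g[THEN Lp_fun_measurable]
  let ?a = "pnorm p M f" and ?b = "pnorm p M g"
  consider "?a = 0" | "?b = 0" | "?a > 0" "?b > 0" using pnorm_nonneg[of M f] pnorm_nonneg[of M g] by linarith
  then show ?thesis
  proof cases
    case 1
    then have "AE x in M. f x = 0" using pnorm_eq_zero_AE f by blast
    then have "pnorm p M (\<lambda>x. f x + g x) = ?b" by (intro pnorm_cong_AE) auto
    then show ?thesis by simp
  next
    case 2
    then have "AE x in M. g x = 0" using pnorm_eq_zero_AE g by blast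
    then have "pnorm p M (\<lambda>x. f x + g x) = ?a" by (intro pnorm_cong_AE) auto
    then show ?thesis by simp
  next
    case 3
    define s where "s = ?b / (?a + ?b)"
    have s: "0 \<le> s" "s \<le> 1" "(1 - s) / ?a = 1 / (?a + ?b)" "s / ?b = 1 / (?a + ?b)"
      using 3 add_pos_pos[OF 3] by (auto simp: s_def divide_simps)
    have pw: "norm (f x + g x) powr p \<le>
      (?a + ?b) powr p * ((1 - s) / ?a powr p * norm (f x) powr p + s / ?b powr p * norm (g x) powr p)" for x
    proof -
      have "(1 - s) * (norm (f x) / ?a) + s * (norm (g x) / ?b) = (norm (f x) + norm (g x)) / (?a + ?b)"
        using s(3,4) by (simp add: add_divide_distrib times_divide_times_eq flip: times_divide_eq_left)
          (simp add: mult.commute)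
      then have "norm (f x) + norm (g x) = (?a + ?b) * ((1 - s) * (norm (f x) / ?a) + s * (norm (g x) / ?b))"
        using 3 by simp
      then have "norm (f x + g x) powr p \<le> ((?a + ?b) * ((1 - s) * (norm (f x) / ?a) + s * (norm (g x) / ?b))) powr p"
        using norm_triangle_ineq[of "f x" "g x"] p by (intro powr_mono2) auto
      also have "\<dots> = (?a + ?b) powr p * ((1 - s) * (norm (f x) / ?a) + s * (norm (g x) / ?b)) powr p"
        using 3 s by (simp add: powr_mult)
      also have "\<dots> \<le> (?a + ?b) powr p * ((1 - s) * (norm (f x) / ?a) powr p + s * (norm (g x) / ?b) powr p)"
        using 3 s p by (intro mult_left_mono powr_convex_combination) auto
      finally show ?thesis by (simp add: powr_divide)
    qed
    have "(\<integral>x. norm (f x + g x) powr p \<partial>M) \<le>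
      (\<integral>x. (?a + ?b) powr p * ((1 - s) / ?a powr p * norm (f x) powr p + s / ?b powr p * norm (g x) powr p) \<partial>M)"
      using f g pw Lp_fun_add[OF f g]
      by (intro integral_mono integrable_mult_right Bochner_Integration.integrable_add Lp_fun_integrable) auto
    also have "\<dots> = (?a + ?b) powr p * ((1 - s) / ?a powr p * ?a powr p + s / ?b powr p * ?b powr p)"
      unfolding pnorm_powr using f g by (simp add: Lp_fun_integrable)
    also have "\<dots> = (?a + ?b) powr p" using 3 by simp
    finally have "pnorm p M (\<lambda>x. f x + g x) powr p \<le> (?a + ?b) powr p"
      by (simp add: pnorm_powr)
    then show ?thesis by (simp add: powr_le_iff)
  qed
qed

lemma pnorm_sum:
  assumes "finite I" "\<And>i. i \<in> I \<Longrightarrow> f i \<in> Lp_fun p M"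
  shows "pnorm p M (\<lambda>x. \<Sum>i\<in>I. f i x) \<le> (\<Sum>i\<in>I. pnorm p M (f i))"
  using assms
proof (induction I)
  case (insert i I)
  have "pnorm p M (\<lambda>x. f i x + (\<Sum>i\<in>I. f i x)) \<le> pnorm p M (f i) + pnorm p M (\<lambda>x. \<Sum>i\<in>I. f i x)"
    using insert by (intro pnorm_add Lp_fun_sum) auto
  then show ?case using insert by simp
qed (simp add: pnorm_zero)

lemma pnorm_mono:
  assumes "f \<in> borel_measurable M" "g \<in> Lp_fun p M" "\<And>x. x \<in> space M \<Longrightarrow> norm (f x) \<le> norm (g x)"
  shows "f \<in> Lp_fun p M" "pnorm p M f \<le> pnorm p M g"
proof -
  have "(\<integral>\<^sup>+x. ennreal (norm (f x) powr p) \<partial>M) \<le> (\<integral>\<^sup>+x. ennreal (norm (g x) powr p) \<partial>M)"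
    using assms p by (intro nn_integral_mono ennreal_leI powr_mono2) auto
  then have *: "(\<integral>\<^sup>+x. ennreal (norm (f x) powr p) \<partial>M) \<le> ennreal (pnorm p M g powr p)"
    using assms by (simp add: pnorm_nn)
  show "f \<in> Lp_fun p M" "pnorm p M f \<le> pnorm p M g"
    using Lp_fun_nn_bound[OF assms(1) *] by auto
qed

text \<open>The argument of Riesz and Fischer. The norms of the increments are summable, so monotone
  convergence shows that the sum of their absolute values is finite almost everywhere, where the
  sequence then converges; Fatou's lemma carries the estimate of the tails over to the
  limit.\<close>

lemma Lp_fun_fast_Cauchy_converges:
  assumes f: "\<And>n. f n \<in> Lp_fun p M" and fast: "\<And>n. pnorm p M (\<lambda>x. f (Suc n) x - f n x) \<le> C * (1/2) ^ n"
  shows "\<exists>g\<in>Lp_fun p M. (\<lambda>n. pnorm p M (\<lambda>x. f n x - g x)) \<longlonglongrightarrow> 0"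
proof -
  note [measurable] = f[THEN Lp_fun_measurable]
  have C: "0 \<le> C" using order_trans[OF pnorm_nonneg fast[of 0]] by simp
  define D where "D n x = norm (f (Suc n) x - f n x)" for n x
  define S where "S N x = (\<Sum>n<N. D n x)" for N x
  have [measurable]: "S N \<in> borel_measurable M" for N unfolding S_def D_def by measurable
  have D_Lp: "(\<lambda>x. complex_of_real (D n x)) \<in> Lp_fun p M" and D_le: "pnorm p M (\<lambda>x. complex_of_real (D n x)) \<le> C * (1/2) ^ n" for n
  proof -
    have d: "(\<lambda>x. f (Suc n) x - f n x) \<in> Lp_fun p M" by (intro Lp_fun_diff f)
    have m: "(\<lambda>x. complex_of_real (D n x)) \<in> borel_measurable M" unfolding D_def by measurable
    have b: "norm (complex_of_real (D n x)) \<le> norm (f (Suc n) x - f n x)" for x by (simp add: D_def)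
    from pnorm_mono[OF m d b] fast[of n]
    show "(\<lambda>x. complex_of_real (D n x)) \<in> Lp_fun p M" "pnorm p M (\<lambda>x. complex_of_real (D n x)) \<le> C * (1/2) ^ n"
      by auto
  qed
  have S_le: "(\<integral>\<^sup>+x. ennreal (S N x powr p) \<partial>M) \<le> ennreal ((2 * C) powr p)" for N
  proof -
    have S_Lp: "(\<lambda>x. \<Sum>n<N. complex_of_real (D n x)) \<in> Lp_fun p M" by (intro Lp_fun_sum D_Lp) auto
    have "pnorm p M (\<lambda>x. \<Sum>n<N. complex_of_real (D n x)) \<le> (\<Sum>n<N. C * (1/2) ^ n)"
      by (intro order_trans[OF pnorm_sum sum_mono] D_Lp D_le) auto
    also have "\<dots> = C * (\<Sum>n<N. (1/2) ^ n)" by (simp add: sum_distrib_left)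
    also have "\<dots> \<le> C * 2"
      using C by (intro mult_left_mono) (auto simp: sum_gp_strict)
    finally have "(\<integral>\<^sup>+x. ennreal (norm (\<Sum>n<N. complex_of_real (D n x)) powr p) \<partial>M) \<le> ennreal ((2 * C) powr p)"
      using C S_Lp by (subst (asm) pnorm_le_iff_nn) (auto simp: mult.commute)
    moreover have "norm (\<Sum>n<N. complex_of_real (D n x)) = S N x" for x
      unfolding S_def of_real_sum[symmetric] norm_of_real by (simp add: D_def sum_nonneg)
    ultimately show ?thesis by simp
  qed
  have "(\<integral>\<^sup>+x. (SUP N. ennreal (S N x powr p)) \<partial>M) = (SUP N. \<integral>\<^sup>+x. ennreal (S N x powr p) \<partial>M)"
  proof (rule nn_integral_monotone_convergence_SUP)
    show "incseq (\<lambda>N x. ennreal (S N x powr p))"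
      using p by (intro incseq_SucI le_funI ennreal_leI powr_mono2) (auto simp: S_def D_def intro!: sum_nonneg)
  qed measurable
  also have "\<dots> \<le> ennreal ((2 * C) powr p)" by (rule SUP_least) (rule S_le)
  finally have "(\<integral>\<^sup>+x. (SUP N. ennreal (S N x powr p)) \<partial>M) \<noteq> \<infinity>"
    by (auto simp: top_unique)
  then have "AE x in M. (SUP N. ennreal (S N x powr p)) \<noteq> \<infinity>"
    by (intro nn_integral_PInf_AE) auto
  then have conv: "AE x in M. convergent (\<lambda>n. f n x)"
  proof eventually_elim
    case (elim x)
    then obtain B where B: "0 \<le> B" "(SUP N. ennreal (S N x powr p)) = ennreal B"
      by (cases "SUP N. ennreal (S N x powr p)") auto
    have "S N x \<le> B powr (1/p)" for N
    proof -
      have "ennreal (S N x powr p) \<le> ennreal B" unfolding B(2)[symmetric] by (rule SUP_upper) simp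
      then have "S N x powr p \<le> B" using B by simp
      then have "(S N x powr p) powr (1/p) \<le> B powr (1/p)" using p by (intro powr_mono2) auto
      moreover have "0 \<le> S N x" by (auto simp: S_def D_def intro: sum_nonneg)
      ultimately show ?thesis using p by (simp add: powr_powr)
    qed
    then have "(\<Sum>k\<le>N. D k x) \<le> B powr (1/p)" for N
      unfolding S_def lessThan_Suc_atMost[symmetric] .
    then have "summable (\<lambda>n. D n x)"
      by (intro bounded_imp_summable[of _ "B powr (1/p)"]) (simp add: D_def)
    then have "summable (\<lambda>n. f (Suc n) x - f n x)"
      unfolding D_def by (rule summable_norm_cancel)
    then have "convergent (\<lambda>n. \<Sum>i<n. f (Suc i) x - f i x)"
      by (simp add: summable_iff_convergent)
    then have "convergent (\<lambda>n. f n x - f 0 x)"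
      by (simp only: sum_lessThan_telescope[of "\<lambda>n. f n x"])
    then have "convergent (\<lambda>n. (f n x - f 0 x) + f 0 x)"
      by (intro convergent_add convergent_const)
    then show ?case by simp
  qed
  \<comment> \<open>Where the sequence diverges the value is unspecified; this affects neither
    measurability nor the norm.\<close>
  define g where "g x = lim (\<lambda>n. f n x)" for x
  have [measurable]: "g \<in> borel_measurable M" unfolding g_def by measurable
  have lim: "AE x in M. (\<lambda>n. f n x) \<longlonglongrightarrow> g x"
    using conv by eventually_elim (simp add: g_def convergent_LIMSEQ_iff)
  have fin: "pnorm p M (\<lambda>x. f (n + k) x - f n x) \<le> 2 * C * (1/2) ^ n" for n k
  proof -
    have "pnorm p M (\<lambda>x. f (n + k) x - f n x) \<le> 2 * C * (1/2) ^ n - 2 * C * (1/2) ^ (n + k)"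
    proof (induction k)
      case (Suc k)
      have "pnorm p M (\<lambda>x. (f (n + Suc k) x - f (n + k) x) + (f (n + k) x - f n x)) \<le>
        pnorm p M (\<lambda>x. f (n + Suc k) x - f (n + k) x) + pnorm p M (\<lambda>x. f (n + k) x - f n x)"
        by (intro pnorm_add Lp_fun_diff f)
      then show ?case using Suc fast[of "n + k"] by simp
    qed (simp add: pnorm_zero)
    moreover have "0 \<le> 2 * C * (1/2) ^ (n + k)" using C by simp
    ultimately show ?thesis by linarith
  qed
  have tail: "(\<lambda>x. f n x - g x) \<in> Lp_fun p M" "pnorm p M (\<lambda>x. f n x - g x) \<le> 2 * C * (1/2) ^ n" for n
  proof -
    have "(\<integral>\<^sup>+x. ennreal (norm (f n x - g x) powr p) \<partial>M)
      = (\<integral>\<^sup>+x. liminf (\<lambda>k. ennreal (norm (f (n + k) x - f n x) powr p)) \<partial>M)"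
    proof (rule nn_integral_cong_AE, use lim in eventually_elim)
      case (elim x)
      have "(\<lambda>k. f (k + n) x) \<longlonglongrightarrow> g x" using elim by (rule LIMSEQ_ignore_initial_segment)
      then have l: "(\<lambda>k. ennreal (norm (f (n + k) x - f n x) powr p)) \<longlonglongrightarrow> ennreal (norm (g x - f n x) powr p)"
        using p by (intro tendsto_intros tendsto_ennrealI tendsto_powr') (auto simp: add.commute)
      show ?case
        unfolding norm_minus_commute[of "f n x" "g x"] by (rule lim_imp_Liminf[OF _ l, symmetric]) simp
    qed
    also have "\<dots> \<le> liminf (\<lambda>k. \<integral>\<^sup>+x. ennreal (norm (f (n + k) x - f n x) powr p) \<partial>M)"
      by (rule nn_integral_liminf) measurable
    also have "\<dots> \<le> limsup (\<lambda>k. \<integral>\<^sup>+x. ennreal (norm (f (n + k) x - f n x) powr p) \<partial>M)"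
      by (rule Liminf_le_Limsup) simp
    also have "\<dots> \<le> ennreal ((2 * C * (1/2) ^ n) powr p)"
    proof (intro Limsup_bounded always_eventually allI)
      fix k
      have "(\<lambda>x. f (n + k) x - f n x) \<in> Lp_fun p M" by (intro Lp_fun_diff f)
      then show "(\<integral>\<^sup>+x. ennreal (norm (f (n + k) x - f n x) powr p) \<partial>M) \<le> ennreal ((2 * C * (1/2) ^ n) powr p)"
        using pnorm_le_iff_nn[of "\<lambda>x. f (n + k) x - f n x" M "2 * C * (1/2) ^ n"] fin[of n k] C by simp
    qed
    finally have *: "(\<integral>\<^sup>+x. ennreal (norm (f n x - g x) powr p) \<partial>M) \<le> ennreal ((2 * C * (1/2) ^ n) powr p)" .
    show "(\<lambda>x. f n x - g x) \<in> Lp_fun p M" "pnorm p M (\<lambda>x. f n x - g x) \<le> 2 * C * (1/2) ^ n"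
      using Lp_fun_nn_bound[OF _ *] C by auto
  qed
  have "g \<in> Lp_fun p M" using Lp_fun_diff[OF f[of 0] tail(1)[of 0]] by simp
  moreover have l: "(\<lambda>n. 2 * C * (1/2) ^ n) \<longlonglongrightarrow> 0"
    by (intro tendsto_mult_right_zero LIMSEQ_realpow_zero) auto
  have "(\<lambda>n. pnorm p M (\<lambda>x. f n x - g x)) \<longlonglongrightarrow> 0"
    using tail(2) by (intro tendsto_sandwich[OF _ _ tendsto_const l] always_eventually allI) auto
  ultimately show ?thesis by blast
qed

lemma equiv_Lp_rel: "equiv (Lp_fun p M) (Lp_rel p M)"
proof (rule equivI)
  show "refl_on (Lp_fun p M) (Lp_rel p M)" by (auto simp: refl_on_def Lp_rel_def)
  show "sym (Lp_rel p M)" by (auto simp: sym_def Lp_rel_def eq_commute)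
  show "trans (Lp_rel p M)"
  proof (rule transI)
    fix f g h assume "(f, g) \<in> Lp_rel p M" "(g, h) \<in> Lp_rel p M"
    then have *: "f \<in> Lp_fun p M" "h \<in> Lp_fun p M" "AE x in M. f x = g x" "AE x in M. g x = h x"
      by (auto simp: Lp_rel_def)
    have "AE x in M. f x = h x" using *(3,4) by eventually_elim simp
    then show "(f, h) \<in> Lp_rel p M" using * by (auto simp: Lp_rel_def)
  qed
qed (auto simp: Lp_rel_def)

lemma Lp_class_eq_iff:
  assumes "f \<in> Lp_fun p M" "g \<in> Lp_fun p M"
  shows "Lp_class p M f = Lp_class p M g \<longleftrightarrow> (AE x in M. f x = g x)"
  using eq_equiv_class_iff[OF equiv_Lp_rel assms] assms by (simp add: Lp_class_def Lp_rel_def)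

lemma Lp_class_in: "f \<in> Lp_fun p M \<Longrightarrow> Lp_class p M f \<in> vcarrier (Lp p M)"
  by (simp add: Lp_def Lp_class_def quotientI)

lemma rep_Lp_class:
  assumes "f \<in> Lp_fun p M"
  shows "rep (Lp_class p M f) \<in> Lp_fun p M" "AE x in M. rep (Lp_class p M f) x = f x"
proof -
  have "f \<in> Lp_class p M f" using assms by (auto simp: Lp_class_def Lp_rel_def)
  then have "rep (Lp_class p M f) \<in> Lp_class p M f" unfolding rep_def by (rule someI[of "\<lambda>g. g \<in> Lp_class p M f"])
  then show "rep (Lp_class p M f) \<in> Lp_fun p M" "AE x in M. rep (Lp_class p M f) x = f x"
    by (auto simp: Lp_class_def Lp_rel_def eq_commute)
qed

lemma carrier_rep:
  assumes "F \<in> vcarrier (Lp p M)"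
  shows "rep F \<in> Lp_fun p M" "Lp_class p M (rep F) = F"
proof -
  obtain f where f: "f \<in> Lp_fun p M" "F = Lp_class p M f"
    using assms unfolding Lp_def Lp_class_def by (auto elim: quotientE)
  show 1: "rep F \<in> Lp_fun p M" using f rep_Lp_class by simp
  show "Lp_class p M (rep F) = F" using Lp_class_eq_iff[OF 1 f(1)] rep_Lp_class[OF f(1)] f by simp
qed

lemma Lp_carrierE:
  assumes "F \<in> vcarrier (Lp p M)"
  obtains f where "f \<in> Lp_fun p M" "F = Lp_class p M f"
  using carrier_rep[OF assms] that by metis

lemma Lp_zero: "vzero (Lp p M) = Lp_class p M (\<lambda>x. 0)"
  by (simp add: Lp_def)

lemma Lp_add:
  assumes "f \<in> Lp_fun p M" "g \<in> Lp_fun p M"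
  shows "vadd (Lp p M) (Lp_class p M f) (Lp_class p M g) = Lp_class p M (\<lambda>x. f x + g x)"
proof -
  have "AE x in M. rep (Lp_class p M f) x + rep (Lp_class p M g) x = f x + g x"
    using rep_Lp_class(2)[OF assms(1)] rep_Lp_class(2)[OF assms(2)] by eventually_elim simp
  then show ?thesis
    unfolding Lp_def by (simp add: Lp_class_eq_iff Lp_fun_add rep_Lp_class assms)
qed

lemma Lp_scale:
  assumes "f \<in> Lp_fun p M"
  shows "vscale (Lp p M) c (Lp_class p M f) = Lp_class p M (\<lambda>x. c * f x)"
proof -
  have "AE x in M. c * rep (Lp_class p M f) x = c * f x"
    using rep_Lp_class(2)[OF assms(1)] by eventually_elim simp
  then show ?thesis
    unfolding Lp_def by (simp add: Lp_class_eq_iff Lp_fun_scale rep_Lp_class assms)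
qed

lemma Lp_norm:
  assumes "f \<in> Lp_fun p M"
  shows "vnorm (Lp p M) (Lp_class p M f) = pnorm p M f"
proof -
  have "vnorm (Lp p M) (Lp_class p M f) = pnorm p M (rep (Lp_class p M f))"
    by (simp add: Lp_def pnorm_def)
  also have "\<dots> = pnorm p M f"
    using assms rep_Lp_class[OF assms] by (intro pnorm_cong_AE) (auto simp: Lp_fun_measurable)
  finally show ?thesis .
qed

lemma cnormed_Lp: "cnormed (Lp p M)"
proof
  fix u assume u: "u \<in> vcarrier (Lp p M)" "vnorm (Lp p M) u = 0"
  obtain f where f: "f \<in> Lp_fun p M" "u = Lp_class p M f" using u(1) by (rule Lp_carrierE)
  then have "AE x in M. f x = 0" using u(2) pnorm_eq_zero_AE by (simp add: Lp_norm)
  then show "u = vzero (Lp p M)" using f by (simp add: Lp_zero Lp_class_eq_iff Lp_fun_zero)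
next
  fix u v z assume "u \<in> vcarrier (Lp p M)" "v \<in> vcarrier (Lp p M)" "z \<in> vcarrier (Lp p M)"
  then show "vadd (Lp p M) (vadd (Lp p M) u v) z = vadd (Lp p M) u (vadd (Lp p M) v z)"
    by (elim Lp_carrierE) (simp add: Lp_add Lp_fun_add add.assoc)
qed (auto elim!: Lp_carrierE simp: Lp_zero Lp_class_in Lp_fun_zero Lp_add Lp_fun_add Lp_scale Lp_fun_scale
    Lp_fun_uminus Lp_norm pnorm_add pnorm_scale ring_distribs add.commute mult.assoc)

lemma Lp_vdist:
  assumes "f \<in> Lp_fun p M" "g \<in> Lp_fun p M"
  shows "cnormed.vdist (Lp p M) (Lp_class p M f) (Lp_class p M g) = pnorm p M (\<lambda>x. f x - g x)"
  using Lp_fun_diff[OF assms] Lp_fun_scale[OF assms(2), of "-1"] assms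
  by (simp add: cnormed.vdist_def[OF cnormed_Lp] Lp_scale Lp_add Lp_norm)

lemma cbanach_Lp: "cbanach (Lp p M)"
proof (intro cbanach.intro cnormed_Lp cbanach_axioms.intro)
  interpret cnormed "Lp p M" by (rule cnormed_Lp)
  fix F :: "nat \<Rightarrow> ('a \<Rightarrow> complex) set" and C
  assume F: "\<And>n. F n \<in> vcarrier (Lp p M)" "\<And>n. vdist (F (Suc n)) (F n) \<le> C * (1/2) ^ n"
  define f where "f n = rep (F n)" for n
  have f: "f n \<in> Lp_fun p M" "F n = Lp_class p M (f n)" for n
    using carrier_rep[OF F(1)] by (auto simp: f_def)
  obtain g where g: "g \<in> Lp_fun p M" "(\<lambda>n. pnorm p M (\<lambda>x. f n x - g x)) \<longlonglongrightarrow> 0"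
    using Lp_fun_fast_Cauchy_converges[of f M C] F(2) f by (auto simp: Lp_vdist)
  then show "\<exists>g\<in>vcarrier (Lp p M). (\<lambda>n. vdist (F n) g) \<longlonglongrightarrow> 0"
    using f by (intro bexI[of _ "Lp_class p M g"]) (auto simp: Lp_vdist Lp_class_in)
qed

end

section \<open>Weight functions and the splitting of an infinite product measure\<close>

lemma nn_integral_weight:
  assumes "weight m g w"
  shows "(\<integral>\<^sup>+v. ennreal (w v) \<partial>count_space (diag_index m g)) = 1"
proof -
  let ?V = "diag_index m g"
  have pos: "\<And>v. v \<in> ?V \<Longrightarrow> 0 \<le> w v" and sum: "(w has_sum 1) ?V"
    using assms by (auto simp: weight_def less_imp_le)
  have "w summable_on ?V" using sum by (rule has_sum_imp_summable)
  then have abs: "Infinite_Set_Sum.abs_summable_on w ?V"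
    using abs_summable_equivalent summable_on_iff_abs_summable_on_real by blast
  then have "(\<integral>\<^sup>+v. ennreal (w v) \<partial>count_space ?V) = ennreal (infsetsum w ?V)"
    using pos by (rule nn_integral_conv_infsetsum)
  also have "infsetsum w ?V = 1"
    using abs sum by (simp add: infsetsum_infsum infsumI)
  finally show ?thesis by simp
qed

text \<open>A summable family has countable support, and the weights are positive; the rationality
  of the entries need not be examined.\<close>

lemma countable_diag_index:
  assumes "weight m g w" shows "countable (diag_index m g)"
proof -
  have "w summable_on diag_index m g"
    using assms by (auto simp: weight_def intro: has_sum_imp_summable)
  then have "countable {v \<in> diag_index m g. w v \<noteq> 0}" by (rule summable_countable_real)
  also have "{v \<in> diag_index m g. w v \<noteq> 0} = diag_index m g"
    using assms by (force simp: weight_def)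
  finally show ?thesis .
qed

definition ent :: "complex mat \<Rightarrow> nat \<Rightarrow> real" where
  "ent v j = Re (v $$ (j, j))"

lemma diag_index_ent:
  assumes "v \<in> diag_index m g" "j < m"
  shows "v $$ (j, j) = of_real (ent v j)" "1 \<le> ent v j" "ent v j \<le> g" "0 < ent v j"
  using assms by (fastforce simp: diag_index_def ent_def)+

lemma mat_diag_in_diag_index:
  assumes "\<And>j. j < m \<Longrightarrow> f j \<in> {1..g} \<inter> \<rat>"
  shows "mat_diag m (\<lambda>j. of_real (f j)) \<in> diag_index m g"
  using assms unfolding diag_index_def diagonal_mat_def mat_diag_def by auto

lemma ent_mat_diag: "j < m \<Longrightarrow> ent (mat_diag m (\<lambda>j. of_real (f j))) j = f j"
  by (simp add: ent_def mat_diag_def)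

text \<open>A cylinder over finitely many coordinates pulls back to a product of two cylinders, and
  the product measure is determined by its values on cylinders.\<close>

lemma PiM_merge_distr:
  fixes N :: "nat \<Rightarrow> 'a measure"
  assumes "\<And>i. prob_space (N i)"
  shows "distr (PiM {..<m} N \<Otimes>\<^sub>M PiM {m..} N) (PiM UNIV N) (merge {..<m} {m..}) = PiM UNIV N" (is "?D = _")
proof -
  interpret Q: prob_space "N i" for i by (rule assms)
  interpret product_prob_space N UNIV by unfold_locales
  interpret A: prob_space "PiM {..<m} N" by (rule prob_space_PiM) (rule assms)
  interpret B: prob_space "PiM {m..} N" by (rule prob_space_PiM) (rule assms)
  have U: "{..<m} \<union> {m..} = UNIV" by auto
  have meas: "merge {..<m} {m..} \<in> measurable (PiM {..<m} N \<Otimes>\<^sub>M PiM {m..} N) (PiM UNIV N)"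
    using measurable_merge[of "{..<m}" "{m..}" N] unfolding U .
  show ?thesis
  proof (rule PiM_eq)
    fix J F assume J: "finite J" "J \<subseteq> UNIV" "\<And>j. j \<in> J \<Longrightarrow> F j \<in> sets (N j)"
    let ?X = "prod_emb UNIV N J (Pi\<^sub>E J F)"
    let ?E = "prod_emb {..<m} N (J \<inter> {..<m}) (Pi\<^sub>E (J \<inter> {..<m}) F)"
    let ?F = "prod_emb {m..} N (J \<inter> {m..}) (Pi\<^sub>E (J \<inter> {m..}) F)"
    have emb_iff: "x \<in> prod_emb I N K (Pi\<^sub>E K F) \<longleftrightarrow> x \<in> space (PiM I N) \<and> (\<forall>j\<in>K. x j \<in> F j)" if "K \<subseteq> I" for I K x
      using that by (auto simp: prod_emb_iff space_PiM PiE_iff)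
    have "merge {..<m} {m..} -` ?X \<inter> space (PiM {..<m} N \<Otimes>\<^sub>M PiM {m..} N) = ?E \<times> ?F"
    proof (rule Set.set_eqI)
      fix x :: "(nat \<Rightarrow> 'a) \<times> (nat \<Rightarrow> 'a)"
      obtain z y where x: "x = (z, y)" by (cases x)
      have merge: "merge {..<m} {m..} (z, y) j = (if j < m then z j else y j)" for j
        by (simp add: merge_def)
      have split: "(\<forall>j\<in>J. merge {..<m} {m..} (z, y) j \<in> F j) \<longleftrightarrow>
          (\<forall>j\<in>J \<inter> {..<m}. z j \<in> F j) \<and> (\<forall>j\<in>J \<inter> {m..}. y j \<in> F j)"
        unfolding merge by (auto simp: not_less)
      have sp: "merge {..<m} {m..} (z, y) \<in> space (PiM UNIV N)" if "(z, y) \<in> space (PiM {..<m} N \<Otimes>\<^sub>M PiM {m..} N)"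
        using measurable_space[OF meas that] .
      show "x \<in> merge {..<m} {m..} -` ?X \<inter> space (PiM {..<m} N \<Otimes>\<^sub>M PiM {m..} N) \<longleftrightarrow> x \<in> ?E \<times> ?F"
        unfolding x using sp by (auto simp: emb_iff split space_pair_measure)
    qed
    then have "emeasure ?D ?X = emeasure (PiM {..<m} N \<Otimes>\<^sub>M PiM {m..} N) (?E \<times> ?F)"
      using J by (subst emeasure_distr[OF meas]) (auto intro!: sets_PiM_I)
    also have "\<dots> = emeasure (PiM {..<m} N) ?E * emeasure (PiM {m..} N) ?F"
      using J by (intro B.emeasure_pair_measure_Times) (auto intro!: sets_PiM_I)
    also have "emeasure (PiM {..<m} N) ?E = (\<Prod>j\<in>J \<inter> {..<m}. emeasure (N j) (F j))"
      using J assms by (intro Infinite_Product_Measure.emeasure_PiM_emb) auto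
    also have "emeasure (PiM {m..} N) ?F = (\<Prod>j\<in>J \<inter> {m..}. emeasure (N j) (F j))"
      using J assms by (intro Infinite_Product_Measure.emeasure_PiM_emb) auto
    also have "(\<Prod>j\<in>J \<inter> {..<m}. emeasure (N j) (F j)) * (\<Prod>j\<in>J \<inter> {m..}. emeasure (N j) (F j))
       = (\<Prod>j\<in>(J \<inter> {..<m}) \<union> (J \<inter> {m..}). emeasure (N j) (F j))"
      using J by (intro prod.union_disjoint[symmetric]) auto
    also have "(J \<inter> {..<m}) \<union> (J \<inter> {m..}) = J" by auto
    finally show "emeasure ?D ?X = (\<Prod>j\<in>J. emeasure (N j) (F j))" .
  qed simp
qed

lemma nn_integral_PiM_split:
  fixes N :: "nat \<Rightarrow> 'a measure"
  assumes "\<And>i. prob_space (N i)" and f: "f \<in> borel_measurable (PiM UNIV N)"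
  shows "(\<integral>\<^sup>+x. f x \<partial>PiM UNIV N) =
    (\<integral>\<^sup>+z. (\<integral>\<^sup>+y. f (merge {..<m} {m..} (z, y)) \<partial>PiM {m..} N) \<partial>PiM {..<m} N)"
proof -
  interpret B: prob_space "PiM {m..} N" by (rule prob_space_PiM) (rule assms)
  have U: "{..<m} \<union> {m..} = UNIV" by auto
  have meas: "merge {..<m} {m..} \<in> measurable (PiM {..<m} N \<Otimes>\<^sub>M PiM {m..} N) (PiM UNIV N)"
    using measurable_merge[of "{..<m}" "{m..}" N] unfolding U .
  have "(\<integral>\<^sup>+x. f x \<partial>PiM UNIV N) = (\<integral>\<^sup>+x. f x \<partial>distr (PiM {..<m} N \<Otimes>\<^sub>M PiM {m..} N) (PiM UNIV N) (merge {..<m} {m..}))"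
    by (simp add: PiM_merge_distr[OF assms(1)])
  also have "\<dots> = (\<integral>\<^sup>+x. f (merge {..<m} {m..} x) \<partial>(PiM {..<m} N \<Otimes>\<^sub>M PiM {m..} N))"
    using meas f by (intro nn_integral_distr) auto
  also have "\<dots> = (\<integral>\<^sup>+z. (\<integral>\<^sup>+y. f (merge {..<m} {m..} (z, y)) \<partial>PiM {m..} N) \<partial>PiM {..<m} N)"
    using measurable_compose[OF meas f] by (intro B.nn_integral_fst[symmetric])
  finally show ?thesis .
qed

lemma nn_integral_pair_count_space:
  assumes "finite J" "countable K"
  shows "(\<integral>\<^sup>+x. f x \<partial>count_space (J \<times> K)) = (\<integral>\<^sup>+v. (\<Sum>j\<in>J. f (j, v)) \<partial>count_space K)"
proof -
  have "(\<integral>\<^sup>+x. f x \<partial>count_space (J \<times> K)) = (\<integral>\<^sup>+x. f x \<partial>(count_space J \<Otimes>\<^sub>M count_space K))"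
    using assms by (simp add: pair_measure_countable countable_finite)
  also have "\<dots> = (\<integral>\<^sup>+j. \<integral>\<^sup>+v. f (j, v) \<partial>count_space K \<partial>count_space J)"
    using assms by (intro sigma_finite_measure.nn_integral_fst[symmetric])
      (auto intro: sigma_finite_measure_count_space_countable simp: pair_measure_countable countable_finite)
  also have "\<dots> = (\<Sum>j\<in>J. \<integral>\<^sup>+v. f (j, v) \<partial>count_space K)"
    using assms by (simp add: nn_integral_count_space_finite)
  also have "\<dots> = (\<integral>\<^sup>+v. (\<Sum>j\<in>J. f (j, v)) \<partial>count_space K)"
    by (rule nn_integral_sum[symmetric]) simp
  finally show ?thesis .
qed

section \<open>The measure space \<open>X\<close> and its fibres\<close>

locale tower =
  fixes p :: real and d :: "nat \<Rightarrow> nat" and \<gamma> :: "nat \<Rightarrow> real" and w :: "nat \<Rightarrow> real \<Rightarrow> complex mat \<Rightarrow> real"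
  assumes p: "1 \<le> p" and d: "\<And>n. 2 \<le> d n" and \<gamma>: "\<And>n. 1 \<le> \<gamma> n"
    and w: "\<And>n. weight (d n) (\<gamma> n) (w (d n) (\<gamma> n))"
begin

abbreviation "N \<equiv> X_seq w d \<gamma>"
abbreviation "M \<equiv> PiM UNIV N"
abbreviation "Mt m \<equiv> PiM {m..} N"
definition V :: "nat \<Rightarrow> complex mat set" where "V n = diag_index (d n) (\<gamma> n)"
text \<open>The mass of each atom \<open>(j, v)\<close>. It is the same for all \<open>j\<close>, so
  it drops out of every norm inequality on a single fibre.\<close>

definition wgt :: "nat \<Rightarrow> complex mat \<Rightarrow> real" where "wgt n v = w (d n) (\<gamma> n) v / real (d n)"

lemma d_pos: "0 < d n" using d[of n] by simp

lemma V_ent: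
  assumes "v \<in> V n" "j < d n"
  shows "v $$ (j, j) = of_real (ent v j)" "1 \<le> ent v j" "ent v j \<le> \<gamma> n" "0 < ent v j"
  using diag_index_ent assms unfolding V_def by auto

lemma V_carrier: "v \<in> V n \<Longrightarrow> v \<in> carrier_mat (d n) (d n)"
  by (simp add: V_def diag_index_def)

lemma V_diagonal: "v \<in> V n \<Longrightarrow> diagonal_mat v"
  by (simp add: V_def diag_index_def)

lemma countable_V [simp]: "countable (V n)"
  unfolding V_def using w by (rule countable_diag_index)

lemma wgt_pos: "v \<in> V n \<Longrightarrow> 0 < wgt n v"
  using w[of n] d_pos by (auto simp: wgt_def weight_def V_def)

lemma N_eq: "N n = point_measure ({..<d n} \<times> V n) (\<lambda>(j, v). ennreal (wgt n v))"
  by (simp add: X_seq_def X_space_def wgt_def V_def)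

lemma space_N: "space (N n) = {..<d n} \<times> V n"
  by (simp add: N_eq space_point_measure)

lemma sets_N: "sets (N n) = Pow ({..<d n} \<times> V n)"
  by (simp add: N_eq sets_point_measure)

lemma nn_integral_N: "(\<integral>\<^sup>+x. f x \<partial>N n) = (\<integral>\<^sup>+v. ennreal (wgt n v) * (\<Sum>j<d n. f (j, v)) \<partial>count_space (V n))"
proof -
  have "(\<integral>\<^sup>+x. f x \<partial>N n) = (\<integral>\<^sup>+x. (case x of (j, v) \<Rightarrow> ennreal (wgt n v)) * f x \<partial>count_space ({..<d n} \<times> V n))"
    unfolding N_eq point_measure_def by (subst nn_integral_density) auto
  also have "\<dots> = (\<integral>\<^sup>+v. (\<Sum>j<d n. ennreal (wgt n v) * f (j, v)) \<partial>count_space (V n))"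
    by (subst nn_integral_pair_count_space) auto
  finally show ?thesis by (simp add: sum_distrib_left)
qed

lemma prob_N [simp]: "prob_space (N n)"
proof (rule prob_spaceI)
  have "emeasure (N n) (space (N n)) = (\<integral>\<^sup>+x. 1 \<partial>N n)" by simp
  also have "\<dots> = (\<integral>\<^sup>+v. ennreal (w (d n) (\<gamma> n) v) \<partial>count_space (V n))"
    unfolding nn_integral_N
  proof (intro nn_integral_cong)
    fix v assume "v \<in> space (count_space (V n))"
    then have "ennreal (wgt n v) * (\<Sum>j<d n. 1) = ennreal (wgt n v * real (d n))"
      using wgt_pos[of v n] by (simp add: ennreal_of_nat_eq_real_of_nat ennreal_mult)
    then show "ennreal (wgt n v) * (\<Sum>j<d n. 1) = ennreal (w (d n) (\<gamma> n) v)"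
      using d_pos[of n] by (simp add: wgt_def)
  qed
  also have "\<dots> = 1" unfolding V_def using w by (rule nn_integral_weight)
  finally show "emeasure (N n) (space (N n)) = 1" .
qed

lemma emeasure_N_singleton: "x \<in> space (N n) \<Longrightarrow> emeasure (N n) {x} = ennreal (wgt n (snd x))"
  by (subst N_eq, subst emeasure_point_measure_finite2) (auto simp: space_N)

sublocale MP: prob_space M by (rule prob_space_PiM) simp

lemma prob_Mt: "prob_space (Mt m)" by (rule prob_space_PiM) simp

definition Idx :: "nat \<Rightarrow> (nat \<Rightarrow> nat) set" where "Idx m = PiE {..<m} (\<lambda>i. {..<d i})"
definition Vs :: "nat \<Rightarrow> (nat \<Rightarrow> complex mat) set" where "Vs m = PiE {..<m} V"
text \<open>\<open>pt m v j y\<close> is the point of \<open>X\<close> whose first \<open>m\<close> coordinates are \<open>(j i, v i)\<close> and whose other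
  coordinates are those of \<open>y\<close>.\<close>

definition pt :: "nat \<Rightarrow> (nat \<Rightarrow> complex mat) \<Rightarrow> (nat \<Rightarrow> nat) \<Rightarrow> (nat \<Rightarrow> nat \<times> complex mat) \<Rightarrow> nat \<Rightarrow> nat \<times> complex mat" where
  "pt m v j y = (\<lambda>i. if i < m then (j i, v i) else y i)"
definition Wt :: "nat \<Rightarrow> (nat \<Rightarrow> complex mat) \<Rightarrow> real" where "Wt m v = (\<Prod>i<m. wgt i (v i))"

lemma finite_Idx [simp]: "finite (Idx m)"
  by (auto simp: Idx_def intro: finite_PiE)

lemma card_Idx: "card (Idx m) = (\<Prod>i<m. d i)"
  by (simp add: Idx_def card_PiE)

lemma countable_Vs [simp]: "countable (Vs m)"
  unfolding Vs_def by (rule countable_PiE) auto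

lemma Wt_pos: "v \<in> Vs m \<Longrightarrow> 0 < Wt m v"
  unfolding Wt_def by (rule prod_pos) (auto simp: Vs_def wgt_pos PiE_iff)

lemma space_fin: "space (PiM {..<m} N) = PiE {..<m} (\<lambda>i. {..<d i} \<times> V i)"
  by (simp add: space_PiM space_N)

lemma countable_space_fin [simp]: "countable (space (PiM {..<m} N))"
  unfolding space_fin by (rule countable_PiE) auto

lemma singleton_fin:
  assumes "z \<in> space (PiM {..<m} N)" shows "{z} = PiE {..<m} (\<lambda>i. {z i})"
  using assms by (intro PiE_singleton[symmetric]) (auto simp: space_PiM PiE_def)

text \<open>Singletons are rectangles and the space is countable, so the finite product is discrete.
  Hence every function of the first \<open>m\<close> coordinates is measurable, whatever the
  kernel.\<close>

lemma sets_fin: "sets (PiM {..<m} N) = Pow (space (PiM {..<m} N))"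
proof (rule sets_eq_countable)
  fix z assume z: "z \<in> space (PiM {..<m} N)"
  show "{z} \<in> sets (PiM {..<m} N)"
    unfolding singleton_fin[OF z] using z
    by (intro sets_PiM_I_finite) (auto simp: sets_N space_fin PiE_iff)
qed simp_all

lemma fin_eq_density: "PiM {..<m} N = density (count_space (space (PiM {..<m} N))) (\<lambda>z. ennreal (Wt m (snd \<circ> z)))"
proof (rule measure_eqI_countable)
  show "sets (PiM {..<m} N) = Pow (space (PiM {..<m} N))" by (rule sets_fin)
  fix z assume z: "z \<in> space (PiM {..<m} N)"
  interpret P: prob_space "N i" for i by simp
  interpret product_sigma_finite N by unfold_locales
  have zi: "z i \<in> space (N i)" if "i < m" for i using z that by (auto simp: space_PiM PiE_iff)
  have "emeasure (PiM {..<m} N) {z} = (\<Prod>i<m. emeasure (N i) {z i})"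
    unfolding singleton_fin[OF z] using zi
    by (subst emeasure_PiM) (auto simp: sets_N space_N)
  also have "\<dots> = (\<Prod>i<m. ennreal (wgt i (snd (z i))))"
    using zi by (intro prod.cong) (auto simp: emeasure_N_singleton)
  also have "\<dots> = ennreal (Wt m (snd \<circ> z))"
    unfolding Wt_def using zi by (subst prod_ennreal) (auto simp: space_N mem_Times_iff less_imp_le wgt_pos)
  also have "\<dots> = emeasure (density (count_space (space (PiM {..<m} N))) (\<lambda>z. ennreal (Wt m (snd \<circ> z)))) {z}"
    using z by (subst emeasure_density) (auto simp: nn_integral_count_space'[where A = "{z}"])
  finally show "emeasure (PiM {..<m} N) {z} = \<dots>" .
qed auto

lemma bij_fin:
  "bij_betw (\<lambda>(j, v). \<lambda>i\<in>{..<m}. (j i, v i)) (Idx m \<times> Vs m) (space (PiM {..<m} N))"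
proof (rule bij_betw_byWitness[where f' = "\<lambda>z. (\<lambda>i\<in>{..<m}. fst (z i), \<lambda>i\<in>{..<m}. snd (z i))"])
  show "\<forall>a\<in>Idx m \<times> Vs m. (\<lambda>z. (\<lambda>i\<in>{..<m}. fst (z i), \<lambda>i\<in>{..<m}. snd (z i))) ((\<lambda>(j, v). \<lambda>i\<in>{..<m}. (j i, v i)) a) = a"
  proof
    fix a assume "a \<in> Idx m \<times> Vs m"
    then obtain j v where a: "a = (j, v)" and "j \<in> Idx m" "v \<in> Vs m" by auto
    then have "restrict j {..<m} = j" "restrict v {..<m} = v" by (auto simp: Idx_def Vs_def PiE_restrict)
    then show "(\<lambda>z. (\<lambda>i\<in>{..<m}. fst (z i), \<lambda>i\<in>{..<m}. snd (z i))) ((\<lambda>(j, v). \<lambda>i\<in>{..<m}. (j i, v i)) a) = a"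
      by (simp add: a restrict_def cong: if_cong)
  qed
  show "\<forall>z\<in>space (PiM {..<m} N). (\<lambda>(j, v). \<lambda>i\<in>{..<m}. (j i, v i)) (\<lambda>i\<in>{..<m}. fst (z i), \<lambda>i\<in>{..<m}. snd (z i)) = z"
  proof
    fix z assume "z \<in> space (PiM {..<m} N)"
    then have "restrict z {..<m} = z" by (auto simp: space_fin PiE_restrict)
    then show "(\<lambda>(j, v). \<lambda>i\<in>{..<m}. (j i, v i)) (\<lambda>i\<in>{..<m}. fst (z i), \<lambda>i\<in>{..<m}. snd (z i)) = z"
      by (simp add: restrict_def cong: if_cong)
  qed
  show "(\<lambda>(j, v). \<lambda>i\<in>{..<m}. (j i, v i)) ` (Idx m \<times> Vs m) \<subseteq> space (PiM {..<m} N)"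
  proof (rule image_subsetI)
    fix a assume "a \<in> Idx m \<times> Vs m"
    then obtain j v where a: "a = (j, v)" and "j \<in> Idx m" "v \<in> Vs m" by auto
    then have "j i < d i" "v i \<in> V i" if "i < m" for i
      using that by (auto simp: Idx_def Vs_def dest: PiE_mem)
    then show "(\<lambda>(j, v). \<lambda>i\<in>{..<m}. (j i, v i)) a \<in> space (PiM {..<m} N)"
      by (simp add: a space_fin restrict_PiE_iff)
  qed
  show "(\<lambda>z. (\<lambda>i\<in>{..<m}. fst (z i), \<lambda>i\<in>{..<m}. snd (z i))) ` space (PiM {..<m} N) \<subseteq> Idx m \<times> Vs m"
  proof (rule image_subsetI)
    fix z assume "z \<in> space (PiM {..<m} N)"
    then have "z i \<in> {..<d i} \<times> V i" if "i < m" for i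
      using that by (auto simp: space_fin dest: PiE_mem)
    then show "(\<lambda>i\<in>{..<m}. fst (z i), \<lambda>i\<in>{..<m}. snd (z i)) \<in> Idx m \<times> Vs m"
      by (simp add: Idx_def Vs_def restrict_PiE_iff mem_Times_iff)
  qed
qed

lemma nn_integral_fin:
  "(\<integral>\<^sup>+z. g z \<partial>PiM {..<m} N) =
   (\<integral>\<^sup>+v. ennreal (Wt m v) * (\<Sum>j\<in>Idx m. g (\<lambda>i\<in>{..<m}. (j i, v i))) \<partial>count_space (Vs m))"
proof -
  have "(\<integral>\<^sup>+z. g z \<partial>PiM {..<m} N) = (\<integral>\<^sup>+z. ennreal (Wt m (snd \<circ> z)) * g z \<partial>count_space (space (PiM {..<m} N)))"
    by (subst fin_eq_density, subst nn_integral_density) auto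
  also have "\<dots> = (\<integral>\<^sup>+x. (\<lambda>z. ennreal (Wt m (snd \<circ> z)) * g z) ((\<lambda>(j, v). \<lambda>i\<in>{..<m}. (j i, v i)) x) \<partial>count_space (Idx m \<times> Vs m))"
    by (rule nn_integral_bij_count_space[OF bij_fin, symmetric])
  also have "\<dots> = (\<integral>\<^sup>+v. (\<Sum>j\<in>Idx m. ennreal (Wt m v) * g (\<lambda>i\<in>{..<m}. (j i, v i))) \<partial>count_space (Vs m))"
    by (subst nn_integral_pair_count_space) (auto simp: Wt_def)
  finally show ?thesis by (simp add: sum_distrib_left)
qed

lemma merge_pt: "merge {..<m} {m..} ((\<lambda>i\<in>{..<m}. (j i, v i)), y) = pt m v j y"
  by (auto simp: merge_def pt_def fun_eq_iff)

lemma merge_measurable: "merge {..<m} {m..} \<in> measurable (PiM {..<m} N \<Otimes>\<^sub>M Mt m) M"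
proof -
  have U: "{..<m} \<union> {m..} = UNIV" by auto
  show ?thesis using measurable_merge[of "{..<m}" "{m..}" N] unfolding U .
qed

lemma pt_space_fin:
  assumes "v \<in> Vs m" "j \<in> Idx m" shows "(\<lambda>i\<in>{..<m}. (j i, v i)) \<in> space (PiM {..<m} N)"
  using assms by (auto simp: space_fin Vs_def Idx_def PiE_iff)

lemma pt_measurable:
  assumes "v \<in> Vs m" "j \<in> Idx m"
  shows "pt m v j \<in> measurable (Mt m) M"
  unfolding merge_pt[symmetric]
  using measurable_compose[OF measurable_Pair1'[OF pt_space_fin[OF assms]] merge_measurable] by simp

text \<open>Disintegration over the diagonal matrices of the first \<open>m\<close> factors. An
  operator of level \<open>m\<close> only mixes the terms of the inner sum, and these all carry the
  same mass, so its action decomposes over \<open>v\<close> and \<open>y\<close>.\<close>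

lemma nn_integral_M:
  assumes f: "f \<in> borel_measurable M"
  shows "(\<integral>\<^sup>+x. f x \<partial>M) =
    (\<integral>\<^sup>+v. ennreal (Wt m v) * (\<integral>\<^sup>+y. (\<Sum>j\<in>Idx m. f (pt m v j y)) \<partial>Mt m) \<partial>count_space (Vs m))"
proof -
  have "(\<integral>\<^sup>+x. f x \<partial>M) = (\<integral>\<^sup>+v. ennreal (Wt m v) * (\<Sum>j\<in>Idx m. \<integral>\<^sup>+y. f (pt m v j y) \<partial>Mt m) \<partial>count_space (Vs m))"
    unfolding nn_integral_PiM_split[OF prob_N f, of m] nn_integral_fin merge_pt ..
  also have "\<dots> = (\<integral>\<^sup>+v. ennreal (Wt m v) * (\<integral>\<^sup>+y. (\<Sum>j\<in>Idx m. f (pt m v j y)) \<partial>Mt m) \<partial>count_space (Vs m))"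
    using f by (intro nn_integral_cong) (auto simp: nn_integral_sum measurable_compose[OF pt_measurable])
  finally show ?thesis .
qed

end

section \<open>Kernels on finite index sets\<close>

text \<open>\<open>kact I \<omega> a\<close> is the matrix \<open>\<omega> a \<omega>\<^sup>-\<^sup>1\<close>, where the weight \<open>\<omega>\<close> is read as a diagonal matrix.\<close>

definition kact :: "'i set \<Rightarrow> ('i \<Rightarrow> real) \<Rightarrow> ('i \<Rightarrow> 'i \<Rightarrow> complex) \<Rightarrow> ('i \<Rightarrow> complex) \<Rightarrow> 'i \<Rightarrow> complex" where
  "kact I \<omega> a \<xi> j = (\<Sum>k\<in>I. a j k * of_real (\<omega> j / \<omega> k) * \<xi> k)"

text \<open>The counting measure stands in for the normalized one: the constant factor between the
  two norms appears on both sides of the inequality.\<close>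

definition kbound :: "real \<Rightarrow> 'i set \<Rightarrow> ('i \<Rightarrow> real) \<Rightarrow> ('i \<Rightarrow> 'i \<Rightarrow> complex) \<Rightarrow> real \<Rightarrow> bool" where
  "kbound p I \<omega> a C \<longleftrightarrow>
    (\<forall>\<xi>. pnorm p (count_space I) (kact I \<omega> a \<xi>) \<le> C * pnorm p (count_space I) \<xi>)"

lemma kboundD: "kbound p I \<omega> a C \<Longrightarrow> pnorm p (count_space I) (kact I \<omega> a \<xi>) \<le> C * pnorm p (count_space I) \<xi>"
  by (simp add: kbound_def)

lemma Lp_fun_finite: "finite I \<Longrightarrow> \<xi> \<in> Lp_fun p (count_space I)"
  by (simp add: Lp_fun_def integrable_count_space)

lemma pnorm_finite_powr:
  assumes "1 \<le> p" "finite I"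
  shows "pnorm p (count_space I) \<xi> powr p = (\<Sum>k\<in>I. norm (\<xi> k) powr p)"
  using assms by (simp add: pnorm_powr lebesgue_integral_count_space_finite)

lemma pnorm_finite_cong:
  assumes "\<And>k. k \<in> I \<Longrightarrow> \<xi> k = \<eta> k"
  shows "pnorm p (count_space I) \<xi> = pnorm p (count_space I) \<eta>"
proof -
  have "(\<integral>x. norm (\<xi> x) powr p \<partial>count_space I) = (\<integral>x. norm (\<eta> x) powr p \<partial>count_space I)"
    by (rule Bochner_Integration.integral_cong) (simp_all add: assms)
  then show ?thesis by (simp add: pnorm_def)
qed

lemma pnorm_finite_mono:
  assumes "1 \<le> p" "finite I" "\<And>k. k \<in> I \<Longrightarrow> norm (\<xi> k) \<le> norm (\<eta> k)"
  shows "pnorm p (count_space I) \<xi> \<le> pnorm p (count_space I) \<eta>"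
  using assms by (intro pnorm_mono(2) Lp_fun_finite) auto

lemma norm_le_pnorm_finite:
  assumes "1 \<le> p" "finite I" "k \<in> I"
  shows "norm (\<xi> k) \<le> pnorm p (count_space I) \<xi>"
proof -
  have "norm (\<xi> k) powr p \<le> (\<Sum>k\<in>I. norm (\<xi> k) powr p)"
    using assms by (intro member_le_sum) auto
  then have "norm (\<xi> k) powr p \<le> pnorm p (count_space I) \<xi> powr p"
    using assms by (simp add: pnorm_finite_powr)
  then show ?thesis using assms by (simp add: powr_le_iff)
qed

lemma pnorm_finite_single:
  assumes "1 \<le> p" "finite I" "k \<in> I"
  shows "pnorm p (count_space I) (\<lambda>j. if j = k then c else 0) = norm c"
proof -
  have "pnorm p (count_space I) (\<lambda>j. if j = k then c else 0) powr p = norm c powr p"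
    using assms by (simp add: pnorm_finite_powr if_distrib[of norm] if_distrib[of "\<lambda>x. x powr p"] cong: if_cong)
  then show ?thesis using assms by (intro antisym) (simp_all flip: powr_le_iff[OF assms(1)])
qed

lemma kbound_mono:
  assumes "1 \<le> p" "kbound p I \<omega> a C" "C \<le> C'"
  shows "kbound p I \<omega> a C'"
  using assms mult_right_mono[OF assms(3) pnorm_nonneg[OF assms(1)]] order_trans
  unfolding kbound_def by blast

text \<open>Conjugation multiplies the only nonzero entry by a ratio of weights. With weights
  between 1 and \<open>G m\<close> this bounds the matrix units of level \<open>m\<close> by
  \<open>G m\<close>, the source of the product of the lower sequence in the growth
  condition.\<close>

lemma kbound_unit:
  assumes p: "1 \<le> p" and I: "finite I" "J \<in> I" "K \<in> I" and \<omega>: "0 < \<omega> J" "0 < \<omega> K"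
  shows "kbound p I \<omega> (\<lambda>j k. if j = J \<and> k = K then c else 0) (norm c * (\<omega> J / \<omega> K))"
  unfolding kbound_def
proof
  fix \<xi>
  have "kact I \<omega> (\<lambda>j k. if j = J \<and> k = K then c else 0) \<xi> j = (if j = J then c * of_real (\<omega> J / \<omega> K) * \<xi> K else 0)" for j
  proof -
    have "kact I \<omega> (\<lambda>j k. if j = J \<and> k = K then c else 0) \<xi> j =
      (\<Sum>k\<in>I. if k = K then (if j = J then c * of_real (\<omega> J / \<omega> K) * \<xi> K else 0) else 0)"
      unfolding kact_def by (intro sum.cong) auto
    then show ?thesis using I by simp
  qed
  then have "kact I \<omega> (\<lambda>j k. if j = J \<and> k = K then c else 0) \<xi> =
      (\<lambda>j. if j = J then c * of_real (\<omega> J / \<omega> K) * \<xi> K else 0)" ..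
  then have "pnorm p (count_space I) (kact I \<omega> (\<lambda>j k. if j = J \<and> k = K then c else 0) \<xi>)
     = norm (c * of_real (\<omega> J / \<omega> K) * \<xi> K)"
    by (simp only: pnorm_finite_single[OF p I(1,2)])
  also have "\<dots> = norm c * (\<omega> J / \<omega> K) * norm (\<xi> K)"
    using \<omega> by (simp add: norm_mult norm_divide)
  also have "\<dots> \<le> norm c * (\<omega> J / \<omega> K) * pnorm p (count_space I) \<xi>"
    using p I \<omega> by (intro mult_left_mono norm_le_pnorm_finite) auto
  finally show "pnorm p (count_space I) (kact I \<omega> (\<lambda>j k. if j = J \<and> k = K then c else 0) \<xi>)
      \<le> norm c * (\<omega> J / \<omega> K) * pnorm p (count_space I) \<xi>" .
qed

lemma kact_sum: "finite S \<Longrightarrow> kact I \<omega> (\<lambda>j k. \<Sum>s\<in>S. a s j k) \<xi> j = (\<Sum>s\<in>S. kact I \<omega> (a s) \<xi> j)"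
  unfolding kact_def sum_distrib_right by (rule sum.swap)

lemma kbound_sum:
  assumes p: "1 \<le> p" and I: "finite I" "finite S" and "\<And>s. s \<in> S \<Longrightarrow> kbound p I \<omega> (a s) (C s)"
  shows "kbound p I \<omega> (\<lambda>j k. \<Sum>s\<in>S. a s j k) (\<Sum>s\<in>S. C s)"
  unfolding kbound_def
proof
  fix \<xi>
  have "pnorm p (count_space I) (kact I \<omega> (\<lambda>j k. \<Sum>s\<in>S. a s j k) \<xi>) =
    pnorm p (count_space I) (\<lambda>j. \<Sum>s\<in>S. kact I \<omega> (a s) \<xi> j)"
    using I(2) by (intro pnorm_finite_cong kact_sum)
  also have "\<dots> \<le> (\<Sum>s\<in>S. pnorm p (count_space I) (kact I \<omega> (a s) \<xi>))"
    using p I by (intro pnorm_sum Lp_fun_finite)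
  also have "\<dots> \<le> (\<Sum>s\<in>S. C s * pnorm p (count_space I) \<xi>)"
    using assms(4) by (intro sum_mono) (auto simp: kbound_def)
  finally show "pnorm p (count_space I) (kact I \<omega> (\<lambda>j k. \<Sum>s\<in>S. a s j k) \<xi>) \<le> (\<Sum>s\<in>S. C s) * pnorm p (count_space I) \<xi>"
    by (simp add: sum_distrib_right)
qed

lemma kact_mult:
  assumes "\<And>k. k \<in> I \<Longrightarrow> 0 < \<omega> k"
  shows "kact I \<omega> a (kact I \<omega> b \<xi>) j = kact I \<omega> (\<lambda>j k. \<Sum>l\<in>I. a j l * b l k) \<xi> j"
proof -
  have "kact I \<omega> a (kact I \<omega> b \<xi>) j = (\<Sum>l\<in>I. \<Sum>k\<in>I. a j l * b l k * of_real (\<omega> j / \<omega> k) * \<xi> k)"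
    unfolding kact_def sum_distrib_left
  proof (intro sum.cong refl)
    fix l k assume "l \<in> I"
    then have "\<omega> l \<noteq> 0" using assms[of l] by simp
    then have "of_real (\<omega> j / \<omega> k) = (of_real (\<omega> j / \<omega> l) * of_real (\<omega> l / \<omega> k) :: complex)"
      by simp
    then show "a j l * of_real (\<omega> j / \<omega> l) * (b l k * of_real (\<omega> l / \<omega> k) * \<xi> k) =
        a j l * b l k * of_real (\<omega> j / \<omega> k) * \<xi> k"
      by (simp only: mult_ac)
  qed
  also have "\<dots> = (\<Sum>k\<in>I. \<Sum>l\<in>I. a j l * b l k * of_real (\<omega> j / \<omega> k) * \<xi> k)" by (rule sum.swap)
  finally show ?thesis by (simp only: kact_def sum_distrib_right)
qed

lemma kact_cong:
  assumes "\<And>j k. j \<in> I \<Longrightarrow> k \<in> I \<Longrightarrow> a j k = b j k" "j \<in> I"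
  shows "kact I \<omega> a \<xi> j = kact I \<omega> b \<xi> j"
  unfolding kact_def using assms by (intro sum.cong) auto

lemma kbound_cong:
  assumes "\<And>j k. j \<in> I \<Longrightarrow> k \<in> I \<Longrightarrow> a j k = b j k"
  shows "kbound p I \<omega> a C \<longleftrightarrow> kbound p I \<omega> b C"
proof -
  have "pnorm p (count_space I) (kact I \<omega> a \<xi>) = pnorm p (count_space I) (kact I \<omega> b \<xi>)" for \<xi>
    by (intro pnorm_finite_cong kact_cong assms)
  then show ?thesis by (simp add: kbound_def)
qed

text \<open>A crude bound, obtained from the expansion into matrix units. Its use is that it is the
  same for all weights with values in [1, G], hence for all fibres at once.\<close>

lemma kbound_entries:
  assumes p: "1 \<le> p" and I: "finite I" and \<omega>: "\<And>k. k \<in> I \<Longrightarrow> 1 \<le> \<omega> k \<and> \<omega> k \<le> G"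
  shows "kbound p I \<omega> a (G * (\<Sum>s\<in>I \<times> I. norm (a (fst s) (snd s))))"
proof -
  let ?u = "\<lambda>s j k. if j = fst s \<and> k = snd s then a (fst s) (snd s) else 0"
  have II: "finite (I \<times> I)" using I by simp
  have "kbound p I \<omega> (\<lambda>j k. \<Sum>s\<in>I \<times> I. ?u s j k) (\<Sum>s\<in>I \<times> I. G * norm (a (fst s) (snd s)))"
  proof (rule kbound_sum[OF p I II])
    fix s assume s: "s \<in> I \<times> I"
    let ?J = "fst s" and ?K = "snd s"
    have JK: "?J \<in> I" "?K \<in> I" using s by auto
    have "\<omega> ?J * 1 \<le> G * \<omega> ?K" "0 < \<omega> ?J" "0 < \<omega> ?K"
      using \<omega>[OF JK(1)] \<omega>[OF JK(2)] mult_mono[of "\<omega> ?J" G 1 "\<omega> ?K"] by auto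
    then have "\<omega> ?J / \<omega> ?K \<le> G" by (simp add: pos_divide_le_eq)
    then have "norm (a ?J ?K) * (\<omega> ?J / \<omega> ?K) \<le> norm (a ?J ?K) * G" by (rule mult_left_mono) simp
    also have "\<dots> = G * norm (a ?J ?K)" by (rule mult.commute)
    finally show "kbound p I \<omega> (?u s) (G * norm (a ?J ?K))"
      by (rule kbound_mono[OF p kbound_unit[OF p I JK \<open>0 < \<omega> ?J\<close> \<open>0 < \<omega> ?K\<close>]])
  qed
  moreover have eq: "(\<Sum>s\<in>I \<times> I. ?u s j k) = a j k" if "j \<in> I" "k \<in> I" for j k
  proof -
    have "(\<Sum>s\<in>I \<times> I. ?u s j k) = (\<Sum>s\<in>I \<times> I. if s = (j, k) then a j k else 0)"
      by (intro sum.cong) auto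
    then show ?thesis using that I by simp
  qed
  ultimately show ?thesis
    using kbound_cong[of I _ a, OF eq] by (simp add: sum_distrib_left)
qed

context tower
begin

definition idx :: "nat \<Rightarrow> (nat \<Rightarrow> nat \<times> complex mat) \<Rightarrow> nat \<Rightarrow> nat" where
  "idx m x = (\<lambda>i\<in>{..<m}. fst (x i))"
definition vpart :: "nat \<Rightarrow> (nat \<Rightarrow> nat \<times> complex mat) \<Rightarrow> nat \<Rightarrow> complex mat" where
  "vpart m x = (\<lambda>i\<in>{..<m}. snd (x i))"
definition put :: "nat \<Rightarrow> (nat \<Rightarrow> nat) \<Rightarrow> (nat \<Rightarrow> nat \<times> complex mat) \<Rightarrow> nat \<Rightarrow> nat \<times> complex mat" where
  "put m k x = (\<lambda>i. if i < m then (k i, snd (x i)) else x i)"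
text \<open>The diagonal entry at \<open>j\<close> of the tensor product of the matrices
  \<open>v 0\<close>, ..., \<open>v (m - 1)\<close>.\<close>

definition wv :: "nat \<Rightarrow> (nat \<Rightarrow> complex mat) \<Rightarrow> (nat \<Rightarrow> nat) \<Rightarrow> real" where
  "wv m v j = (\<Prod>i<m. ent (v i) (j i))"
text \<open>An element of \<open>M\<^bsub>d(0)\<^esub> \<otimes> \<dots> \<otimes> M\<^bsub>d(m-1)\<^esub>\<close> is a kernel \<open>a\<close> on \<open>Idx m\<close>. It acts by \<open>v a v\<^sup>-\<^sup>1\<close> on the fibre over
  \<open>v\<close>, and \<open>fib m v a C\<close> says that the norm there is at most \<open>C\<close>.\<close>

definition opf :: "nat \<Rightarrow> ((nat \<Rightarrow> nat) \<Rightarrow> (nat \<Rightarrow> nat) \<Rightarrow> complex) \<Rightarrow> ((nat \<Rightarrow> nat \<times> complex mat) \<Rightarrow> complex) \<Rightarrow>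
    (nat \<Rightarrow> nat \<times> complex mat) \<Rightarrow> complex" where
  "opf m a f x = (\<Sum>k\<in>Idx m. a (idx m x) k * of_real (wv m (vpart m x) (idx m x) / wv m (vpart m x) k) * f (put m k x))"
definition fib :: "nat \<Rightarrow> (nat \<Rightarrow> complex mat) \<Rightarrow> ((nat \<Rightarrow> nat) \<Rightarrow> (nat \<Rightarrow> nat) \<Rightarrow> complex) \<Rightarrow> real \<Rightarrow> bool" where
  "fib m v a C \<longleftrightarrow> kbound p (Idx m) (wv m v) a C"
definition G :: "nat \<Rightarrow> real" where "G m = (\<Prod>i<m. \<gamma> i)"

lemma space_M: "x \<in> space M \<longleftrightarrow> (\<forall>i. x i \<in> {..<d i} \<times> V i)"
  by (auto simp: space_PiM space_N PiE_iff)

lemma idx_in: "x \<in> space M \<Longrightarrow> idx m x \<in> Idx m"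
  by (auto simp: idx_def Idx_def space_M mem_Times_iff)

lemma vpart_in: "x \<in> space M \<Longrightarrow> vpart m x \<in> Vs m"
  by (auto simp: vpart_def Vs_def space_M mem_Times_iff)

lemma pt_id: "pt m (vpart m x) (idx m x) x = x"
  by (auto simp: pt_def vpart_def idx_def)

lemma idx_pt: "j \<in> Idx m \<Longrightarrow> idx m (pt m v j y) = j"
  by (auto simp: idx_def pt_def Idx_def fun_eq_iff PiE_iff extensional_def)

lemma vpart_pt: "v \<in> Vs m \<Longrightarrow> vpart m (pt m v j y) = v"
  by (auto simp: vpart_def pt_def Vs_def fun_eq_iff PiE_iff extensional_def)

lemma put_pt: "put m k (pt m v j y) = pt m v k y"
  by (auto simp: put_def pt_def)

lemma put_idx: "put m (idx m x) x = x"
  by (auto simp: put_def idx_def)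

lemma put_in: "k \<in> Idx m \<Longrightarrow> x \<in> space M \<Longrightarrow> put m k x \<in> space M"
  by (auto simp: space_M put_def Idx_def PiE_iff mem_Times_iff)

lemma wv_bounds:
  assumes "v \<in> Vs m" "j \<in> Idx m"
  shows "1 \<le> wv m v j" "wv m v j \<le> G m" "0 < wv m v j"
proof -
  have e: "1 \<le> ent (v i) (j i)" "ent (v i) (j i) \<le> \<gamma> i" if "i < m" for i
    using assms V_ent[of "v i" i "j i"] that by (auto simp: Vs_def Idx_def PiE_iff)
  show 1: "1 \<le> wv m v j" unfolding wv_def using e by (intro prod_ge_1) auto
  show "wv m v j \<le> G m" unfolding wv_def G_def using e by (intro prod_mono) (auto intro: order_trans[OF zero_le_one])
  show "0 < wv m v j" using 1 by linarith
qed

lemma G_ge_1: "1 \<le> G m"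
  unfolding G_def using \<gamma> by (intro prod_ge_1) auto

lemma opf_pt:
  assumes "v \<in> Vs m" "j \<in> Idx m"
  shows "opf m a f (pt m v j y) = kact (Idx m) (wv m v) a (\<lambda>k. f (pt m v k y)) j"
  using assms by (simp add: opf_def kact_def idx_pt vpart_pt put_pt)

lemma restrict_measurable: "(\<lambda>x. g (restrict x {..<m})) \<in> borel_measurable M"
proof (rule measurable_compose[of "\<lambda>x. restrict x {..<m}" M "PiM {..<m} N" g])
  show "(\<lambda>x. restrict x {..<m}) \<in> measurable M (PiM {..<m} N)"
    by (rule measurable_restrict_subset) simp
  show "g \<in> borel_measurable (PiM {..<m} N)"
    unfolding measurable_def by (auto simp: sets_fin)
qed

lemma idx_restrict: "idx m (restrict x {..<m}) = idx m x"
  and vpart_restrict: "vpart m (restrict x {..<m}) = vpart m x"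
  by (simp_all add: idx_def vpart_def restrict_def cong: if_cong)

lemma put_measurable:
  assumes "k \<in> Idx m" shows "put m k \<in> measurable M M"
proof (rule measurable_PiM_single')
  show "put m k \<in> space M \<rightarrow> (\<Pi>\<^sub>E i\<in>UNIV. space (N i))"
    using put_in[OF assms] by (auto simp: space_PiM)
  fix i
  show "(\<lambda>x. put m k x i) \<in> measurable M (N i)"
  proof (cases "i < m")
    case True
    have "(\<lambda>z. (k i, snd z)) \<in> measurable (N i) (N i)"
      using assms True by (auto simp: measurable_def space_N sets_N Idx_def PiE_iff)
    then show ?thesis using True measurable_compose[OF measurable_component_singleton] by (simp add: put_def)
  qed (simp add: put_def)
qed

lemma opf_measurable:
  assumes "f \<in> borel_measurable M"
  shows "opf m a f \<in> borel_measurable M"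
proof -
  let ?c = "\<lambda>k x. a (idx m x) k * of_real (wv m (vpart m x) (idx m x) / wv m (vpart m x) k)"
  have c: "?c k \<in> borel_measurable M" for k
    using restrict_measurable[of "?c k" m] by (simp only: idx_restrict vpart_restrict)
  have "(\<lambda>x. ?c k x * f (put m k x)) \<in> borel_measurable M" if "k \<in> Idx m" for k
    by (intro borel_measurable_times c measurable_compose[OF put_measurable[OF that] assms])
  then show ?thesis
    unfolding opf_def by (intro borel_measurable_sum)
qed

text \<open>On every fibre the inequality is one between finite sums; raised to the power
  \<open>p\<close> and integrated over \<open>y\<close> and \<open>v\<close>, it becomes the
  inequality in L^p.\<close>

lemma opf_bound:
  assumes f: "f \<in> Lp_fun p M" and C: "0 \<le> C" and fib: "\<And>v. v \<in> Vs m \<Longrightarrow> fib m v a C"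
  shows "opf m a f \<in> Lp_fun p M" "pnorm p M (opf m a f) \<le> C * pnorm p M f"
proof -
  have fm [measurable]: "f \<in> borel_measurable M" using Lp_fun_measurable[OF p f] .
  have om [measurable]: "opf m a f \<in> borel_measurable M" using fm by (rule opf_measurable)
  have le: "(\<Sum>j\<in>Idx m. ennreal (norm (opf m a f (pt m v j y)) powr p)) \<le>
      ennreal (C powr p) * (\<Sum>j\<in>Idx m. ennreal (norm (f (pt m v j y)) powr p))" if v: "v \<in> Vs m" for v y
  proof -
    let ?\<xi> = "\<lambda>k. f (pt m v k y)"
    have "(\<Sum>j\<in>Idx m. norm (opf m a f (pt m v j y)) powr p) =
      pnorm p (count_space (Idx m)) (kact (Idx m) (wv m v) a ?\<xi>) powr p"
      using p v by (simp add: pnorm_finite_powr opf_pt)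
    also have "\<dots> \<le> (C * pnorm p (count_space (Idx m)) ?\<xi>) powr p"
      using fib[OF v] p by (intro powr_mono2) (auto simp: fib_def kbound_def)
    also have "\<dots> = C powr p * (\<Sum>j\<in>Idx m. norm (f (pt m v j y)) powr p)"
      using p C by (simp add: powr_mult pnorm_finite_powr)
    finally show ?thesis
      using C by (simp add: sum_ennreal sum_nonneg ennreal_mult[symmetric] del: sum_ennreal[symmetric])
  qed
  have "(\<integral>\<^sup>+x. ennreal (norm (opf m a f x) powr p) \<partial>M) =
    (\<integral>\<^sup>+v. ennreal (Wt m v) * (\<integral>\<^sup>+y. (\<Sum>j\<in>Idx m. ennreal (norm (opf m a f (pt m v j y)) powr p)) \<partial>Mt m) \<partial>count_space (Vs m))"
    by (rule nn_integral_M) measurable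
  also have "\<dots> \<le> (\<integral>\<^sup>+v. ennreal (Wt m v) * (\<integral>\<^sup>+y. ennreal (C powr p) * (\<Sum>j\<in>Idx m. ennreal (norm (f (pt m v j y)) powr p)) \<partial>Mt m) \<partial>count_space (Vs m))"
    by (intro nn_integral_mono mult_left_mono le) auto
  also have "\<dots> = (\<integral>\<^sup>+v. ennreal (C powr p) * (ennreal (Wt m v) * (\<integral>\<^sup>+y. (\<Sum>j\<in>Idx m. ennreal (norm (f (pt m v j y)) powr p)) \<partial>Mt m)) \<partial>count_space (Vs m))"
    using measurable_compose[OF pt_measurable fm]
    by (intro nn_integral_cong) (subst nn_integral_cmult, auto simp: mult_ac)
  also have "\<dots> = ennreal (C powr p) * (\<integral>\<^sup>+x. ennreal (norm (f x) powr p) \<partial>M)"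
    by (subst nn_integral_cmult) (auto simp: nn_integral_M[of "\<lambda>x. ennreal (norm (f x) powr p)" m])
  also have "\<dots> = ennreal ((C * pnorm p M f) powr p)"
    using C p f by (simp flip: pnorm_nn[OF p f] add: ennreal_mult powr_mult)
  finally have *: "(\<integral>\<^sup>+x. ennreal (norm (opf m a f x) powr p) \<partial>M) \<le> ennreal ((C * pnorm p M f) powr p)" .
  show "opf m a f \<in> Lp_fun p M" "pnorm p M (opf m a f) \<le> C * pnorm p M f"
    using Lp_fun_nn_bound[OF p om *] C p by auto
qed

lemma fib_entries: "v \<in> Vs m \<Longrightarrow> fib m v a (G m * (\<Sum>s\<in>Idx m \<times> Idx m. norm (a (fst s) (snd s))))"
  unfolding fib_def using p wv_bounds by (intro kbound_entries) auto

lemma opf_Lp: "f \<in> Lp_fun p M \<Longrightarrow> opf m a f \<in> Lp_fun p M"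
  using G_ge_1[of m] fib_entries
  by (intro opf_bound(1)[where C = "G m * (\<Sum>s\<in>Idx m \<times> Idx m. norm (a (fst s) (snd s)))"] mult_nonneg_nonneg sum_nonneg) auto

text \<open>The converse of \<open>opf_bound\<close>; together they make the operator norm the least
  common bound of the fibre norms. It rests on the positive mass of each \<open>v\<close>: a vector
  on \<open>Idx m\<close>, extended by 0 to the other fibres and constant in the later coordinates,
  is an element of L^p, and the factor \<open>Wt m v\<close> cancels.\<close>

lemma fib_of_op_bound:
  assumes v: "v \<in> Vs m" and C: "0 \<le> C"
    and bound: "\<And>f. f \<in> Lp_fun p M \<Longrightarrow> pnorm p M (opf m a f) \<le> C * pnorm p M f"
  shows "fib m v a C"
  unfolding fib_def kbound_def
proof
  fix \<xi> :: "(nat \<Rightarrow> nat) \<Rightarrow> complex"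
  interpret T: prob_space "Mt m" by (rule prob_Mt)
  define lift where "lift \<eta> x = (if vpart m x = v then \<eta> (idx m x) else 0)" for \<eta> :: "(nat \<Rightarrow> nat) \<Rightarrow> complex" and x
  have lift_m [measurable]: "lift \<eta> \<in> borel_measurable M" for \<eta>
  proof -
    have "lift \<eta> (restrict x {..<m}) = lift \<eta> x" for x
      unfolding lift_def idx_restrict vpart_restrict ..
    then show ?thesis using restrict_measurable[of "lift \<eta>" m] by simp
  qed
  have lift_pt: "lift \<eta> (pt m v' j y) = (if v' = v then \<eta> j else 0)" if "v' \<in> Vs m" "j \<in> Idx m" for \<eta> v' j y
    using that by (simp add: lift_def vpart_pt idx_pt)
  have lift_nn: "(\<integral>\<^sup>+x. ennreal (norm (lift \<eta> x) powr p) \<partial>M) =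
      ennreal (Wt m v * pnorm p (count_space (Idx m)) \<eta> powr p)" for \<eta>
  proof -
    have "(\<integral>\<^sup>+x. ennreal (norm (lift \<eta> x) powr p) \<partial>M) =
      (\<integral>\<^sup>+v'. ennreal (Wt m v') * (\<integral>\<^sup>+y. (\<Sum>j\<in>Idx m. ennreal (norm (lift \<eta> (pt m v' j y)) powr p)) \<partial>Mt m) \<partial>count_space (Vs m))"
      by (rule nn_integral_M) measurable
    also have "\<dots> = (\<integral>\<^sup>+v'. (if v' = v then ennreal (Wt m v * pnorm p (count_space (Idx m)) \<eta> powr p) else 0) \<partial>count_space (Vs m))"
    proof (intro nn_integral_cong)
      fix v' assume v': "v' \<in> space (count_space (Vs m))"
      have "(\<Sum>j\<in>Idx m. ennreal (norm (lift \<eta> (pt m v' j y)) powr p)) =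
         (if v' = v then ennreal (pnorm p (count_space (Idx m)) \<eta> powr p) else 0)" for y
        using v' p by (auto simp: lift_pt pnorm_finite_powr sum_ennreal)
      then show "ennreal (Wt m v') * (\<integral>\<^sup>+y. (\<Sum>j\<in>Idx m. ennreal (norm (lift \<eta> (pt m v' j y)) powr p)) \<partial>Mt m) =
        (if v' = v then ennreal (Wt m v * pnorm p (count_space (Idx m)) \<eta> powr p) else 0)"
        using Wt_pos[OF v] by (simp add: T.emeasure_space_1 ennreal_mult)
    qed
    also have "\<dots> = ennreal (Wt m v * pnorm p (count_space (Idx m)) \<eta> powr p)"
      using v by (subst nn_integral_count_space'[where A = "{v}"]) auto
    finally show ?thesis .
  qed
  have lift_Lp: "lift \<eta> \<in> Lp_fun p M" for \<eta>
    using p by (simp add: Lp_fun_iff_nn lift_nn)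
  have lift_norm: "pnorm p M (lift \<eta>) powr p = Wt m v * pnorm p (count_space (Idx m)) \<eta> powr p" for \<eta>
    using pnorm_nn[OF p lift_Lp[of \<eta>]] lift_nn[of \<eta>] Wt_pos[OF v] by (simp add: less_imp_le)
  let ?\<zeta> = "kact (Idx m) (wv m v) a \<xi>"
  have "opf m a (lift \<xi>) x = lift ?\<zeta> x" if x: "x \<in> space M" for x
  proof -
    define v' j where "v' = vpart m x" and "j = idx m x"
    have vj: "v' \<in> Vs m" "j \<in> Idx m" "x = pt m v' j x"
      using x by (simp_all add: v'_def j_def vpart_in idx_in pt_id)
    have "opf m a (lift \<xi>) (pt m v' j x) = lift ?\<zeta> (pt m v' j x)"
      unfolding opf_pt[OF vj(1,2)] using vj(1,2) by (auto simp: lift_pt kact_def)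
    then show ?thesis using vj(3) by simp
  qed
  then have "pnorm p M (opf m a (lift \<xi>)) = pnorm p M (lift ?\<zeta>)"
    using p opf_measurable by (intro pnorm_cong_AE) auto
  then have "pnorm p M (lift ?\<zeta>) \<le> C * pnorm p M (lift \<xi>)" using bound[OF lift_Lp, of \<xi>] by simp
  then have "pnorm p M (lift ?\<zeta>) powr p \<le> (C * pnorm p M (lift \<xi>)) powr p"
    using p by (intro powr_mono2) auto
  then have "Wt m v * pnorm p (count_space (Idx m)) ?\<zeta> powr p \<le> Wt m v * (C * pnorm p (count_space (Idx m)) \<xi>) powr p"
    using C p by (simp add: powr_mult lift_norm mult.left_commute)
  then have "pnorm p (count_space (Idx m)) ?\<zeta> powr p \<le> (C * pnorm p (count_space (Idx m)) \<xi>) powr p"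
    using Wt_pos[OF v] by (subst (asm) mult_le_cancel_left_pos)
  then show "pnorm p (count_space (Idx m)) ?\<zeta> \<le> C * pnorm p (count_space (Idx m)) \<xi>"
    using p C by (simp add: powr_le_iff)
qed

end

section \<open>The operators of finite level\<close>

context tower
begin

sublocale LP: cbanach "Lp p M" by (rule cbanach_Lp[OF p])

abbreviation "B \<equiv> Lp p M"

lemma opf_eqI:
  assumes "\<And>v j. v \<in> Vs m \<Longrightarrow> j \<in> Idx m \<Longrightarrow> opf m a f (pt m v j x) = g (pt m v j x)" "x \<in> space M"
  shows "opf m a f x = g x"
  using assms(1)[OF vpart_in[OF assms(2)] idx_in[OF assms(2)]] by (simp add: pt_id)

lemma opf_add_fun: "opf m a (\<lambda>x. f x + g x) x = opf m a f x + opf m a g x"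
  by (simp only: opf_def distrib_left sum.distrib)

lemma opf_scale_fun: "opf m a (\<lambda>x. c * f x) x = c * opf m a f x"
  by (simp add: opf_def sum_distrib_left mult_ac)

lemma opf_diff_fun: "opf m a (\<lambda>x. f x - g x) x = opf m a f x - opf m a g x"
  by (simp only: opf_def right_diff_distrib sum_subtractf)

definition C0 :: "nat \<Rightarrow> ((nat \<Rightarrow> nat) \<Rightarrow> (nat \<Rightarrow> nat) \<Rightarrow> complex) \<Rightarrow> real" where
  "C0 m a = G m * (\<Sum>s\<in>Idx m \<times> Idx m. norm (a (fst s) (snd s)))"

lemma C0_nonneg: "0 \<le> C0 m a"
  unfolding C0_def using G_ge_1[of m] by (intro mult_nonneg_nonneg sum_nonneg) auto

lemma opf_C0: "f \<in> Lp_fun p M \<Longrightarrow> pnorm p M (opf m a f) \<le> C0 m a * pnorm p M f"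
  by (intro opf_bound(2) C0_nonneg) (auto simp: C0_def intro: fib_entries)

text \<open>Since \<open>opf\<close> evaluates at the moved points \<open>put m k x\<close>, null
  sets are not visibly respected. The norm bound, applied to the difference of the functions,
  settles this and makes \<open>Op\<close> independent of representatives.\<close>

lemma opf_cong_AE:
  assumes f: "f \<in> Lp_fun p M" "g \<in> Lp_fun p M" and ae: "AE x in M. f x = g x"
  shows "AE x in M. opf m a f x = opf m a g x"
proof -
  have d: "(\<lambda>x. f x - g x) \<in> Lp_fun p M" using f by (rule Lp_fun_diff[OF p])
  have "pnorm p M (\<lambda>x. f x - g x) = pnorm p M (\<lambda>x. 0)"
    using ae d by (intro pnorm_cong_AE[OF p]) (auto simp: Lp_fun_measurable[OF p])
  then have "pnorm p M (opf m a (\<lambda>x. f x - g x)) \<le> 0"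
    using opf_C0[OF d, of m a] by (simp add: pnorm_zero[OF p])
  then have "pnorm p M (opf m a (\<lambda>x. f x - g x)) = 0"
    using pnorm_nonneg[OF p] by (intro antisym)
  then have "AE x in M. opf m a (\<lambda>x. f x - g x) x = 0"
    by (rule pnorm_eq_zero_AE[OF p opf_Lp[OF d]])
  then show ?thesis by eventually_elim (simp add: opf_diff_fun)
qed

definition Op :: "nat \<Rightarrow> ((nat \<Rightarrow> nat) \<Rightarrow> (nat \<Rightarrow> nat) \<Rightarrow> complex) \<Rightarrow>
    ((nat \<Rightarrow> nat \<times> complex mat) \<Rightarrow> complex) set \<Rightarrow> ((nat \<Rightarrow> nat \<times> complex mat) \<Rightarrow> complex) set" where
  "Op m a = (\<lambda>F\<in>vcarrier B. Lp_class p M (opf m a (rep F)))"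

lemma Lp_class_eqI:
  assumes "f \<in> Lp_fun p M" "g \<in> Lp_fun p M" "\<And>x. x \<in> space M \<Longrightarrow> f x = g x"
  shows "Lp_class p M f = Lp_class p M g"
  using assms by (subst Lp_class_eq_iff[OF p]) auto

lemma Op_class:
  assumes f: "f \<in> Lp_fun p M"
  shows "Op m a (Lp_class p M f) = Lp_class p M (opf m a f)"
proof -
  have r: "rep (Lp_class p M f) \<in> Lp_fun p M" "AE x in M. rep (Lp_class p M f) x = f x"
    using rep_Lp_class[OF p f] by auto
  have "Lp_class p M (opf m a (rep (Lp_class p M f))) = Lp_class p M (opf m a f)"
    using opf_cong_AE[OF r(1) f r(2)] Lp_class_eq_iff[OF p opf_Lp[OF r(1)] opf_Lp[OF f]] by simp
  then show ?thesis using Lp_class_in[OF p f] by (simp add: Op_def)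
qed

lemma Op_in [simp]: "Op m a \<in> bounded_ops B"
proof (rule LP.bounded_opsI[where C = "C0 m a"])
  show "Op m a \<in> extensional (vcarrier B)" by (simp add: Op_def)
next
  fix F assume "F \<in> vcarrier B"
  then show "Op m a F \<in> vcarrier B"
    by (elim Lp_carrierE[OF p]) (simp add: Op_class Lp_class_in[OF p] opf_Lp)
next
  fix F H assume "F \<in> vcarrier B" "H \<in> vcarrier B"
  then obtain f h where fh: "f \<in> Lp_fun p M" "F = Lp_class p M f" "h \<in> Lp_fun p M" "H = Lp_class p M h"
    by (metis Lp_carrierE[OF p])
  then show "Op m a (vadd B F H) = vadd B (Op m a F) (Op m a H)"
    by (simp add: Lp_add[OF p] Op_class Lp_fun_add[OF p] opf_Lp opf_add_fun[abs_def])
next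
  fix c F assume "F \<in> vcarrier B"
  then show "Op m a (vscale B c F) = vscale B c (Op m a F)"
    by (elim Lp_carrierE[OF p]) (simp add: Lp_scale[OF p] Op_class Lp_fun_scale[OF p] opf_Lp opf_scale_fun[abs_def])
next
  fix F assume "F \<in> vcarrier B"
  then show "vnorm B (Op m a F) \<le> C0 m a * vnorm B F"
    by (elim Lp_carrierE[OF p]) (simp add: Lp_norm[OF p] Op_class opf_Lp opf_C0)
qed

lemma Op_norm_le:
  assumes "0 \<le> C" "\<And>v. v \<in> Vs m \<Longrightarrow> fib m v a C"
  shows "op_norm B (Op m a) \<le> C"
proof (rule LP.op_norm_le[OF Op_in assms(1)])
  show "LP.op_bound (Op m a) C"
    unfolding LP.op_bound_def
  proof
    fix F assume "F \<in> vcarrier B"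
    then show "vnorm B (Op m a F) \<le> C * vnorm B F"
      using opf_bound(2)[OF _ assms] by (elim Lp_carrierE[OF p]) (simp add: Lp_norm[OF p] Op_class opf_Lp)
  qed
qed

lemma fib_op_norm:
  assumes "v \<in> Vs m" shows "fib m v a (op_norm B (Op m a))"
proof (rule fib_of_op_bound[OF assms])
  show "0 \<le> op_norm B (Op m a)" by (rule LP.op_norm_nonneg) simp
  fix f assume f: "f \<in> Lp_fun p M"
  show "pnorm p M (opf m a f) \<le> op_norm B (Op m a) * pnorm p M f"
    using LP.norm_op_le[OF Op_in[of m a] Lp_class_in[OF p f]] f by (simp add: Op_class Lp_norm[OF p] opf_Lp)
qed

lemma Op_eqI:
  assumes T: "T \<in> bounded_ops B"
    and "\<And>f. f \<in> Lp_fun p M \<Longrightarrow> T (Lp_class p M f) = Lp_class p M (opf m a f)"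
  shows "T = Op m a"
  by (rule LP.bounded_ops_eqI[OF T Op_in]) (auto elim!: Lp_carrierE[OF p] simp: assms(2) Op_class)

lemma Op_cong:
  assumes "\<And>j k. j \<in> Idx m \<Longrightarrow> k \<in> Idx m \<Longrightarrow> a j k = b j k"
  shows "Op m a = Op m b"
proof (rule Op_eqI)
  fix f assume f: "f \<in> Lp_fun p M"
  have "opf m a f x = opf m b f x" if "x \<in> space M" for x
    unfolding opf_def using idx_in[OF that] assms by (intro sum.cong) auto
  then show "Op m a (Lp_class p M f) = Lp_class p M (opf m b f)"
    unfolding Op_class[OF f] by (rule Lp_class_eqI[OF opf_Lp[OF f] opf_Lp[OF f]])
qed simp

lemma Op_add: "op_add B (Op m a) (Op m b) = Op m (\<lambda>j k. a j k + b j k)"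
proof (rule Op_eqI)
  fix f assume f: "f \<in> Lp_fun p M"
  have "opf m (\<lambda>j k. a j k + b j k) f = (\<lambda>x. opf m a f x + opf m b f x)"
    by (rule ext) (simp only: opf_def distrib_right sum.distrib)
  then show "op_add B (Op m a) (Op m b) (Lp_class p M f) = Lp_class p M (opf m (\<lambda>j k. a j k + b j k) f)"
    using f by (simp add: op_add_def Lp_class_in[OF p] Op_class Lp_add[OF p] opf_Lp)
qed simp

lemma Op_scale: "op_scale B c (Op m a) = Op m (\<lambda>j k. c * a j k)"
proof (rule Op_eqI)
  fix f assume f: "f \<in> Lp_fun p M"
  have "opf m (\<lambda>j k. c * a j k) f = (\<lambda>x. c * opf m a f x)"
    by (auto simp: opf_def sum_distrib_left mult_ac)
  then show "op_scale B c (Op m a) (Lp_class p M f) = Lp_class p M (opf m (\<lambda>j k. c * a j k) f)"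
    using f by (simp add: op_scale_def Lp_class_in[OF p] Op_class Lp_scale[OF p] opf_Lp)
qed simp

definition kmul :: "nat \<Rightarrow> ((nat \<Rightarrow> nat) \<Rightarrow> (nat \<Rightarrow> nat) \<Rightarrow> complex) \<Rightarrow> ((nat \<Rightarrow> nat) \<Rightarrow> (nat \<Rightarrow> nat) \<Rightarrow> complex) \<Rightarrow>
    (nat \<Rightarrow> nat) \<Rightarrow> (nat \<Rightarrow> nat) \<Rightarrow> complex" where
  "kmul m a b j k = (\<Sum>l\<in>Idx m. a j l * b l k)"

lemma Op_mult: "op_mult B (Op m a) (Op m b) = Op m (kmul m a b)"
proof (rule Op_eqI)
  fix f assume f: "f \<in> Lp_fun p M"
  have "opf m a (opf m b f) x = opf m (kmul m a b) f x" if "x \<in> space M" for x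
  proof (rule opf_eqI[OF _ that])
    fix v j assume vj: "v \<in> Vs m" "j \<in> Idx m"
    have "kact (Idx m) (wv m v) a (\<lambda>k. opf m b f (pt m v k x)) j =
      kact (Idx m) (wv m v) a (kact (Idx m) (wv m v) b (\<lambda>k. f (pt m v k x))) j"
      unfolding kact_def[of _ _ a] using vj by (intro sum.cong) (auto simp: opf_pt)
    then show "opf m a (opf m b f) (pt m v j x) = opf m (kmul m a b) f (pt m v j x)"
      using vj wv_bounds(3)[OF vj(1)] by (simp add: opf_pt kact_mult kmul_def[abs_def])
  qed
  then show "op_mult B (Op m a) (Op m b) (Lp_class p M f) = Lp_class p M (opf m (kmul m a b) f)"
    unfolding LP.op_mult_apply[OF Lp_class_in[OF p f]] Op_class[OF f] Op_class[OF opf_Lp[OF f]]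
    by (rule Lp_class_eqI[OF opf_Lp[OF opf_Lp[OF f]] opf_Lp[OF f]])
qed simp

lemma Op_one: "Op m (\<lambda>j k. if j = k then 1 else 0) = op_one B"
proof (rule sym, rule Op_eqI)
  fix f assume f: "f \<in> Lp_fun p M"
  have "opf m (\<lambda>j k. if j = k then 1 else 0) f x = f x" if x: "x \<in> space M" for x
  proof -
    have "wv m (vpart m x) (idx m x) \<noteq> 0"
      using wv_bounds(3)[OF vpart_in[OF x] idx_in[OF x], of m] by simp
    then have "opf m (\<lambda>j k. if j = k then 1 else 0) f x = (\<Sum>k\<in>Idx m. if k = idx m x then f (put m (idx m x) x) else 0)"
      unfolding opf_def by (intro sum.cong) auto
    then show ?thesis using idx_in[OF x] by (simp add: put_idx)
  qed
  then show "op_one B (Lp_class p M f) = Lp_class p M (opf m (\<lambda>j k. if j = k then 1 else 0) f)"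
    unfolding LP.op_one_apply[OF Lp_class_in[OF p f]] by (intro Lp_class_eqI[OF f opf_Lp[OF f]]) simp
qed simp

lemma Op_zero: "Op m (\<lambda>j k. 0) = op_zero B"
proof (rule sym, rule Op_eqI)
  fix f assume f: "f \<in> Lp_fun p M"
  have "opf m (\<lambda>j k. 0) f = (\<lambda>x. 0)" by (auto simp: opf_def)
  then show "op_zero B (Lp_class p M f) = Lp_class p M (opf m (\<lambda>j k. 0) f)"
    using f by (simp add: LP.op_zero_apply Lp_class_in[OF p] Lp_zero[OF p])
qed simp

text \<open>The kernel of \<open>a\<close> tensored with the identity on the factors from
  \<open>m\<close> to \<open>m' - 1\<close>.\<close>

definition klift :: "nat \<Rightarrow> nat \<Rightarrow> ((nat \<Rightarrow> nat) \<Rightarrow> (nat \<Rightarrow> nat) \<Rightarrow> complex) \<Rightarrow> (nat \<Rightarrow> nat) \<Rightarrow> (nat \<Rightarrow> nat) \<Rightarrow> complex" where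
  "klift m m' a J L = (if \<forall>i\<in>{m..<m'}. J i = L i then a (restrict J {..<m}) (restrict L {..<m}) else 0)"

lemma Idx_restrict: "J \<in> Idx m' \<Longrightarrow> m \<le> m' \<Longrightarrow> restrict J {..<m} \<in> Idx m"
  unfolding Idx_def restrict_PiE_iff by (meson PiE_mem lessThan_iff less_le_trans)

text \<open>Replaces the first \<open>m\<close> coordinates of \<open>J\<close> by \<open>k\<close>.
  For fixed \<open>J\<close> this parametrizes the columns in which row \<open>J\<close> of a lifted
  kernel can be nonzero.\<close>

definition glue :: "nat \<Rightarrow> nat \<Rightarrow> (nat \<Rightarrow> nat) \<Rightarrow> (nat \<Rightarrow> nat) \<Rightarrow> nat \<Rightarrow> nat" where
  "glue m m' J k = (\<lambda>i\<in>{..<m'}. if i < m then k i else J i)"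

lemma glue_in:
  assumes "J \<in> Idx m'" "k \<in> Idx m" "m \<le> m'" shows "glue m m' J k \<in> Idx m'"
  using assms by (auto simp: glue_def Idx_def restrict_PiE_iff dest: PiE_mem)

lemma glue_restrict:
  assumes "k \<in> Idx m" "m \<le> m'" shows "restrict (glue m m' J k) {..<m} = k"
  using assms by (auto simp: glue_def Idx_def fun_eq_iff PiE_iff extensional_def)

lemma glue_bij:
  assumes J: "J \<in> Idx m'" and m: "m \<le> m'"
  shows "bij_betw (glue m m' J) (Idx m) {L \<in> Idx m'. \<forall>i\<in>{m..<m'}. J i = L i}"
proof (rule bij_betw_byWitness[where f' = "\<lambda>L. restrict L {..<m}"])
  show "\<forall>k\<in>Idx m. restrict (glue m m' J k) {..<m} = k" using glue_restrict m by auto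
  show "\<forall>L\<in>{L \<in> Idx m'. \<forall>i\<in>{m..<m'}. J i = L i}. glue m m' J (restrict L {..<m}) = L"
  proof clarify
    fix L assume L: "L \<in> Idx m'" "\<forall>i\<in>{m..<m'}. J i = L i"
    show "glue m m' J (restrict L {..<m}) = L"
    proof
      fix i
      consider "i < m" | "m \<le> i" "i < m'" | "\<not> i < m'" by linarith
      then show "glue m m' J (restrict L {..<m}) i = L i"
        using L m by cases (auto simp: glue_def Idx_def PiE_iff extensional_def)
    qed
  qed
  show "glue m m' J ` Idx m \<subseteq> {L \<in> Idx m'. \<forall>i\<in>{m..<m'}. J i = L i}"
    using glue_in[OF J _ m] by (auto simp: glue_def)
  show "(\<lambda>L. restrict L {..<m}) ` {L \<in> Idx m'. \<forall>i\<in>{m..<m'}. J i = L i} \<subseteq> Idx m"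
    using Idx_restrict m by auto
qed

lemma sum_klift:
  assumes J: "J \<in> Idx m'" and m: "m \<le> m'"
  shows "(\<Sum>L\<in>Idx m'. klift m m' a J L * h L) = (\<Sum>k\<in>Idx m. a (restrict J {..<m}) k * h (glue m m' J k))"
proof -
  have "(\<Sum>L\<in>Idx m'. klift m m' a J L * h L) =
    (\<Sum>L\<in>{L \<in> Idx m'. \<forall>i\<in>{m..<m'}. J i = L i}. a (restrict J {..<m}) (restrict L {..<m}) * h L)"
    by (rule sum.mono_neutral_cong_right) (auto simp: klift_def)
  also have "\<dots> = (\<Sum>k\<in>Idx m. a (restrict J {..<m}) (restrict (glue m m' J k) {..<m}) * h (glue m m' J k))"
    by (rule sum.reindex_bij_betw[OF glue_bij[OF J m], symmetric])
  finally show ?thesis using m by (simp add: glue_restrict)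
qed

lemma wv_split:
  assumes m: "m \<le> m'"
  shows "wv m' v J = wv m (restrict v {..<m}) (restrict J {..<m}) * (\<Prod>i\<in>{m..<m'}. ent (v i) (J i))"
proof -
  have "wv m' v J = (\<Prod>i\<in>{..<m} \<union> {m..<m'}. ent (v i) (J i))"
    unfolding wv_def using m by (intro prod.cong) auto
  also have "\<dots> = (\<Prod>i<m. ent (v i) (J i)) * (\<Prod>i\<in>{m..<m'}. ent (v i) (J i))"
    by (rule prod.union_disjoint) auto
  finally show ?thesis by (simp add: wv_def)
qed

text \<open>Where the lifted kernel is nonzero, row and column agree from \<open>m\<close> on, so
  the weights of these coordinates cancel in the quotient. Hence finitely many elements of finite
  level can always be moved to a common level.\<close>

lemma Op_lift:
  assumes m: "m \<le> m'" shows "Op m' (klift m m' a) = Op m a"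
proof (rule Op_eqI)
  fix f assume f: "f \<in> Lp_fun p M"
  have "opf m' (klift m m' a) f x = opf m a f x" if x: "x \<in> space M" for x
  proof -
    let ?J = "idx m' x" and ?v = "vpart m' x"
    have J: "?J \<in> Idx m'" "?v \<in> Vs m'" using x by (auto intro: idx_in vpart_in)
    have r: "restrict ?J {..<m} = idx m x" "restrict ?v {..<m} = vpart m x"
      using m by (auto simp: idx_def vpart_def)
    have "opf m' (klift m m' a) f x =
      (\<Sum>L\<in>Idx m'. klift m m' a ?J L * (of_real (wv m' ?v ?J / wv m' ?v L) * f (put m' L x)))"
      by (simp add: opf_def mult.assoc)
    also have "\<dots> = (\<Sum>k\<in>Idx m. a (idx m x) k * (of_real (wv m' ?v ?J / wv m' ?v (glue m m' ?J k)) * f (put m' (glue m m' ?J k) x)))"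
      unfolding sum_klift[OF J(1) m] r ..
    also have "\<dots> = opf m a f x"
      unfolding opf_def mult.assoc
    proof (intro sum.cong refl)
      fix k assume k: "k \<in> Idx m"
      have t: "(\<Prod>i\<in>{m..<m'}. ent (?v i) (glue m m' ?J k i)) = (\<Prod>i\<in>{m..<m'}. ent (?v i) (?J i))"
        by (intro prod.cong) (auto simp: glue_def)
      have "(\<Prod>i\<in>{m..<m'}. ent (?v i) (?J i)) > 0"
        using J by (intro prod_pos) (auto simp: Idx_def Vs_def intro!: V_ent(4) dest: PiE_mem)
      then have ne: "(\<Prod>i\<in>{m..<m'}. ent (?v i) (?J i)) \<noteq> 0" by linarith
      then have w: "wv m' ?v ?J / wv m' ?v (glue m m' ?J k) = wv m (vpart m x) (idx m x) / wv m (vpart m x) k"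
        unfolding wv_split[OF m] r glue_restrict[OF k m] t by (rule mult_divide_mult_cancel_right)
      have pu: "put m' (glue m m' ?J k) x = put m k x"
        using m by (auto simp: put_def glue_def idx_def fun_eq_iff)
      show "a (idx m x) k * (of_real (wv m' ?v ?J / wv m' ?v (glue m m' ?J k)) * f (put m' (glue m m' ?J k) x)) =
        a (idx m x) k * (of_real (wv m (vpart m x) (idx m x) / wv m (vpart m x) k) * f (put m k x))"
        unfolding w pu ..
    qed
    finally show ?thesis .
  qed
  then show "Op m' (klift m m' a) (Lp_class p M f) = Lp_class p M (opf m a f)"
    unfolding Op_class[OF f] by (rule Lp_class_eqI[OF opf_Lp[OF f] opf_Lp[OF f]])
qed simp

end

section \<open>Elementary tensors and the generators\<close>

lemma prod_less_top_ennreal: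
  fixes f :: "'a \<Rightarrow> ennreal"
  assumes "\<And>i. i \<in> I \<Longrightarrow> f i < \<infinity>" shows "prod f I < \<infinity>"
  using assms by (induction I rule: infinite_finite_induct) (auto simp: ennreal_mult_less_top infinity_ennreal_def)

context tower
begin

definition rhof :: "nat \<Rightarrow> complex mat \<Rightarrow> (nat \<times> complex mat \<Rightarrow> complex) \<Rightarrow> nat \<times> complex mat \<Rightarrow> complex" where
  "rhof k a f = (\<lambda>(j, v). \<Sum>l<d k. (v * a * diag_inv (d k) v) $$ (j, l) * f (l, v))"

lemma conj_entry:
  assumes v: "v \<in> V k" and a: "a \<in> carrier_mat (d k) (d k)" and j: "j < d k" "l < d k"
  shows "(v * a * diag_inv (d k) v) $$ (j, l) = a $$ (j, l) * of_real (ent v j / ent v l)"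
proof -
  have "v = mat_diag (d k) (\<lambda>j. v $$ (j, j))"
    using V_carrier[OF v] V_diagonal[OF v] by (intro eq_matI) (auto simp: mat_diag_def diagonal_mat_def)
  then have "v * a = Matrix.mat (d k) (d k) (\<lambda>(i, j). v $$ (i, i) * a $$ (i, j))"
    using mat_diag_mult_left[OF a, of "\<lambda>j. v $$ (j, j)"] by simp
  then have "v * a * diag_inv (d k) v =
    Matrix.mat (d k) (d k) (\<lambda>(i, j). Matrix.mat (d k) (d k) (\<lambda>(i, j). v $$ (i, i) * a $$ (i, j)) $$ (i, j) * (1 / v $$ (j, j)))"
    unfolding diag_inv_def using mat_diag_mult_right[of "v * a" "d k" "d k" "\<lambda>j. 1 / v $$ (j, j)"] by simp
  then show ?thesis using j V_ent(1)[OF v j(1)] V_ent(1)[OF v j(2)] by simp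
qed

lemma N_measurable: "f \<in> borel_measurable (N k)"
  by (simp add: N_eq)

text \<open>All atoms of a single factor have positive mass. Hence representatives of a class agree
  on the whole of \<open>space (N k)\<close>, and \<open>rho\<close> can be computed
  pointwise.\<close>

lemma AE_N: "(AE x in N k. P x) \<longleftrightarrow> (\<forall>x\<in>space (N k). P x)"
  by (subst N_eq, subst AE_point_measure) (auto simp: space_N wgt_pos)

lemma rhof_Lp:
  assumes f: "f \<in> Lp_fun p (N k)" and a: "a \<in> carrier_mat (d k) (d k)"
  shows "rhof k a f \<in> Lp_fun p (N k)"
proof -
  have "(\<lambda>(j, v). (v * a * diag_inv (d k) v) $$ (j, l) * f (l, v)) \<in> Lp_fun p (N k)" if l: "l < d k" for l
  proof -
    let ?g = "\<lambda>(j, v). (v * a * diag_inv (d k) v) $$ (j, l) * f (l, v)"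
    \<comment> \<open>The quotient of diagonal entries is at most \<open>\<gamma> k\<close>, since
      the numerator is at most \<open>\<gamma> k\<close> and the denominator at least 1; the sum
      dominates every entry of column \<open>l\<close>.\<close>
    define K where "K = \<gamma> k * (\<Sum>j<d k. norm (a $$ (j, l)))"
    have K: "0 \<le> K" unfolding K_def using \<gamma>[of k] by (intro mult_nonneg_nonneg sum_nonneg) auto
    have le: "norm (?g (j, v)) \<le> K * norm (f (l, v))" if v: "v \<in> V k" and j: "j < d k" for j v
    proof -
      have e: "0 < ent v j" "ent v j \<le> \<gamma> k" "1 \<le> ent v l"
        using V_ent[OF v j] V_ent[OF v l] by auto
      then have "ent v j / ent v l \<le> \<gamma> k / 1" by (intro frac_le) auto
      then have "norm (a $$ (j, l)) * (ent v j / ent v l) \<le> (\<Sum>j<d k. norm (a $$ (j, l))) * \<gamma> k"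
        using j e by (intro mult_mono member_le_sum) (auto intro: sum_nonneg)
      then have "norm (a $$ (j, l)) * (ent v j / ent v l) * norm (f (l, v)) \<le> K * norm (f (l, v))"
        unfolding K_def by (intro mult_right_mono) (auto simp: mult.commute)
      then show ?thesis using e conj_entry[OF v a j l] by (simp add: norm_mult norm_divide)
    qed
    have fin: "(\<integral>\<^sup>+x. ennreal (norm (f x) powr p) \<partial>N k) < \<infinity>"
      using f by (auto simp: Lp_fun_iff_nn[OF p])
    have "(\<integral>\<^sup>+x. ennreal (norm (?g x) powr p) \<partial>N k) =
      (\<integral>\<^sup>+v. ennreal (wgt k v) * (\<Sum>j<d k. ennreal (norm (?g (j, v)) powr p)) \<partial>count_space (V k))"
      by (rule nn_integral_N)
    also have "\<dots> \<le> (\<integral>\<^sup>+v. ennreal (real (d k) * K powr p) * (ennreal (wgt k v) * (\<Sum>j<d k. ennreal (norm (f (j, v)) powr p))) \<partial>count_space (V k))"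
    proof (rule nn_integral_mono)
      fix v assume "v \<in> space (count_space (V k))"
      then have v: "v \<in> V k" by simp
      have "(\<Sum>j<d k. ennreal (norm (?g (j, v)) powr p)) \<le> (\<Sum>j<d k. ennreal ((K * norm (f (l, v))) powr p))"
        using le[OF v] p by (intro sum_mono ennreal_leI powr_mono2) auto
      also have "\<dots> = ennreal (real (d k) * K powr p) * ennreal (norm (f (l, v)) powr p)"
        using K by (simp add: powr_mult ennreal_of_nat_eq_real_of_nat ennreal_mult mult.assoc)
      also have "\<dots> \<le> ennreal (real (d k) * K powr p) * (\<Sum>j<d k. ennreal (norm (f (j, v)) powr p))"
        using l by (intro mult_left_mono member_le_sum[of l "{..<d k}" "\<lambda>j. ennreal (norm (f (j, v)) powr p)"]) auto
      finally show "ennreal (wgt k v) * (\<Sum>j<d k. ennreal (norm (?g (j, v)) powr p)) \<le>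
        ennreal (real (d k) * K powr p) * (ennreal (wgt k v) * (\<Sum>j<d k. ennreal (norm (f (j, v)) powr p)))"
        by (subst mult.left_commute) (rule mult_left_mono, auto)
    qed
    also have "\<dots> = ennreal (real (d k) * K powr p) * (\<integral>\<^sup>+x. ennreal (norm (f x) powr p) \<partial>N k)"
      by (subst nn_integral_cmult) (auto simp: nn_integral_N)
    also have "\<dots> < \<infinity>" using fin by (simp add: ennreal_mult_less_top)
    finally show ?thesis by (simp add: Lp_fun_iff_nn[OF p] N_measurable)
  qed
  then have "(\<lambda>x. \<Sum>l<d k. (\<lambda>(j, v). (v * a * diag_inv (d k) v) $$ (j, l) * f (l, v)) x) \<in> Lp_fun p (N k)"
    by (intro Lp_fun_sum[OF p]) auto
  then show ?thesis by (simp add: rhof_def case_prod_unfold)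
qed

lemma rho_rep:
  assumes F: "F \<in> vcarrier (Lp p (N k))" and a: "a \<in> carrier_mat (d k) (d k)"
  shows "rho p (d k) (\<gamma> k) (w (d k) (\<gamma> k)) a F \<in> vcarrier (Lp p (N k))"
    and "x \<in> space (N k) \<Longrightarrow> rep (rho p (d k) (\<gamma> k) (w (d k) (\<gamma> k)) a F) x = rhof k a (rep F) x"
proof -
  have eq: "rho p (d k) (\<gamma> k) (w (d k) (\<gamma> k)) a F = Lp_class p (N k) (rhof k a (rep F))"
    using F by (simp add: rho_def rhof_def X_seq_def)
  have r: "rhof k a (rep F) \<in> Lp_fun p (N k)"
    by (rule rhof_Lp[OF carrier_rep(1)[OF p F] a])
  show "rho p (d k) (\<gamma> k) (w (d k) (\<gamma> k)) a F \<in> vcarrier (Lp p (N k))"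
    unfolding eq by (rule Lp_class_in[OF p r])
  assume "x \<in> space (N k)"
  then show "rep (rho p (d k) (\<gamma> k) (w (d k) (\<gamma> k)) a F) x = rhof k a (rep F) x"
    using rep_Lp_class(2)[OF p r] unfolding eq AE_N by blast
qed

definition elemfun :: "nat \<Rightarrow> (nat \<Rightarrow> nat \<times> complex mat \<Rightarrow> complex) \<Rightarrow> ((nat \<Rightarrow> nat \<times> complex mat) \<Rightarrow> complex) \<Rightarrow>
    (nat \<Rightarrow> nat \<times> complex mat) \<Rightarrow> complex" where
  "elemfun m \<xi> h x = (\<Prod>k<m. \<xi> k (x k)) * h (restrict x {m..})"

lemma elem_tensor_eq: "elem_tensor p N m \<Xi> H = Lp_class p M (elemfun m (\<lambda>k. rep (\<Xi> k)) (rep H))"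
  by (simp add: elem_tensor_def elemfun_def[abs_def])

text \<open>By Tonelli the integral of the p-th power factors into integrals over the single factors
  and one over the tail, all finite.\<close>

lemma elemfun_Lp:
  assumes \<xi>: "\<And>k. k < m \<Longrightarrow> \<xi> k \<in> Lp_fun p (N k)" and h: "h \<in> Lp_fun p (Mt m)"
  shows "elemfun m \<xi> h \<in> Lp_fun p M"
proof -
  interpret Q: prob_space "N i" for i by simp
  interpret PS: product_sigma_finite N by unfold_locales
  have [measurable]: "h \<in> borel_measurable (Mt m)" using Lp_fun_measurable[OF p h] .
  have m1: "(\<lambda>x. \<xi> k (x k)) \<in> borel_measurable M" for k
    by (rule measurable_compose[of "\<lambda>x. x k" M "N k"]) (simp_all add: N_measurable)
  have "(\<lambda>x. h (restrict x {m..})) \<in> borel_measurable M"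
    by (rule measurable_compose[OF measurable_restrict_subset]) auto
  then have em: "elemfun m \<xi> h \<in> borel_measurable M"
    unfolding elemfun_def[abs_def] by (intro borel_measurable_times borel_measurable_prod m1)
  have "(\<integral>\<^sup>+x. ennreal (norm (elemfun m \<xi> h x) powr p) \<partial>M) =
    (\<integral>\<^sup>+z. (\<integral>\<^sup>+y. ennreal (norm (elemfun m \<xi> h (merge {..<m} {m..} (z, y))) powr p) \<partial>Mt m) \<partial>PiM {..<m} N)"
    using em by (intro nn_integral_PiM_split) auto
  also have "\<dots> = (\<integral>\<^sup>+z. (\<integral>\<^sup>+y. (\<Prod>k<m. ennreal (norm (\<xi> k (z k)) powr p)) * ennreal (norm (h y) powr p) \<partial>Mt m) \<partial>PiM {..<m} N)"
  proof (intro nn_integral_cong)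
    fix z y assume y: "y \<in> space (Mt m)"
    have r: "restrict (merge {..<m} {m..} (z, y)) {m..} = y"
      using y by (auto simp: space_PiM merge_def fun_eq_iff PiE_iff extensional_def)
    have "(\<Prod>k<m. \<xi> k (merge {..<m} {m..} (z, y) k)) = (\<Prod>k<m. \<xi> k (z k))"
      by (intro prod.cong) (auto simp: merge_def)
    then show "ennreal (norm (elemfun m \<xi> h (merge {..<m} {m..} (z, y))) powr p) =
        (\<Prod>k<m. ennreal (norm (\<xi> k (z k)) powr p)) * ennreal (norm (h y) powr p)"
      by (simp add: elemfun_def r norm_mult powr_mult prod_nonneg ennreal_mult prod_ennreal
          prod_powr_distrib flip: prod_norm)
  qed
  also have "\<dots> = (\<integral>\<^sup>+z. (\<Prod>k<m. ennreal (norm (\<xi> k (z k)) powr p)) * (\<integral>\<^sup>+y. ennreal (norm (h y) powr p) \<partial>Mt m) \<partial>PiM {..<m} N)"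
    by (intro nn_integral_cong nn_integral_cmult) measurable
  also have "\<dots> = (\<integral>\<^sup>+z. (\<Prod>k<m. ennreal (norm (\<xi> k (z k)) powr p)) \<partial>PiM {..<m} N) * (\<integral>\<^sup>+y. ennreal (norm (h y) powr p) \<partial>Mt m)"
    by (rule nn_integral_multc) (simp add: measurable_def sets_fin)
  also have "(\<integral>\<^sup>+z. (\<Prod>k<m. ennreal (norm (\<xi> k (z k)) powr p)) \<partial>PiM {..<m} N) = (\<Prod>k<m. \<integral>\<^sup>+x. ennreal (norm (\<xi> k x) powr p) \<partial>N k)"
    by (rule PS.product_nn_integral_prod[of "{..<m}" "\<lambda>k x. ennreal (norm (\<xi> k x) powr p)"]) (simp_all add: N_eq)
  also have "\<dots> * (\<integral>\<^sup>+y. ennreal (norm (h y) powr p) \<partial>Mt m) < \<infinity>"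
  proof -
    have "(\<Prod>k<m. \<integral>\<^sup>+x. ennreal (norm (\<xi> k x) powr p) \<partial>N k) < \<infinity>"
      by (rule prod_less_top_ennreal) (use \<xi> in \<open>simp add: Lp_fun_iff_nn[OF p]\<close>)
    moreover have "(\<integral>\<^sup>+y. ennreal (norm (h y) powr p) \<partial>Mt m) < \<infinity>"
      using h by (simp add: Lp_fun_iff_nn[OF p])
    ultimately show ?thesis by (simp add: ennreal_mult_less_top)
  qed
  finally show ?thesis using em by (simp add: Lp_fun_iff_nn[OF p])
qed

definition ktensor :: "nat \<Rightarrow> (nat \<Rightarrow> complex mat) \<Rightarrow> (nat \<Rightarrow> nat) \<Rightarrow> (nat \<Rightarrow> nat) \<Rightarrow> complex" where
  "ktensor m a j k = (\<Prod>i<m. a i $$ (j i, k i))"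

text \<open>The entries of the kernel, the quotient of weights and the function all factor over the
  coordinates below \<open>m\<close>, so the sum over \<open>Idx m\<close> is a product of sums over
  single indices.\<close>

lemma opf_elemfun:
  assumes a: "\<And>k. k < m \<Longrightarrow> a k \<in> carrier_mat (d k) (d k)" and x: "x \<in> space M"
  shows "opf m (ktensor m a) (elemfun m \<xi> h) x = elemfun m (\<lambda>k. rhof k (a k) (\<xi> k)) h x"
proof -
  let ?t = "\<lambda>i l. a i $$ (fst (x i), l) * of_real (ent (snd (x i)) (fst (x i)) / ent (snd (x i)) l) * \<xi> i (l, snd (x i))"
  have xi: "fst (x i) < d i" "snd (x i) \<in> V i" for i using x by (auto simp: space_M mem_Times_iff)
  have "opf m (ktensor m a) (elemfun m \<xi> h) x = (\<Sum>k\<in>Idx m. (\<Prod>i<m. ?t i (k i)) * h (restrict x {m..}))"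
    unfolding opf_def
  proof (intro sum.cong refl)
    fix k assume "k \<in> Idx m"
    have r: "restrict (put m k x) {m..} = restrict x {m..}" by (auto simp: put_def fun_eq_iff)
    have pr: "(\<Prod>i<m. ?t i (k i)) = (\<Prod>i<m. a i $$ (fst (x i), k i)) *
       ((\<Prod>i<m. of_real (ent (snd (x i)) (fst (x i)))) / (\<Prod>i<m. of_real (ent (snd (x i)) (k i)))) * (\<Prod>i<m. \<xi> i (k i, snd (x i)))"
      by (simp add: prod.distrib prod_dividef)
    have e: "elemfun m \<xi> h (put m k x) = (\<Prod>i<m. \<xi> i (k i, snd (x i))) * h (restrict x {m..})"
      unfolding elemfun_def r by (simp add: put_def)
    have kt: "ktensor m a (idx m x) k = (\<Prod>i<m. a i $$ (fst (x i), k i))"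
      by (simp add: ktensor_def idx_def)
    have wv: "complex_of_real (wv m (vpart m x) (idx m x) / wv m (vpart m x) k) =
        (\<Prod>i<m. of_real (ent (snd (x i)) (fst (x i)))) / (\<Prod>i<m. of_real (ent (snd (x i)) (k i)))"
      by (simp add: wv_def idx_def vpart_def)
    show "ktensor m a (idx m x) k * of_real (wv m (vpart m x) (idx m x) / wv m (vpart m x) k) * elemfun m \<xi> h (put m k x) =
        (\<Prod>i<m. ?t i (k i)) * h (restrict x {m..})"
      unfolding pr e kt wv by (simp only: mult.assoc)
  qed
  also have "\<dots> = (\<Prod>i<m. \<Sum>l<d i. ?t i l) * h (restrict x {m..})"
    unfolding Idx_def by (subst prod_sum_PiE) (auto simp: sum_distrib_right)
  also have "(\<Prod>i<m. \<Sum>l<d i. ?t i l) = (\<Prod>i<m. rhof i (a i) (\<xi> i) (x i))"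
  proof (intro prod.cong refl)
    fix i assume i: "i \<in> {..<m}"
    obtain j v where jv: "x i = (j, v)" by (cases "x i")
    then have "v \<in> V i" "j < d i" using xi[of i] by auto
    then have "(v * a i * diag_inv (d i) v) $$ (j, l) = a i $$ (j, l) * of_real (ent v j / ent v l)" if "l < d i" for l
      using conj_entry[of v i "a i" j l] a[of i] i that by auto
    then show "(\<Sum>l<d i. ?t i l) = rhof i (a i) (\<xi> i) (x i)"
      by (simp add: jv rhof_def)
  qed
  finally show ?thesis unfolding elemfun_def[of m "\<lambda>k. rhof k (a k) (\<xi> k)" h x] .
qed

abbreviation "rhos a k \<equiv> rho p (d k) (\<gamma> k) (w (d k) (\<gamma> k)) (a k)"

lemma Op_ktensor:
  assumes a: "\<And>k. k < m \<Longrightarrow> a k \<in> carrier_mat (d k) (d k)"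
  shows "is_tensor_op p N m (rhos a) (Op m (ktensor m a))"
  unfolding is_tensor_op_def
proof (intro conjI allI impI)
  fix \<Xi> H assume \<Xi>: "\<forall>k<m. \<Xi> k \<in> vcarrier (Lp p (N k))" and H: "H \<in> vcarrier (Lp p (Mt m))"
  have h: "rep H \<in> Lp_fun p (Mt m)" using carrier_rep[OF p H] by simp
  have \<xi>: "rep (\<Xi> k) \<in> Lp_fun p (N k)" if "k < m" for k using carrier_rep[OF p] \<Xi> that by blast
  have \<xi>': "rep (rhos a k (\<Xi> k)) \<in> Lp_fun p (N k)" if "k < m" for k
    using carrier_rep(1)[OF p rho_rep(1)] \<Xi> a that by blast
  have e: "elemfun m (\<lambda>k. rep (\<Xi> k)) (rep H) \<in> Lp_fun p M" by (rule elemfun_Lp[OF \<xi> h])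
  have e': "elemfun m (\<lambda>k. rep (rhos a k (\<Xi> k))) (rep H) \<in> Lp_fun p M" by (rule elemfun_Lp[OF \<xi>' h])
  show "Op m (ktensor m a) (elem_tensor p N m \<Xi> H) = elem_tensor p N m (\<lambda>k. rhos a k (\<Xi> k)) H"
    unfolding elem_tensor_eq Op_class[OF e]
  proof (rule Lp_class_eqI[OF opf_Lp[OF e] e'])
    fix x assume x: "x \<in> space M"
    then have "x k \<in> space (N k)" for k by (simp add: space_M space_N)
    then have "(\<Prod>k<m. rhof k (a k) (rep (\<Xi> k)) (x k)) = (\<Prod>k<m. rep (rhos a k (\<Xi> k)) (x k))"
      using rho_rep(2) \<Xi> a by (intro prod.cong) auto
    then show "opf m (ktensor m a) (elemfun m (\<lambda>k. rep (\<Xi> k)) (rep H)) x = elemfun m (\<lambda>k. rep (rhos a k (\<Xi> k))) (rep H) x"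
      by (intro trans[OF opf_elemfun[OF a x]]) (simp_all add: elemfun_def)
  qed
qed simp

text \<open>Where the first \<open>m\<close> coordinates equal \<open>z\<close>, only the tail
  varies, so the restriction of \<open>f\<close> is a product of indicators of the points
  \<open>z k\<close> and the section \<open>h\<close> of \<open>f\<close>. The section is
  p-integrable because the fibre has positive mass.\<close>

lemma atom_elem:
  assumes f: "f \<in> Lp_fun p M" and z: "z \<in> space (PiM {..<m} N)"
  shows "\<exists>\<Xi> H. (\<forall>k<m. \<Xi> k \<in> vcarrier (Lp p (N k))) \<and> H \<in> vcarrier (Lp p (Mt m)) \<and>
    Lp_class p M (\<lambda>x. if restrict x {..<m} = z then f x else 0) = elem_tensor p N m \<Xi> H"
proof -
  note fm = Lp_fun_measurable[OF p f]
  define j v where "j = (\<lambda>i\<in>{..<m}. fst (z i))" and "v = (\<lambda>i\<in>{..<m}. snd (z i))"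
  have zi: "z i \<in> {..<d i} \<times> V i" if "i < m" for i using z that by (auto simp: space_fin dest: PiE_mem)
  have jv: "j \<in> Idx m" "v \<in> Vs m"
    using zi by (auto simp: j_def v_def Idx_def Vs_def restrict_PiE_iff mem_Times_iff)
  have z_eq: "z = (\<lambda>i\<in>{..<m}. (j i, v i))"
    using z by (auto simp: j_def v_def space_fin fun_eq_iff PiE_iff extensional_def)
  define h where "h y = f (pt m v j y)" for y
  have hm: "h \<in> borel_measurable (Mt m)"
    unfolding h_def by (rule measurable_compose[OF pt_measurable[OF jv(2,1)] fm])
  have "ennreal (Wt m v) * (\<integral>\<^sup>+y. ennreal (norm (h y) powr p) \<partial>Mt m) \<le>
      ennreal (Wt m v) * (\<integral>\<^sup>+y. (\<Sum>j\<in>Idx m. ennreal (norm (f (pt m v j y)) powr p)) \<partial>Mt m)"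
    unfolding h_def using jv
    by (intro mult_left_mono nn_integral_mono member_le_sum[of j "Idx m" "\<lambda>j. ennreal (norm (f (pt m v j _)) powr p)"]) auto
  also have "\<dots> = (\<integral>\<^sup>+v'. (ennreal (Wt m v') * (\<integral>\<^sup>+y. (\<Sum>j\<in>Idx m. ennreal (norm (f (pt m v' j y)) powr p)) \<partial>Mt m)) * indicator {v} v' \<partial>count_space (Vs m))"
    using jv by (subst nn_integral_count_space'[where A = "{v}"]) auto
  also have "\<dots> \<le> (\<integral>\<^sup>+v'. ennreal (Wt m v') * (\<integral>\<^sup>+y. (\<Sum>j\<in>Idx m. ennreal (norm (f (pt m v' j y)) powr p)) \<partial>Mt m) \<partial>count_space (Vs m))"
    by (intro nn_integral_mono) (auto simp: indicator_def)
  also have "\<dots> = (\<integral>\<^sup>+x. ennreal (norm (f x) powr p) \<partial>M)"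
    using fm by (intro nn_integral_M[symmetric]) auto
  also have "\<dots> < \<infinity>" using f by (simp add: Lp_fun_iff_nn[OF p])
  finally have "(\<integral>\<^sup>+y. ennreal (norm (h y) powr p) \<partial>Mt m) < \<infinity>"
    using Wt_pos[OF jv(2)] by (auto simp: ennreal_mult_less_top)
  then have h: "h \<in> Lp_fun p (Mt m)" using hm by (simp add: Lp_fun_iff_nn[OF p])
  define \<xi> :: "nat \<Rightarrow> nat \<times> complex mat \<Rightarrow> complex" where "\<xi> k x = (if x = z k then 1 else 0)" for k x
  have \<xi>: "\<xi> k \<in> Lp_fun p (N k)" for k
  proof -
    interpret prob_space "N k" by simp
    have "(\<integral>\<^sup>+x. ennreal (norm (\<xi> k x) powr p) \<partial>N k) \<le> (\<integral>\<^sup>+x. 1 \<partial>N k)"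
      by (intro nn_integral_mono) (auto simp: \<xi>_def)
    also have "\<dots> < \<infinity>" by (simp add: emeasure_space_1)
    finally show ?thesis by (simp add: Lp_fun_iff_nn[OF p] N_measurable)
  qed
  let ?\<Xi> = "\<lambda>k. Lp_class p (N k) (\<xi> k)" and ?H = "Lp_class p (Mt m) h"
  have fz_m: "(\<lambda>x. if restrict x {..<m} = z then f x else 0) \<in> borel_measurable M"
  proof -
    have "(\<lambda>x. (if restrict x {..<m} = z then 1 else 0) * f x) \<in> borel_measurable M"
      by (intro borel_measurable_times fm restrict_measurable[of "\<lambda>y. if y = z then 1 else 0"])
    moreover have "(\<lambda>x. (if restrict x {..<m} = z then 1 else 0) * f x) = (\<lambda>x. if restrict x {..<m} = z then f x else 0)"
      by auto
    ultimately show ?thesis by simp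
  qed
  have fz: "(\<lambda>x. if restrict x {..<m} = z then f x else 0) \<in> Lp_fun p M"
    by (rule pnorm_mono(1)[OF p fz_m f]) auto
  have rH: "rep ?H \<in> Lp_fun p (Mt m)" "AE y in Mt m. rep ?H y = h y"
    using rep_Lp_class[OF p h] by auto
  have r\<xi>: "rep (?\<Xi> k) x = \<xi> k x" if "x \<in> space (N k)" for k x
    using rep_Lp_class(2)[OF p \<xi>] that unfolding AE_N by blast
  have e: "elemfun m (\<lambda>k. rep (?\<Xi> k)) (rep ?H) \<in> Lp_fun p M"
    using rep_Lp_class(1)[OF p \<xi>] rH(1) by (intro elemfun_Lp)
  interpret PM: prob_space "Mt m" by (rule prob_Mt)
  \<comment> \<open>Restriction to the coordinates from \<open>m\<close> on maps \<open>M\<close> to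
    \<open>Mt m\<close>, so null sets of the tail pull back to null sets.\<close>
  have ae: "AE x in M. rep ?H (restrict x {m..}) = h (restrict x {m..})"
  proof -
    have r: "(\<lambda>x. restrict x {m..}) \<in> measurable M (Mt m)" by (rule measurable_restrict_subset) simp
    have "distr M (Mt m) (\<lambda>x. restrict x {m..}) = Mt m"
      using distr_PiM_reindex[of UNIV N "\<lambda>i. i" "{m..}"] by (simp add: restrict_def)
    then show ?thesis using rH(2) AE_distrD[OF r, of "\<lambda>y. rep ?H y = h y"] by (simp only:)
  qed
  have "AE x in M. (if restrict x {..<m} = z then f x else 0) = elemfun m (\<lambda>k. rep (?\<Xi> k)) (rep ?H) x"
    using ae AE_space
  proof eventually_elim
    case (elim x)
    then have xs: "x k \<in> space (N k)" for k by (simp add: space_M space_N)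
    have rx: "rep (?\<Xi> k) (x k) = (if x k = z k then 1 else 0)" for k
      using r\<xi>[OF xs] unfolding \<xi>_def .
    have z_iff: "restrict x {..<m} = z \<longleftrightarrow> (\<forall>k<m. x k = z k)"
    proof
      assume *: "\<forall>k<m. x k = z k"
      show "restrict x {..<m} = z"
      proof
        fix i
        have "z i = undefined" if "\<not> i < m"
          using z that unfolding space_fin by (intro PiE_arb[of z "{..<m}"]) simp_all
        then show "restrict x {..<m} i = z i" using * by (simp add: restrict_def)
      qed
    next
      assume *: "restrict x {..<m} = z"
      show "\<forall>k<m. x k = z k"
      proof (intro allI impI)
        fix k assume "k < m"
        then show "x k = z k" using fun_cong[OF *, of k] by simp
      qed
    qed
    have "(\<Prod>k<m. rep (?\<Xi> k) (x k)) = (if restrict x {..<m} = z then 1 else 0)"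
    proof (cases "\<forall>k<m. x k = z k")
      case True
      then have "(\<Prod>k<m. rep (?\<Xi> k) (x k)) = (\<Prod>k<m. 1)"
        unfolding rx by (intro prod.cong refl) simp
      then show ?thesis using True z_iff by simp
    next
      case False
      then obtain k where "k < m" "x k \<noteq> z k" by blast
      then have "(\<Prod>k<m. rep (?\<Xi> k) (x k)) = 0"
        unfolding rx by (intro prod_zero) auto
      moreover have "restrict x {..<m} \<noteq> z" using False z_iff by blast
      ultimately show ?thesis by (simp only: if_not_P if_False)
    qed
    moreover have "h (restrict x {m..}) = f x" if "restrict x {..<m} = z"
    proof -
      have "x i = z i" if "i < m" for i using z_iff \<open>restrict x {..<m} = z\<close> that by blast
      then have "pt m v j (restrict x {m..}) i = x i" for i
        by (cases "i < m") (simp_all add: pt_def j_def v_def)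
      then have "pt m v j (restrict x {m..}) = x" ..
      then show ?thesis by (simp add: h_def)
    qed
    ultimately show ?case using elim(1) by (simp add: elemfun_def)
  qed
  then have "Lp_class p M (\<lambda>x. if restrict x {..<m} = z then f x else 0) = elem_tensor p N m ?\<Xi> ?H"
    unfolding elem_tensor_eq using fz e by (subst Lp_class_eq_iff[OF p])
  then show ?thesis using Lp_class_in[OF p \<xi>] Lp_class_in[OF p h] by (intro exI[of _ ?\<Xi>] exI[of _ ?H]) auto
qed

text \<open>The first \<open>m\<close> coordinates take countably many values. By dominated
  convergence \<open>f\<close> is the limit of the sums of its restrictions to finitely many of
  them, and each restriction is an elementary tensor, on which the two bounded operators
  agree.\<close>

lemma tensor_op_unique:
  assumes S: "is_tensor_op p N m A S" and T: "is_tensor_op p N m A T"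
  shows "S = T"
proof (rule LP.bounded_ops_eqI)
  show Sb: "S \<in> bounded_ops B" and Tb: "T \<in> bounded_ops B" using S T by (auto simp: is_tensor_op_def)
  fix F assume F: "F \<in> vcarrier B"
  obtain f where f: "f \<in> Lp_fun p M" "F = Lp_class p M f" using Lp_carrierE[OF p F] by blast
  let ?Z = "space (PiM {..<m} N)"
  define fB where "fB D x = (if restrict x {..<m} \<in> D then f x else 0)" for D x
  note fm = Lp_fun_measurable[OF p f(1)]
  have fB_m: "fB D \<in> borel_measurable M" for D
  proof -
    have "(\<lambda>x. (if restrict x {..<m} \<in> D then 1 else 0) * f x) \<in> borel_measurable M"
      by (intro borel_measurable_times fm restrict_measurable[of "\<lambda>y. if y \<in> D then 1 else 0"])
    moreover have "(\<lambda>x. (if restrict x {..<m} \<in> D then 1 else 0) * f x) = fB D"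
      by (auto simp: fB_def)
    ultimately show ?thesis by simp
  qed
  have fB: "fB D \<in> Lp_fun p M" for D
    by (rule pnorm_mono(1)[OF p fB_m f(1)]) (simp add: fB_def)
  have eq: "S (Lp_class p M (fB D)) = T (Lp_class p M (fB D))" if "finite D" "D \<subseteq> ?Z" for D
    using that
  proof (induction D)
    case empty
    have "fB {} = (\<lambda>x. 0)" by (auto simp: fB_def)
    then show ?case using LP.bounded_op_zero[OF Sb] LP.bounded_op_zero[OF Tb] by (simp add: Lp_zero[OF p])
  next
    case (insert z D)
    let ?g = "\<lambda>x. if restrict x {..<m} = z then f x else 0"
    have g: "?g = fB {z}" by (auto simp: fB_def)
    obtain \<Xi> H where "\<forall>k<m. \<Xi> k \<in> vcarrier (Lp p (N k))" "H \<in> vcarrier (Lp p (Mt m))"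
        "Lp_class p M ?g = elem_tensor p N m \<Xi> H"
      using atom_elem[OF f(1), of z m] insert by blast
    then have "S (Lp_class p M ?g) = T (Lp_class p M ?g)"
      using S T by (simp add: is_tensor_op_def)
    moreover have "Lp_class p M (fB (insert z D)) = vadd B (Lp_class p M ?g) (Lp_class p M (fB D))"
    proof -
      have "fB (insert z D) = (\<lambda>x. fB {z} x + fB D x)" using insert by (auto simp: fB_def)
      then show ?thesis unfolding g Lp_add[OF p fB fB] by (simp only:)
    qed
    ultimately show ?case
      using insert fB[of "{z}"] fB[of D] g
      by (simp add: LP.bounded_opsD(2)[OF Sb] LP.bounded_opsD(2)[OF Tb] Lp_class_in[OF p])
  qed
  obtain x0 where "x0 \<in> space M" using MP.not_empty by blast
  then have "restrict x0 {..<m} \<in> ?Z" by (auto simp: space_fin space_M restrict_PiE_iff)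
  then have "?Z \<noteq> {}" by blast
  \<comment> \<open>Finite sets that exhaust the countable space; since it is nonempty, all values
    of \<open>from_nat_into\<close> lie in it.\<close>
  define D where "D n = from_nat_into ?Z ` {..n}" for n
  have D: "finite (D n)" "D n \<subseteq> ?Z" for n
    using from_nat_into[OF \<open>?Z \<noteq> {}\<close>] by (auto simp: D_def)
  have lim: "(\<lambda>n. (\<integral>x. norm (f x - fB (D n) x) powr p \<partial>M)) \<longlonglongrightarrow> (\<integral>x. 0 \<partial>M)"
  proof (rule integral_dominated_convergence[where w = "\<lambda>x. norm (f x) powr p"])
    show "AE x in M. (\<lambda>n. norm (f x - fB (D n) x) powr p) \<longlonglongrightarrow> 0"
    proof (rule AE_I2)
      fix x assume "x \<in> space M"
      then have "restrict x {..<m} \<in> ?Z" by (auto simp: space_fin space_M restrict_PiE_iff)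
      then obtain n where n: "from_nat_into ?Z n = restrict x {..<m}"
        using from_nat_into_surj[OF countable_space_fin] by blast
      have "norm (f x - fB (D n') x) powr p = 0" if "n \<le> n'" for n'
        using n that by (force simp: fB_def D_def)
      then have "\<forall>\<^sub>F n' in sequentially. norm (f x - fB (D n') x) powr p = 0"
        by (auto simp: eventually_sequentially)
      then show "(\<lambda>n. norm (f x - fB (D n) x) powr p) \<longlonglongrightarrow> 0" by (rule tendsto_eventually)
    qed
  next
    fix n
    show "AE x in M. norm (norm (f x - fB (D n) x) powr p) \<le> norm (f x) powr p"
      by (rule AE_I2) (auto simp: fB_def)
    have "(\<lambda>x. f x - fB (D n) x) \<in> borel_measurable M" using fm fB_m by (rule borel_measurable_diff)
    then show "(\<lambda>x. norm (f x - fB (D n) x) powr p) \<in> borel_measurable M" by simp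
  next
    show "integrable M (\<lambda>x. norm (f x) powr p)" by (rule Lp_fun_integrable[OF p f(1)])
  qed simp
  let ?K = "op_norm B S + op_norm B T"
  have le: "LP.vdist (S F) (T F) \<le> ?K * pnorm p M (\<lambda>x. f x - fB (D n) x)" for n
  proof -
    let ?F = "Lp_class p M (fB (D n))"
    have mem: "F \<in> vcarrier B" "?F \<in> vcarrier B" using F Lp_class_in[OF p fB] by auto
    have dist: "LP.vdist F ?F = pnorm p M (\<lambda>x. f x - fB (D n) x)" using f fB by (simp add: Lp_vdist[OF p])
    have U: "LP.vdist (U F) (U ?F) \<le> op_norm B U * LP.vdist F ?F" if "U \<in> bounded_ops B" for U
      using LP.bounded_op_vdist[OF that mem] LP.norm_op_le[OF that, of "vadd B F (vscale B (-1) ?F)"] mem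
      by (simp add: LP.vdist_def)
    have "LP.vdist (S F) (T F) \<le> LP.vdist (S F) (S ?F) + LP.vdist (T ?F) (T F)"
      using LP.vdist_triangle[of "S F" "S ?F" "T F"] mem LP.bounded_opsD(1)[OF Sb] LP.bounded_opsD(1)[OF Tb] eq[OF D]
      by simp
    also have "LP.vdist (T ?F) (T F) = LP.vdist (T F) (T ?F)"
      using mem LP.bounded_opsD(1)[OF Tb] by (intro LP.vdist_commute)
    finally show ?thesis using U[OF Sb] U[OF Tb] unfolding dist by (simp add: algebra_simps)
  qed
  have "(\<lambda>n. ?K * pnorm p M (\<lambda>x. f x - fB (D n) x)) \<longlonglongrightarrow> ?K * (0 powr (1 / p))"
    unfolding pnorm_def using lim p by (intro tendsto_mult_left tendsto_powr') auto
  then have "LP.vdist (S F) (T F) \<le> 0" using le p by (intro LIMSEQ_le_const) auto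
  moreover have "S F \<in> vcarrier B" "T F \<in> vcarrier B" using LP.bounded_opsD(1)[OF Sb F] LP.bounded_opsD(1)[OF Tb F] by auto
  ultimately show "S F = T F" using LP.vdist_eq_zero[of "S F" "T F"] LP.vdist_nonneg[of "S F" "T F"] by linarith
qed

section \<open>The algebra generated by the elementary tensors\<close>

lemma B_space_eq: "B_space w p d \<gamma> = B"
  by (simp add: B_space_def)

definition Ops :: "(((nat \<Rightarrow> nat \<times> complex mat) \<Rightarrow> complex) set \<Rightarrow> ((nat \<Rightarrow> nat \<times> complex mat) \<Rightarrow> complex) set) set" where
  "Ops = range (\<lambda>s. Op (fst s) (snd s))"

lemma OpsI: "Op m a \<in> Ops"
  unfolding Ops_def by (rule range_eqI[of _ _ "(m, a)"]) simp

lemma OpsE: assumes "T \<in> Ops" obtains m a where "T = Op m a"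
  using assms unfolding Ops_def by auto

lemma Ops_bounded: "Ops \<subseteq> bounded_ops B"
  by (auto elim: OpsE)

text \<open>The generators are given only by their action on elementary tensors; uniqueness
  identifies them with operators that have a kernel.\<close>

lemma B_gens_subset: "B_gens w p d \<gamma> \<subseteq> Ops"
proof
  fix T assume "T \<in> B_gens w p d \<gamma>"
  then obtain m a where a: "\<And>k. k < m \<Longrightarrow> a k \<in> carrier_mat (d k) (d k)"
    and T: "is_tensor_op p N m (rhos a) T" by (auto simp: B_gens_def)
  have "T = Op m (ktensor m a)" by (rule tensor_op_unique[OF T Op_ktensor[OF a]])
  then show "T \<in> Ops" using OpsI by simp
qed

lemma Op_ktensor_in_gens:
  assumes "\<And>k. k < m \<Longrightarrow> a k \<in> carrier_mat (d k) (d k)"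
  shows "Op m (ktensor m a) \<in> B_gens w p d \<gamma>"
  using Op_ktensor[OF assms] assms unfolding B_gens_def by blast

definition kunit :: "(nat \<Rightarrow> nat) \<Rightarrow> (nat \<Rightarrow> nat) \<Rightarrow> (nat \<Rightarrow> nat) \<Rightarrow> (nat \<Rightarrow> nat) \<Rightarrow> complex" where
  "kunit J K j k = (if j = J \<and> k = K then 1 else 0)"

lemma Op_kunit_in_gens:
  assumes "J \<in> Idx m" "K \<in> Idx m"
  shows "Op m (kunit J K) \<in> B_gens w p d \<gamma>"
proof -
  define a where "a i = Matrix.mat (d i) (d i) (\<lambda>(r, s). if r = J i \<and> s = K i then 1 else 0 :: complex)" for i
  have "Op m (kunit J K) = Op m (ktensor m a)"
  proof (rule Op_cong)
    fix j k assume jk: "j \<in> Idx m" "k \<in> Idx m"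
    have lt: "j i < d i" "k i < d i" if "i < m" for i using jk that by (auto simp: Idx_def dest: PiE_mem)
    have "ktensor m a j k = (\<Prod>i<m. if j i = J i \<and> k i = K i then 1 else 0)"
      unfolding ktensor_def a_def using lt by (intro prod.cong) auto
    also have "\<dots> = kunit J K j k"
    proof (cases "j = J \<and> k = K")
      case False
      then obtain i where "i < m" "\<not> (j i = J i \<and> k i = K i)"
        using jk assms unfolding Idx_def by (metis PiE_ext lessThan_iff)
      then show ?thesis using False by (auto simp: kunit_def intro!: prod_zero)
    qed (simp add: kunit_def)
    finally show "kunit J K j k = ktensor m a j k" by simp
  qed
  then show ?thesis using Op_ktensor_in_gens[of m a] by (simp add: a_def)
qed

text \<open>A kernel is a finite combination of matrix units over \<open>Idx m\<close>, and each of
  these is a tensor product of ordinary matrix units, hence a generator.\<close>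

lemma Op_in_subalgebra:
  assumes D: "closed_subalgebra B D" "B_gens w p d \<gamma> \<subseteq> D"
  shows "Op m a \<in> D"
proof -
  have "Op m (\<lambda>j k. \<Sum>s\<in>S. a (fst s) (snd s) * kunit (fst s) (snd s) j k) \<in> D"
    if "finite S" "S \<subseteq> Idx m \<times> Idx m" for S
    using that
  proof (induction S)
    case empty
    then show ?case using D(1) by (simp add: Op_zero closed_subalgebra_def)
  next
    case (insert s S)
    have "op_scale B (a (fst s) (snd s)) (Op m (kunit (fst s) (snd s))) \<in> D"
      using D Op_kunit_in_gens[of "fst s" m "snd s"] insert by (auto simp: closed_subalgebra_def)
    then have "op_add B (Op m (\<lambda>j k. a (fst s) (snd s) * kunit (fst s) (snd s) j k))
        (Op m (\<lambda>j k. \<Sum>s\<in>S. a (fst s) (snd s) * kunit (fst s) (snd s) j k)) \<in> D"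
      using D(1) insert by (auto simp: closed_subalgebra_def Op_scale)
    then show ?case using insert by (simp add: Op_add)
  qed
  then have "Op m (\<lambda>j k. \<Sum>s\<in>Idx m \<times> Idx m. a (fst s) (snd s) * kunit (fst s) (snd s) j k) \<in> D" by simp
  also have "Op m (\<lambda>j k. \<Sum>s\<in>Idx m \<times> Idx m. a (fst s) (snd s) * kunit (fst s) (snd s) j k) = Op m a"
  proof (rule Op_cong)
    fix j k assume "j \<in> Idx m" "k \<in> Idx m"
    moreover have "(\<Sum>s\<in>Idx m \<times> Idx m. a (fst s) (snd s) * kunit (fst s) (snd s) j k) =
      (\<Sum>s\<in>Idx m \<times> Idx m. if s = (j, k) then a j k else 0)"
      by (intro sum.cong) (auto simp: kunit_def)
    ultimately show "(\<Sum>s\<in>Idx m \<times> Idx m. a (fst s) (snd s) * kunit (fst s) (snd s) j k) = a j k" by simp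
  qed
  finally show ?thesis .
qed

lemma Op_common:
  obtains m a' b' where "Op m1 a = Op m a'" "Op m2 b = Op m b'"
  using Op_lift[of m1 "max m1 m2" a] Op_lift[of m2 "max m1 m2" b] by (metis max.cobounded1 max.cobounded2)

lemma closed_subalgebra_Ops: "closed_subalgebra B (LP.op_closure Ops)"
proof (rule LP.closed_subalgebra_closure[OF Ops_bounded])
  show "op_zero B \<in> Ops" using OpsI[of 0 "\<lambda>j k. 0"] by (simp add: Op_zero)
  fix S T assume "S \<in> Ops" "T \<in> Ops"
  then obtain m a b where "S = Op m a" "T = Op m b" by (metis OpsE Op_common)
  then show "op_add B S T \<in> Ops" "op_mult B S T \<in> Ops" by (simp_all add: Op_add Op_mult OpsI)
next
  fix c T assume "T \<in> Ops"
  then show "op_scale B c T \<in> Ops" by (auto elim!: OpsE simp: Op_scale OpsI)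
qed

lemma B_alg_eq: "B_alg w p d \<gamma> = LP.op_closure Ops"
  unfolding B_alg_def B_space_eq
  by (rule LP.closed_subalgebra_hull_eq[OF closed_subalgebra_Ops Ops_bounded B_gens_subset])
     (auto elim!: OpsE intro: Op_in_subalgebra)

end

section \<open>Compression of matrix units\<close>

text \<open>Gaussian elimination, one point of \<open>Z\<close> at a time: a function with nonzero
  value at \<open>z\<close> is used to clear the others there, and is then removed together with
  \<open>z\<close>. Its coefficient is recovered from the multiples that were subtracted.\<close>

lemma linear_dependence_functions:
  fixes \<zeta> :: "'s \<Rightarrow> 'i \<Rightarrow> complex"
  assumes "finite Z" "finite S" "card Z < card S"
  shows "\<exists>c. (\<exists>r\<in>S. c r \<noteq> 0) \<and> (\<forall>z\<in>Z. (\<Sum>r\<in>S. c r * \<zeta> r z) = 0)"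
  using assms
proof (induction Z arbitrary: S \<zeta>)
  case empty
  then have "S \<noteq> {}" by auto
  then show ?case by (intro exI[of _ "\<lambda>_. 1"]) auto
next
  case (insert z Z)
  show ?case
  proof (cases "\<forall>r\<in>S. \<zeta> r z = 0")
    case True
    have "card Z < card S" using insert by simp
    then obtain c where "\<exists>r\<in>S. c r \<noteq> 0" "\<forall>z\<in>Z. (\<Sum>r\<in>S. c r * \<zeta> r z) = 0"
      using insert.IH[OF insert.prems(1), of \<zeta>] by blast
    then show ?thesis using True by (intro exI[of _ c]) auto
  next
    case False
    then obtain s where s: "s \<in> S" "\<zeta> s z \<noteq> 0" by auto
    define \<zeta>' where "\<zeta>' r y = \<zeta> r y - (\<zeta> r z / \<zeta> s z) * \<zeta> s y" for r y
    have "card Z < card (S - {s})" using insert s by simp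
    then obtain c where c: "\<exists>r\<in>S - {s}. c r \<noteq> 0" "\<And>y. y \<in> Z \<Longrightarrow> (\<Sum>r\<in>S - {s}. c r * \<zeta>' r y) = 0"
      using insert.IH[of "S - {s}" \<zeta>'] insert.prems by auto
    define c' where "c' r = (if r = s then - (\<Sum>r\<in>S - {s}. c r * \<zeta> r z / \<zeta> s z) else c r)" for r
    have split: "(\<Sum>r\<in>S. c' r * \<zeta> r y) = (\<Sum>r\<in>S - {s}. c r * \<zeta>' r y)" for y
    proof -
      have "(\<Sum>r\<in>S. c' r * \<zeta> r y) = c' s * \<zeta> s y + (\<Sum>r\<in>S - {s}. c r * \<zeta> r y)"
        using insert.prems s by (subst sum.remove[of S s]) (auto simp: c'_def intro!: sum.cong)
      also have "\<dots> = (\<Sum>r\<in>S - {s}. c r * \<zeta> r y) - (\<Sum>r\<in>S - {s}. c r * \<zeta> r z / \<zeta> s z * \<zeta> s y)"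
        by (simp add: c'_def sum_distrib_right)
      finally show ?thesis by (simp add: \<zeta>'_def right_diff_distrib sum_subtractf mult.assoc)
    qed
    have "\<zeta>' r z = 0" for r using s by (simp add: \<zeta>'_def)
    then have "(\<Sum>r\<in>S. c' r * \<zeta> r y) = 0" if "y \<in> insert z Z" for y
      using that c(2) unfolding split by auto
    moreover have "\<exists>r\<in>S. c' r \<noteq> 0" using c(1) by (auto simp: c'_def)
    ultimately show ?thesis by blast
  qed
qed

text \<open>Division by a coefficient of largest modulus. With all coefficients bounded by 1, a
  combination of errors is at most the sum of the errors.\<close>

lemma normalized_dependence:
  fixes \<zeta> :: "'s \<Rightarrow> 'i \<Rightarrow> complex"
  assumes "finite Z" "finite S" "card Z < card S"
  obtains c r1 where "r1 \<in> S" "c r1 = 1" "\<And>r. r \<in> S \<Longrightarrow> norm (c r) \<le> 1"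
    "\<And>z. z \<in> Z \<Longrightarrow> (\<Sum>r\<in>S. c r * \<zeta> r z) = 0"
proof -
  obtain c r where c: "r \<in> S" "c r \<noteq> 0" "\<And>z. z \<in> Z \<Longrightarrow> (\<Sum>r\<in>S. c r * \<zeta> r z) = 0"
    using linear_dependence_functions[OF assms, of \<zeta>] by auto
  have "Max ((\<lambda>r. norm (c r)) ` S) \<in> (\<lambda>r. norm (c r)) ` S"
    using assms(2) c(1) by (intro Max_in) auto
  then obtain r1 where "r1 \<in> S" "norm (c r1) = Max ((\<lambda>r. norm (c r)) ` S)" by auto
  then have r1: "r1 \<in> S" "\<And>r. r \<in> S \<Longrightarrow> norm (c r) \<le> norm (c r1)"
    using assms(2) by auto
  have "c r1 \<noteq> 0" using r1(2)[OF c(1)] c(2) by auto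
  moreover have "(\<Sum>r\<in>S. c r / c r1 * \<zeta> r z) = 0" if "z \<in> Z" for z
  proof -
    have "(\<Sum>r\<in>S. c r / c r1 * \<zeta> r z) = (\<Sum>r\<in>S. c r * \<zeta> r z) / c r1"
      by (simp add: sum_divide_distrib)
    then show ?thesis using c(3)[OF that] by simp
  qed
  ultimately show ?thesis
    using r1 by (intro that[of r1 "\<lambda>r. c r / c r1"]) (auto simp: norm_divide divide_le_eq_1)
qed

lemma kact_diff: "kact I \<omega> a (\<lambda>k. \<xi> k - \<eta> k) j = kact I \<omega> a \<xi> j - kact I \<omega> a \<eta> j"
  by (simp only: kact_def right_diff_distrib sum_subtractf)

lemma kact_diff_kernel: "kact I \<omega> (\<lambda>j k. a j k - b j k) \<xi> j = kact I \<omega> a \<xi> j - kact I \<omega> b \<xi> j"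
  by (simp only: kact_def left_diff_distrib sum_subtractf)

lemma kact_lincomb:
  "kact I \<omega> a (\<lambda>k. \<Sum>r\<in>S. c r * \<xi> r k) j = (\<Sum>r\<in>S. c r * kact I \<omega> a (\<xi> r) j)"
proof -
  have "kact I \<omega> a (\<lambda>k. \<Sum>r\<in>S. c r * \<xi> r k) j = (\<Sum>k\<in>I. \<Sum>r\<in>S. c r * (a j k * of_real (\<omega> j / \<omega> k) * \<xi> r k))"
    unfolding kact_def sum_distrib_left by (intro sum.cong refl) (simp only: mult_ac)
  also have "\<dots> = (\<Sum>r\<in>S. \<Sum>k\<in>I. c r * (a j k * of_real (\<omega> j / \<omega> k) * \<xi> r k))" by (rule sum.swap)
  finally show ?thesis by (simp only: kact_def sum_distrib_left)
qed

text \<open>The weights \<open>\<omega> / t\<close> make the rows indexed by \<open>Z\<close> small outside \<open>Z\<close>, so that compression to \<open>Z\<close> is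
  almost multiplicative; more than \<open>card Z\<close> vectors in the range of the compression are dependent.\<close>

lemma compressed_matrix_units:
  fixes b :: "'s \<Rightarrow> 's \<Rightarrow> 'i \<Rightarrow> 'i \<Rightarrow> complex" and t \<omega> :: "'i \<Rightarrow> real"
  assumes p: "1 \<le> p" and I: "finite I" "Z \<subseteq> I" and \<omega>: "\<And>k. k \<in> I \<Longrightarrow> 0 < \<omega> k"
    and t: "\<And>k. k \<in> Z \<Longrightarrow> t k = 1" "\<And>k. k \<in> I \<Longrightarrow> k \<notin> Z \<Longrightarrow> c \<le> t k" "0 < c"
    and S: "finite S" "card Z < card S" and K: "0 \<le> K" and \<delta>: "0 \<le> \<delta>"
    and row: "\<And>r s. r \<in> S \<Longrightarrow> s \<in> S \<Longrightarrow> kbound p I (\<lambda>j. \<omega> j / t j) (b r s) K"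
    and col: "\<And>r s. r \<in> S \<Longrightarrow> s \<in> S \<Longrightarrow> kbound p I \<omega> (b r s) K"
    and mult: "\<And>r s s' q. r \<in> S \<Longrightarrow> s \<in> S \<Longrightarrow> s' \<in> S \<Longrightarrow> q \<in> S \<Longrightarrow>
      kbound p I \<omega> (\<lambda>j k. (\<Sum>l\<in>I. b r s j l * b s' q l k) - (if s = s' then b r q j k else 0)) \<delta>"
    and \<xi>: "\<And>j. j \<notin> Z \<Longrightarrow> \<xi> j = 0"
  shows "pnorm p (count_space I) (\<lambda>j. if j \<in> Z then kact I \<omega> (\<lambda>j k. \<Sum>r\<in>S. b r r j k) \<xi> j else 0)
    \<le> (real (card S))\<^sup>2 * (K\<^sup>2 / c + \<delta>) * pnorm p (count_space I) \<xi>"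
proof -
  let ?n = "pnorm p (count_space I)"
  \<comment> \<open>Compression to the rows in \<open>Z\<close>. In an iterate
    \<open>A r s (A s' q \<eta>)\<close> the inner one also cuts the columns of the outer one down
    to \<open>Z\<close>.\<close>
  define A where "A r s \<eta> j = (if j \<in> Z then kact I \<omega> (b r s) \<eta> j else 0)" for r s \<eta> j
  define \<rho> where "\<rho> = K\<^sup>2 / c + \<delta>"
  have tpos: "0 < t k" if "k \<in> I" for k using that t by (cases "k \<in> Z") force+
  have \<rho>: "0 \<le> \<rho>" using K t \<delta> by (simp add: \<rho>_def)
  have almost_mult: "?n (\<lambda>j. A r s (A s' q \<eta>) j - (if s = s' then A r q \<eta> j else 0)) \<le> \<rho> * ?n \<eta>"
    if rs: "r \<in> S" "s \<in> S" "s' \<in> S" "q \<in> S" for r s s' q \<eta>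
  proof -
    define \<zeta> where "\<zeta> = kact I \<omega> (b s' q) \<eta>"
    \<comment> \<open>The compressed product fails for two reasons: the \<open>b r s\<close> are
      only approximate matrix units, which gives \<open>E1\<close>, and the inner compression drops
      the part \<open>off\<close> of the vector outside \<open>Z\<close>, which gives
      \<open>E2\<close>.\<close>
    define off where "off k = (if k \<in> Z then 0 else \<zeta> k)" for k
    define E1 where "E1 j = (if j \<in> Z then kact I \<omega> (\<lambda>j k. (\<Sum>l\<in>I. b r s j l * b s' q l k) - (if s = s' then b r q j k else 0)) \<eta> j else 0)" for j
    define E2 where "E2 j = (if j \<in> Z then kact I \<omega> (b r s) off j else 0)" for j
    have eq: "A r s (A s' q \<eta>) j - (if s = s' then A r q \<eta> j else 0) = E1 j + (-1) * E2 j" for j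
    proof (cases "j \<in> Z")
      case True
      have "A s' q \<eta> = (\<lambda>k. \<zeta> k - off k)" by (auto simp: A_def off_def \<zeta>_def)
      then have "A r s (A s' q \<eta>) j = kact I \<omega> (b r s) \<zeta> j - E2 j"
        using True by (simp add: A_def[of r s] kact_diff E2_def)
      moreover have "kact I \<omega> (b r s) \<zeta> j = kact I \<omega> (\<lambda>j k. \<Sum>l\<in>I. b r s j l * b s' q l k) \<eta> j"
        unfolding \<zeta>_def using \<omega> by (rule kact_mult)
      moreover have "E1 j = kact I \<omega> (\<lambda>j k. \<Sum>l\<in>I. b r s j l * b s' q l k) \<eta> j - (if s = s' then A r q \<eta> j else 0)"
        using True unfolding E1_def kact_diff_kernel by (auto simp: A_def kact_def)
      ultimately show ?thesis by simp
    qed (simp add: A_def E1_def E2_def)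
    have "?n E1 \<le> ?n (kact I \<omega> (\<lambda>j k. (\<Sum>l\<in>I. b r s j l * b s' q l k) - (if s = s' then b r q j k else 0)) \<eta>)"
      using p I by (intro pnorm_finite_mono) (auto simp: E1_def)
    also have "\<dots> \<le> \<delta> * ?n \<eta>" using mult[OF rs] by (rule kboundD)
    finally have n1: "?n E1 \<le> \<delta> * ?n \<eta>" .
    \<comment> \<open>In a row of \<open>Z\<close> one has \<open>t j = 1\<close>, so passing to the
      weights \<open>\<omega> / t\<close> is compensated by dividing the vector by \<open>t\<close>.
      As \<open>off\<close> vanishes on \<open>Z\<close>, this division gains a factor
      \<open>1 / c\<close>, while the hypothesis \<open>row\<close> still bounds the kernel by
      \<open>K\<close>.\<close>
    have "E2 j = (if j \<in> Z then kact I (\<lambda>j. \<omega> j / t j) (b r s) (\<lambda>k. off k / t k) j else 0)" for j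
    proof (cases "j \<in> Z")
      case True
      have "kact I \<omega> (b r s) off j = kact I (\<lambda>j. \<omega> j / t j) (b r s) (\<lambda>k. off k / t k) j"
        unfolding kact_def using tpos t(1)[OF True] by (intro sum.cong refl) force
      then show ?thesis using True by (simp add: E2_def)
    qed (simp add: E2_def)
    then have "?n E2 \<le> ?n (kact I (\<lambda>j. \<omega> j / t j) (b r s) (\<lambda>k. off k / t k))"
      using p I by (intro pnorm_finite_mono) auto
    also have "\<dots> \<le> K * ?n (\<lambda>k. off k / t k)" using row rs by (intro kboundD) auto
    also have "?n (\<lambda>k. off k / t k) \<le> ?n (\<lambda>k. of_real (1 / c) * \<zeta> k)"
    proof (rule pnorm_finite_mono[OF p I(1)])
      fix k assume k: "k \<in> I"
      show "norm (off k / t k) \<le> norm (of_real (1 / c) * \<zeta> k)"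
      proof (cases "k \<in> Z")
        case False
        then have "c \<le> t k" using t(2) k by simp
        then have "norm (\<zeta> k) / t k \<le> norm (\<zeta> k) / c" using t(3) by (intro divide_left_mono) auto
        then show ?thesis using False t(3) tpos[OF k] by (simp add: off_def norm_divide norm_mult)
      qed (simp add: off_def)
    qed
    also have "?n (\<lambda>k. of_real (1 / c) * \<zeta> k) = (1 / c) * ?n \<zeta>"
      unfolding pnorm_scale[OF p] using t(3) by (simp add: norm_divide)
    also have "?n \<zeta> \<le> K * ?n \<eta>" unfolding \<zeta>_def using col rs by (intro kboundD) auto
    finally have n2: "?n E2 \<le> K * ((1 / c) * (K * ?n \<eta>))"
      using K t(3) by (simp add: mult_left_mono divide_right_mono)
    have "?n (\<lambda>j. E1 j + (-1) * E2 j) \<le> ?n E1 + ?n (\<lambda>j. (-1) * E2 j)"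
      using p I by (intro pnorm_add Lp_fun_finite)
    also have "?n (\<lambda>j. (-1) * E2 j) = ?n E2" unfolding pnorm_scale[OF p] by simp
    also have "?n E1 + ?n E2 \<le> \<rho> * ?n \<eta>"
      using n1 n2 by (simp add: \<rho>_def algebra_simps power2_eq_square)
    finally show ?thesis by (simp only: eq)
  qed
  \<comment> \<open>The vectors \<open>A r r0 \<xi>\<close> for \<open>r\<close> in \<open>S\<close>
    live on \<open>Z\<close> and are more than \<open>card Z\<close> many, hence dependent. For
    exact matrix units \<open>A r0 r1\<close> would map a vanishing combination to
    \<open>A r0 r0 \<xi>\<close>, since the coefficient at \<open>r1\<close> is 1; so
    \<open>A r0 r0 \<xi>\<close> is no larger than the errors, at most \<open>card S\<close> times a
    single one.\<close>
  have diag: "?n (A r0 r0 \<xi>) \<le> real (card S) * \<rho> * ?n \<xi>" if r0: "r0 \<in> S" for r0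
  proof -
    have Z: "finite Z" using I finite_subset by blast
    obtain c r1 where c: "r1 \<in> S" "c r1 = 1" "\<And>r. r \<in> S \<Longrightarrow> norm (c r) \<le> 1"
      "\<And>z. z \<in> Z \<Longrightarrow> (\<Sum>r\<in>S. c r * A r r0 \<xi> z) = 0"
      using normalized_dependence[OF Z S, of "\<lambda>r. A r r0 \<xi>"] by metis
    define D where "D r j = A r0 r1 (A r r0 \<xi>) j - (if r1 = r then A r0 r0 \<xi> j else 0)" for r j
    have "A r0 r0 \<xi> j = (\<Sum>r\<in>S. (- c r) * D r j)" for j
    proof (cases "j \<in> Z")
      case True
      have z: "(\<lambda>k. \<Sum>r\<in>S. c r * A r r0 \<xi> k) = (\<lambda>k. 0)"
      proof
        fix k show "(\<Sum>r\<in>S. c r * A r r0 \<xi> k) = 0"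
          using c(4) by (cases "k \<in> Z") (auto simp: A_def)
      qed
      have "(\<Sum>r\<in>S. c r * A r0 r1 (A r r0 \<xi>) j) = kact I \<omega> (b r0 r1) (\<lambda>k. \<Sum>r\<in>S. c r * A r r0 \<xi> k) j"
        using True by (simp add: A_def[of r0 r1] kact_lincomb)
      then have s0: "(\<Sum>r\<in>S. c r * A r0 r1 (A r r0 \<xi>) j) = 0" unfolding z by (simp add: kact_def)
      have "(\<Sum>r\<in>S. (- c r) * D r j) = (\<Sum>r\<in>S. (if r1 = r then c r * A r0 r0 \<xi> j else 0)) - (\<Sum>r\<in>S. c r * A r0 r1 (A r r0 \<xi>) j)"
        unfolding sum_subtractf[symmetric] by (intro sum.cong refl) (auto simp: D_def algebra_simps)
      then show ?thesis using c(1,2) S s0 by simp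
    next
      case False
      then have "A r s \<eta> j = 0" for r s \<eta> by (simp add: A_def)
      then show ?thesis by (simp add: D_def cong: if_cong)
    qed
    then have "?n (A r0 r0 \<xi>) = ?n (\<lambda>j. \<Sum>r\<in>S. (- c r) * D r j)" by (intro pnorm_finite_cong)
    also have "\<dots> \<le> (\<Sum>r\<in>S. ?n (\<lambda>j. (- c r) * D r j))"
      using p S I by (intro pnorm_sum Lp_fun_finite)
    also have "\<dots> \<le> (\<Sum>r\<in>S. \<rho> * ?n \<xi>)"
    proof (rule sum_mono)
      fix r assume r: "r \<in> S"
      have "?n (\<lambda>j. (- c r) * D r j) = norm (c r) * ?n (D r)" unfolding pnorm_scale[OF p] by simp
      also have "\<dots> \<le> 1 * ?n (D r)" using c(3)[OF r] pnorm_nonneg[OF p] by (intro mult_right_mono)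
      also have "?n (D r) \<le> \<rho> * ?n \<xi>"
        using almost_mult[OF r0 c(1) r r0, of \<xi>] by (simp add: D_def[abs_def])
      finally show "?n (\<lambda>j. (- c r) * D r j) \<le> \<rho> * ?n \<xi>" by simp
    qed
    finally show ?thesis by (simp add: mult.assoc)
  qed
  have "?n (\<lambda>j. if j \<in> Z then kact I \<omega> (\<lambda>j k. \<Sum>r\<in>S. b r r j k) \<xi> j else 0) = ?n (\<lambda>j. \<Sum>r\<in>S. A r r \<xi> j)"
    using S by (intro pnorm_finite_cong) (auto simp: A_def kact_sum)
  also have "\<dots> \<le> (\<Sum>r\<in>S. ?n (A r r \<xi>))" using p S I by (intro pnorm_sum Lp_fun_finite)
  also have "\<dots> \<le> (\<Sum>r\<in>S. real (card S) * \<rho> * ?n \<xi>)" by (intro sum_mono diag)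
  finally show ?thesis by (simp add: \<rho>_def power2_eq_square mult.assoc)
qed

text \<open>Conjugation by the diagonal matrix \<open>r\<close>: multiplication by \<open>r\<close>
  costs at most \<open>R\<close>, and division by it costs nothing because \<open>r\<close> is at
  least 1.\<close>

lemma kbound_rescale:
  assumes p: "1 \<le> p" and I: "finite I" and r: "\<And>k. k \<in> I \<Longrightarrow> 1 \<le> r k \<and> r k \<le> R" and R: "0 \<le> R" and C: "0 \<le> C"
    and a: "kbound p I \<omega> a C"
  shows "kbound p I (\<lambda>k. r k * \<omega> k) a (R * C)"
  unfolding kbound_def
proof
  fix \<xi>
  let ?n = "pnorm p (count_space I)"
  have eq: "kact I (\<lambda>k. r k * \<omega> k) a \<xi> j = of_real (r j) * kact I \<omega> a (\<lambda>k. \<xi> k / of_real (r k)) j" for j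
    unfolding kact_def sum_distrib_left by (intro sum.cong refl) (simp add: mult_ac)
  have "?n (kact I (\<lambda>k. r k * \<omega> k) a \<xi>) \<le> ?n (\<lambda>j. of_real R * kact I \<omega> a (\<lambda>k. \<xi> k / of_real (r k)) j)"
    unfolding eq using r R
    by (intro pnorm_finite_mono[OF p I]) (force simp: norm_mult intro!: mult_right_mono)
  also have "\<dots> = R * ?n (kact I \<omega> a (\<lambda>k. \<xi> k / of_real (r k)))"
    unfolding pnorm_scale[OF p] using R by simp
  also have "\<dots> \<le> R * (C * ?n (\<lambda>k. \<xi> k / of_real (r k)))"
    using R kboundD[OF a] by (intro mult_left_mono)
  also have "?n (\<lambda>k. \<xi> k / of_real (r k)) \<le> ?n \<xi>"
  proof (rule pnorm_finite_mono[OF p I])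
    fix k assume "k \<in> I"
    then have "1 \<le> r k" using r by simp
    then have "norm (\<xi> k) / r k \<le> norm (\<xi> k) / 1" by (intro divide_left_mono) auto
    then show "norm (\<xi> k / of_real (r k)) \<le> norm (\<xi> k)" using \<open>1 \<le> r k\<close> by (simp add: norm_divide)
  qed
  finally show "?n (kact I (\<lambda>k. r k * \<omega> k) a \<xi>) \<le> R * C * ?n \<xi>"
    using R C by (simp add: mult_left_mono mult.assoc)
qed

lemma kbound_scale_weight:
  assumes "x \<noteq> 0" shows "kbound p I (\<lambda>k. \<omega> k * x) a C \<longleftrightarrow> kbound p I \<omega> a C"
  using assms unfolding kbound_def kact_def by simp

lemma kbound_weight_cong:
  assumes "\<And>k. k \<in> I \<Longrightarrow> \<omega> k = \<omega>' k"
  shows "kbound p I \<omega> a C \<longleftrightarrow> kbound p I \<omega>' a C"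
proof -
  have "pnorm p (count_space I) (kact I \<omega> a \<xi>) = pnorm p (count_space I) (kact I \<omega>' a \<xi>)" for \<xi>
    using assms by (intro pnorm_finite_cong) (simp add: kact_def)
  then show ?thesis by (simp add: kbound_def)
qed

section \<open>Comparison of two algebras\<close>

lemma op_scale_apply: "v \<in> vcarrier E \<Longrightarrow> op_scale E c T v = vscale E c (T v)"
  by (simp add: op_scale_def)

text \<open>Continuity at 0 gives a ball of radius \<delta> with image in the unit ball; homogeneity
  extends this to a bound everywhere.\<close>

lemma continuous_hom_bounded:
  assumes "cnormed E" "cnormed E'" and \<phi>: "continuous_hom E A E' A' \<phi>"
    and A: "A \<subseteq> bounded_ops E" "op_zero E \<in> A" "\<And>c T. T \<in> A \<Longrightarrow> op_scale E c T \<in> A"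
    and A': "A' \<subseteq> bounded_ops E'"
  shows "\<exists>C\<ge>1. \<forall>T\<in>A. op_norm E' (\<phi> T) \<le> C * op_norm E T"
proof -
  interpret E: cnormed E by fact
  interpret E': cnormed E' by fact
  interpret M1: Metric_space A "op_dist E" using A(1) by (rule E.Metric_space_ops)
  interpret M2: Metric_space A' "op_dist E'" using A' by (rule E'.Metric_space_ops)
  have \<phi>_in: "\<phi> T \<in> A'" if "T \<in> A" for T using \<phi> that by (auto simp: continuous_hom_def)
  have \<phi>_b: "\<phi> T \<in> bounded_ops E'" if "T \<in> A" for T using \<phi>_in[OF that] A' by auto
  have \<phi>_scale: "\<phi> (op_scale E c T) = op_scale E' c (\<phi> T)" if "T \<in> A" for c T
    using \<phi> that by (auto simp: continuous_hom_def)
  have scale0: "op_scale E 0 (op_zero E) = op_zero E" "op_scale E' 0 S = op_zero E'" if "S \<in> bounded_ops E'" for S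
  proof -
    show "op_scale E 0 (op_zero E) = op_zero E"
      by (rule E.bounded_ops_eqI) (auto simp: op_scale_apply E.op_zero_apply E.scale_zero_left)
    show "op_scale E' 0 S = op_zero E'"
      using that by (intro E'.bounded_ops_eqI)
        (auto simp: op_scale_apply E'.op_zero_apply E'.scale_zero_left E'.bounded_opsD(1))
  qed
  have \<phi>_zero: "\<phi> (op_zero E) = op_zero E'"
    using \<phi>_scale[OF A(2), of 0] scale0[OF \<phi>_b[OF A(2)]] by simp
  have "continuous_map M1.mtopology M2.mtopology \<phi>"
    using \<phi> by (simp add: continuous_hom_def norm_topology_def)
  then have "\<forall>a\<in>A. \<forall>\<epsilon>>0. \<exists>\<delta>>0. \<forall>x. x \<in> A \<and> op_dist E a x < \<delta> \<longrightarrow> op_dist E' (\<phi> a) (\<phi> x) < \<epsilon>"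
    unfolding M1.metric_continuous_map[OF M2.Metric_space_axioms] by blast
  from bspec[OF this A(2), THEN spec, of 1]
  have "\<exists>\<delta>>0. \<forall>x. x \<in> A \<and> op_dist E (op_zero E) x < \<delta> \<longrightarrow> op_dist E' (\<phi> (op_zero E)) (\<phi> x) < 1"
    by simp
  then obtain \<delta> where \<delta>: "\<delta> > 0" "\<And>T. T \<in> A \<Longrightarrow> op_norm E T < \<delta> \<Longrightarrow> op_norm E' (\<phi> T) < 1"
    unfolding \<phi>_zero
    using A(1) \<phi>_b by (metis E.op_dist_commute E.op_dist_zero E'.op_dist_commute E'.op_dist_zero subsetD)
  have "op_norm E' (\<phi> T) \<le> (1 + 2 / \<delta>) * op_norm E T" if T: "T \<in> A" for T
  proof (cases "op_norm E T = 0")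
    case True
    then have "T = op_zero E" using E.op_dist_eq_zero[of T "op_zero E"] T A(1) by (auto simp: E.op_dist_zero)
    then show ?thesis by (simp add: \<phi>_zero E.op_norm_op_zero E'.op_norm_op_zero)
  next
    case False
    have Tb: "T \<in> bounded_ops E" using T A(1) by auto
    have pos: "op_norm E T > 0" using False E.op_norm_nonneg[OF Tb] by linarith
    \<comment> \<open>Scales \<open>T\<close> to norm at most \<open>\<delta> / 2\<close>, strictly
      inside the ball.\<close>
    define c where "c = \<delta> / (2 * op_norm E T)"
    have c: "c > 0" using pos \<delta> by (simp add: c_def)
    have "op_norm E (op_scale E (of_real c) T) \<le> norm (complex_of_real c) * op_norm E T"
      by (rule E.op_norm_scale_le[OF Tb])
    also have "\<dots> = \<delta> / 2" unfolding norm_of_real abs_of_pos[OF c] using pos by (simp add: c_def)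
    also have "\<dots> < \<delta>" using \<delta> by simp
    finally have "op_norm E' (op_scale E' (of_real c) (\<phi> T)) < 1"
      using \<delta>(2)[OF A(3)[OF T]] by (simp add: \<phi>_scale[OF T])
    moreover have "\<phi> T = op_scale E' (of_real (1 / c)) (op_scale E' (of_real c) (\<phi> T))"
      using \<phi>_b[OF T] c by (intro E'.bounded_ops_eqI)
        (auto simp: op_scale_apply E'.scale_scale E'.scale_one E'.bounded_opsD(1))
    then have "op_norm E' (\<phi> T) \<le> norm (complex_of_real (1 / c)) * op_norm E' (op_scale E' (of_real c) (\<phi> T))"
      using E'.op_norm_scale_le[OF E'.op_scale_in[OF \<phi>_b[OF T]], of "of_real (1 / c)" "of_real c"] by simp
    moreover have "norm (complex_of_real (1 / c)) = 1 / c" unfolding norm_of_real using c by simp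
    ultimately have "op_norm E' (\<phi> T) \<le> (1 / c) * 1"
      using c mult_left_mono[of "op_norm E' (op_scale E' (of_real c) (\<phi> T))" 1 "1 / c"] by (simp only:) simp
    also have "\<dots> = (2 / \<delta>) * op_norm E T" by (simp add: c_def)
    also have "\<dots> \<le> (1 + 2 / \<delta>) * op_norm E T" using pos by (intro mult_right_mono) auto
    finally show ?thesis .
  qed
  then show ?thesis using \<delta>(1) by (intro exI[of _ "1 + 2 / \<delta>"]) auto
qed

text \<open>Index sets depend on \<open>d\<close> alone, and lifting and multiplying kernels do not
  involve \<gamma>. So the same kernel names an element of both algebras; only the spaces and the
  admissible weights differ.\<close>

locale two_towers = K: tower p d \<gamma>1 w + L: tower p d \<gamma>2 w
  for p d \<gamma>1 \<gamma>2 w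
begin

text \<open>From \<open>n0\<close> on, the diagonal matrices of the first tower are admissible in
  the second. In the earlier factors they are replaced by the identity, which changes the weights by
  a factor between 1 and \<open>G n0\<close>; the resulting constant does not depend on
  \<open>m\<close>.\<close>

lemma op_norm_comparison:
  assumes le: "\<And>n. n0 \<le> n \<Longrightarrow> \<gamma>1 n \<le> \<gamma>2 n"
  shows "op_norm K.B (K.Op m a) \<le> K.G n0 * op_norm L.B (L.Op m a)"
proof (rule K.Op_norm_le)
  have nn: "0 \<le> op_norm L.B (L.Op m a)" by (rule L.LP.op_norm_nonneg) simp
  have G1: "1 \<le> K.G n0" by (rule K.G_ge_1)
  show "0 \<le> K.G n0 * op_norm L.B (L.Op m a)" using nn G1 by simp
  fix v assume v: "v \<in> K.Vs m"
  define v' where "v' = (\<lambda>i\<in>{..<m}. if i < n0 then mat_diag (d i) (\<lambda>j. of_real 1) else v i)"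
  have vi: "v i \<in> K.V i" if "i < m" for i using v that by (auto simp: K.Vs_def dest: PiE_mem)
  have "mat_diag (d i) (\<lambda>j. of_real 1) \<in> L.V i" for i
    unfolding L.V_def using L.\<gamma>[of i] by (intro mat_diag_in_diag_index) auto
  moreover have "v i \<in> L.V i" if "i < m" "\<not> i < n0" for i
    using vi[OF that(1)] le[of i] that unfolding K.V_def L.V_def diag_index_def by fastforce
  ultimately have v': "v' \<in> L.Vs m"
    unfolding v'_def L.Vs_def restrict_PiE_iff by auto
  define r where "r J = (\<Prod>i\<in>{..<m} \<inter> {..<n0}. ent (v i) (J i))" for J :: "nat \<Rightarrow> nat"
  have ent1: "1 \<le> ent (v i) (J i) \<and> ent (v i) (J i) \<le> \<gamma>1 i" if "J \<in> K.Idx m" "i < m" for J i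
    using K.V_ent[OF vi[OF that(2)], of "J i"] that by (auto simp: K.Idx_def dest: PiE_mem)
  have r: "1 \<le> r J \<and> r J \<le> K.G n0" if J: "J \<in> K.Idx m" for J
  proof
    show "1 \<le> r J" unfolding r_def using ent1[OF J] by (intro prod_ge_1) auto
    have "r J \<le> (\<Prod>i\<in>{..<m} \<inter> {..<n0}. \<gamma>1 i)"
      unfolding r_def using ent1[OF J] by (intro prod_mono) (force intro: order_trans[OF zero_le_one])
    also have "\<dots> \<le> (\<Prod>i\<in>{..<n0}. \<gamma>1 i)"
      using K.\<gamma> by (intro prod_mono2) (auto intro: order_trans[OF zero_le_one])
    finally show "r J \<le> K.G n0" by (simp add: K.G_def)
  qed
  have w_eq: "K.wv m v J = r J * L.wv m v' J" if J: "J \<in> K.Idx m" for J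
  proof -
    have Ji: "J i < d i" if "i < m" for i using J that by (auto simp: K.Idx_def dest: PiE_mem)
    have "r J * L.wv m v' J = (\<Prod>i<m. if i < n0 then ent (v i) (J i) else 1) * (\<Prod>i<m. ent (v' i) (J i))"
      unfolding r_def L.wv_def by (subst prod.inter_restrict) auto
    also have "\<dots> = (\<Prod>i<m. ent (v i) (J i))"
      unfolding prod.distrib[symmetric] v'_def using Ji
      by (intro prod.cong) (auto simp: ent_mat_diag[of _ _ "\<lambda>_. 1", simplified])
    finally show ?thesis by (simp add: K.wv_def)
  qed
  have "kbound p (K.Idx m) (L.wv m v') a (op_norm L.B (L.Op m a))"
    using L.fib_op_norm[OF v', of a] by (simp add: L.fib_def)
  then have "kbound p (K.Idx m) (\<lambda>J. r J * L.wv m v' J) a (K.G n0 * op_norm L.B (L.Op m a))"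
    using K.p r G1 nn by (intro kbound_rescale) auto
  moreover have "kbound p (K.Idx m) (K.wv m v) a C \<longleftrightarrow> kbound p (K.Idx m) (\<lambda>J. r J * L.wv m v' J) a C" for C
    by (rule kbound_weight_cong) (rule w_eq)
  ultimately show "K.fib m v a (K.G n0 * op_norm L.B (L.Op m a))"
    unfolding K.fib_def by simp
qed

lemma dense_hom_exists:
  assumes le: "\<And>n. n0 \<le> n \<Longrightarrow> \<gamma>1 n \<le> \<gamma>2 n"
  shows "\<exists>\<phi>. continuous_hom (B_space w p d \<gamma>2) (B_alg w p d \<gamma>2) (B_space w p d \<gamma>1) (B_alg w p d \<gamma>1) \<phi> \<and>
     unital_hom (B_space w p d \<gamma>2) (B_space w p d \<gamma>1) \<phi> \<and>
     dense_range (B_alg w p d \<gamma>2) (B_space w p d \<gamma>1) (B_alg w p d \<gamma>1) \<phi>"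
proof -
  let ?O2 = "\<lambda>s. L.Op (fst s) (snd s)" and ?O1 = "\<lambda>s. K.Op (fst s) (snd s)"
  \<comment> \<open>Both elements are lifted to the larger level. The lifted kernels are the same in
    the two towers, so the correspondence of operators respects sums and products.\<close>
  have common: "\<exists>m a b. ?O2 s = L.Op m a \<and> ?O1 s = K.Op m a \<and> ?O2 t = L.Op m b \<and> ?O1 t = K.Op m b" for s t
  proof -
    let ?m = "max (fst s) (fst t)"
    show ?thesis
      by (intro exI[of _ ?m] exI[of _ "K.klift (fst s) ?m (snd s)"] exI[of _ "K.klift (fst t) ?m (snd t)"])
        (simp add: K.Op_lift L.Op_lift)
  qed
  have "\<exists>\<phi>. continuous_hom L.B (L.LP.op_closure (range ?O2)) K.B (K.LP.op_closure (range ?O1)) \<phi> \<and>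
     (\<forall>s. \<phi> (?O2 s) = ?O1 s) \<and>
     dense_range (L.LP.op_closure (range ?O2)) K.B (K.LP.op_closure (range ?O1)) \<phi>"
  proof (rule hom_extension[where M = "K.G n0"])
    show "cnormed L.B" by (rule L.LP.cnormed_axioms)
    show "cbanach K.B" by (rule K.LP.cbanach_axioms)
    show "0 \<le> K.G n0" using K.G_ge_1[of n0] by simp
    fix s t
    show "op_norm K.B (?O1 s) \<le> K.G n0 * op_norm L.B (?O2 s)" by (rule op_norm_comparison[OF le])
    obtain m a b where ab: "?O2 s = L.Op m a" "?O1 s = K.Op m a" "?O2 t = L.Op m b" "?O1 t = K.Op m b"
      using common by blast
    show "\<exists>k. ?O2 k = op_add L.B (?O2 s) (?O2 t) \<and> ?O1 k = op_add K.B (?O1 s) (?O1 t)"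
      unfolding ab K.Op_add L.Op_add by (rule exI[of _ "(m, \<lambda>j k. a j k + b j k)"]) simp
    show "\<exists>k. ?O2 k = op_mult L.B (?O2 s) (?O2 t) \<and> ?O1 k = op_mult K.B (?O1 s) (?O1 t)"
      unfolding ab K.Op_mult L.Op_mult by (rule exI[of _ "(m, K.kmul m a b)"]) simp
    show "\<exists>k. ?O2 k = op_scale L.B c (?O2 s) \<and> ?O1 k = op_scale K.B c (?O1 s)" for c
      unfolding ab K.Op_scale L.Op_scale by (rule exI[of _ "(m, \<lambda>j k. c * a j k)"]) simp
  qed simp_all
  then obtain \<phi> where \<phi>: "continuous_hom L.B (L.LP.op_closure L.Ops) K.B (K.LP.op_closure K.Ops) \<phi>"
    "\<And>m a. \<phi> (L.Op m a) = K.Op m a" "dense_range (L.LP.op_closure L.Ops) K.B (K.LP.op_closure K.Ops) \<phi>"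
    unfolding K.Ops_def L.Ops_def by auto
  have "unital_hom L.B K.B \<phi>"
    using \<phi>(2)[of 0 "\<lambda>j k. if j = k then 1 else 0"] by (simp add: unital_hom_def K.Op_one L.Op_one)
  then show ?thesis
    using \<phi> by (auto simp: K.B_space_eq L.B_space_eq K.B_alg_eq L.B_alg_eq)
qed

text \<open>The errors are balanced as follows. The approximant of \<phi>(1) has norm at least 3/4,
  so on some fibre it stretches a vector by more than 1/2. On the block it differs from the sum of
  the approximate diagonal units by at most 1/4 + 1/16, and the compressed sum contributes at most
  1/16 + 1/16. The total 7/16 is less than 1/2.\<close>

lemma no_hom:
  assumes mono: "mono \<gamma>2"
    and growth: "\<forall>\<^sub>F n in sequentially. real (Suc n) * (real (\<Prod>i<Suc n. d i))\<^sup>2 * (\<Prod>i<Suc n. \<gamma>1 i)\<^sup>2 \<le> \<gamma>2 n"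
    and \<phi>: "continuous_hom (B_space w p d \<gamma>1) (B_alg w p d \<gamma>1) (B_space w p d \<gamma>2) (B_alg w p d \<gamma>2) \<phi>"
    and nz: "nonzero_hom (B_alg w p d \<gamma>1) (B_space w p d \<gamma>2) \<phi>"
  shows False
proof -
  note p = K.p
  let ?A = "K.LP.op_closure K.Ops" and ?A' = "L.LP.op_closure L.Ops"
  have \<phi>': "continuous_hom K.B ?A L.B ?A' \<phi>" and nz': "nonzero_hom ?A L.B \<phi>"
    using \<phi> nz by (auto simp: K.B_space_eq L.B_space_eq K.B_alg_eq L.B_alg_eq)
  have alg: "closed_subalgebra K.B ?A"
    by (rule K.closed_subalgebra_Ops)
  have Ab: "?A \<subseteq> bounded_ops K.B" "?A' \<subseteq> bounded_ops L.B"
    by (simp_all add: K.LP.op_closure_bounded L.LP.op_closure_bounded)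
  have OpA: "K.Op m a \<in> ?A" for m a
    using K.LP.op_closure_subset[OF K.Ops_bounded] K.OpsI by blast
  have \<phi>_in: "\<phi> T \<in> ?A'" if "T \<in> ?A" for T using \<phi>' that by (auto simp: continuous_hom_def)
  have \<phi>_b: "\<phi> T \<in> bounded_ops L.B" if "T \<in> ?A" for T using \<phi>_in[OF that] Ab by auto
  have \<phi>_add: "\<phi> (op_add K.B S T) = op_add L.B (\<phi> S) (\<phi> T)"
    and \<phi>_mult: "\<phi> (op_mult K.B S T) = op_mult L.B (\<phi> S) (\<phi> T)" if "S \<in> ?A" "T \<in> ?A" for S T
    using \<phi>' that by (auto simp: continuous_hom_def)
  have zero_A: "op_zero K.B \<in> ?A" and scale_A: "\<And>c T. T \<in> ?A \<Longrightarrow> op_scale K.B c T \<in> ?A"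
    using alg by (auto simp: closed_subalgebra_def)
  obtain C where C: "C \<ge> 1" "\<And>T. T \<in> ?A \<Longrightarrow> op_norm L.B (\<phi> T) \<le> C * op_norm K.B T"
    using continuous_hom_bounded[OF K.LP.cnormed_axioms L.LP.cnormed_axioms \<phi>' Ab(1) zero_A scale_A Ab(2)]
    by blast
  have \<phi>_zero: "\<phi> (op_zero K.B) = op_zero L.B"
  proof -
    note z = zero_A
    have "op_norm L.B (\<phi> (op_zero K.B)) \<le> 0" using C(2)[OF z] by (simp add: K.LP.op_norm_op_zero)
    then have "op_dist L.B (\<phi> (op_zero K.B)) (op_zero L.B) = 0"
      using L.LP.op_norm_nonneg[OF \<phi>_b[OF z]] by (simp add: L.LP.op_dist_zero \<phi>_b[OF z])
    then show ?thesis by (intro L.LP.op_dist_eq_zero \<phi>_b[OF z]) simp_all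
  qed
  define e where "e = \<phi> (op_one K.B)"
  have one: "op_one K.B \<in> ?A" using OpA[of 0 "\<lambda>j k. if j = k then 1 else 0"] by (simp add: K.Op_one)
  have e_b: "e \<in> bounded_ops L.B" unfolding e_def by (rule \<phi>_b[OF one])
  have e_unit: "op_mult L.B e (\<phi> T) = \<phi> T" if "T \<in> ?A" for T
    using \<phi>_mult[OF one that] that Ab(1) by (auto simp: e_def K.LP.op_mult_one_left)
  have e_norm: "1 \<le> op_norm L.B e"
  proof (rule L.LP.op_norm_idempotent[OF e_b])
    show "op_mult L.B e e = e" using e_unit[OF one] by (simp add: e_def)
    obtain T where T: "T \<in> ?A" "\<phi> T \<noteq> op_zero L.B" using nz' by (auto simp: nonzero_hom_def)
    show "e \<noteq> op_zero L.B"
    proof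
      assume "e = op_zero L.B"
      then have "\<phi> T = op_mult L.B (op_zero L.B) (\<phi> T)" using e_unit[OF T(1)] by simp
      also have "\<dots> = op_zero L.B"
        using \<phi>_b[OF T(1)] by (intro L.LP.bounded_ops_eqI) (auto simp: L.LP.op_mult_apply L.LP.op_zero_apply L.LP.bounded_opsD(1))
      finally show False using T(2) by simp
    qed
  qed
  obtain m0 g0 where g0: "op_dist L.B e (L.Op m0 g0) < 1/4"
  proof -
    have "e \<in> ?A'" unfolding e_def by (rule \<phi>_in[OF one])
    moreover have "(0::real) < 1/4" by simp
    ultimately obtain S where S: "S \<in> L.Ops" "op_dist L.B e S < 1/4" unfolding L.LP.op_closure_def by blast
    then obtain m a where "S = L.Op m a" by (elim L.OpsE)
    then show ?thesis using that S(2) by blast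
  qed
  \<comment> \<open>128 = 2 * 4 * 16: rounding \<open>\<gamma>2 n\<close> down loses a factor of at
    most 2, \<open>K1 \<le> 2 * (C * Gn)\<close> gives 4 after squaring, and an error of 1/16 is to
    remain. The factor \<open>Suc n\<close> in the growth condition is there to absorb
    \<open>128 * C^2\<close>.\<close>
  obtain n where n: "m0 \<le> n" "128 * C\<^sup>2 \<le> real (Suc n)"
    "real (Suc n) * (real (\<Prod>i<Suc n. d i))\<^sup>2 * (\<Prod>i<Suc n. \<gamma>1 i)\<^sup>2 \<le> \<gamma>2 n"
  proof -
    have "\<forall>\<^sub>F n in sequentially. nat \<lceil>128 * C\<^sup>2\<rceil> \<le> n" by (rule eventually_ge_at_top)
    then have "\<forall>\<^sub>F n in sequentially. m0 \<le> n \<and> 128 * C\<^sup>2 \<le> real (Suc n) \<and>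
       real (Suc n) * (real (\<Prod>i<Suc n. d i))\<^sup>2 * (\<Prod>i<Suc n. \<gamma>1 i)\<^sup>2 \<le> \<gamma>2 n"
      using growth eventually_ge_at_top[of m0]
    proof eventually_elim
      case (elim n)
      have "128 * C\<^sup>2 \<le> real (Suc n)" using elim(1) real_nat_ceiling_ge[of "128 * C\<^sup>2"] by linarith
      then show ?case using elim by blast
    qed
    from eventually_happens'[OF sequentially_bot this] show ?thesis using that by blast
  qed
  \<comment> \<open>The matrix units have level \<open>n + 1\<close>, the block will have the
    coordinates of level \<open>n\<close>; the surplus factor \<open>d n \<ge> 2\<close> makes them
    too many.\<close>
  define S where "S = K.Idx (Suc n)"
  define Nn where "Nn = real (card S)"
  define Gn where "Gn = K.G (Suc n)"
  have finS: "finite S" by (simp add: S_def)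
  have Nn_eq: "Nn = real (\<Prod>i<Suc n. d i)" by (simp add: Nn_def S_def K.card_Idx)
  have Gn_eq: "Gn = (\<Prod>i<Suc n. \<gamma>1 i)" by (simp add: Gn_def K.G_def)
  have Gn: "1 \<le> Gn" unfolding Gn_def by (rule K.G_ge_1)
  have cardIdx: "card (K.Idx n) < card S"
  proof -
    have "card (K.Idx n) > 0" unfolding K.card_Idx using K.d_pos by (intro prod_pos) auto
    moreover have "card S = card (K.Idx n) * d n" by (simp add: S_def K.card_Idx)
    ultimately show ?thesis using K.d[of n] by simp
  qed
  have Nn: "1 \<le> Nn" using cardIdx by (simp add: Nn_def)
  define g where "g = K.klift m0 n g0"
  have g: "L.Op n g = L.Op m0 g0" unfolding g_def by (rule L.Op_lift[OF n(1)])
  have "3/4 \<le> op_norm L.B (L.Op n g)"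
    using L.LP.op_norm_le_dist[OF e_b L.Op_in[of n g]] e_norm g0 unfolding g by simp
  then have "\<not> (\<forall>v\<in>L.Vs n. L.fib n v g (1/2))"
    using L.Op_norm_le[of "1/2" n g] by auto
  then obtain v0 \<xi>0 where v0: "v0 \<in> L.Vs n" and
    \<xi>0: "1/2 * pnorm p (count_space (K.Idx n)) \<xi>0 < pnorm p (count_space (K.Idx n)) (kact (K.Idx n) (L.wv n v0) g \<xi>0)"
    unfolding L.fib_def kbound_def by (auto simp: not_le)
  define f where "f r s = \<phi> (K.Op (Suc n) (K.kunit r s))" for r s
  have f_b: "f r s \<in> bounded_ops L.B" for r s unfolding f_def by (rule \<phi>_b[OF OpA])
  have f_norm: "op_norm L.B (f r s) \<le> C * Gn" if "r \<in> S" "s \<in> S" for r s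
  proof -
    have "op_norm K.B (K.Op (Suc n) (K.kunit r s)) \<le> Gn"
    proof (rule K.Op_norm_le)
      fix v assume v: "v \<in> K.Vs (Suc n)"
      have rs: "r \<in> K.Idx (Suc n)" "s \<in> K.Idx (Suc n)" using that by (simp_all add: S_def)
      have "kbound p (K.Idx (Suc n)) (K.wv (Suc n) v) (\<lambda>j k. if j = r \<and> k = s then 1 else 0)
          (norm (1::complex) * (K.wv (Suc n) v r / K.wv (Suc n) v s))"
        using K.wv_bounds[OF v rs(1)] K.wv_bounds[OF v rs(2)] by (intro kbound_unit[OF p _ rs]) auto
      moreover have "K.wv (Suc n) v r / K.wv (Suc n) v s \<le> Gn / 1"
        using K.wv_bounds[OF v rs(1)] K.wv_bounds[OF v rs(2)] Gn by (intro frac_le) (auto simp: Gn_def)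
      moreover have "K.kunit r s = (\<lambda>j k. if j = r \<and> k = s then 1 else 0)"
        by (intro ext) (simp add: K.kunit_def)
      ultimately show "K.fib (Suc n) v (K.kunit r s) Gn"
        unfolding K.fib_def using kbound_mono[OF p] by simp
    qed (use Gn in simp)
    then have "C * op_norm K.B (K.Op (Suc n) (K.kunit r s)) \<le> C * Gn" using C(1) by (intro mult_left_mono) auto
    then show ?thesis unfolding f_def by (rule order_trans[OF C(2)[OF OpA]])
  qed
  have f_mult: "op_mult L.B (f r s) (f s' q) = (if s = s' then f r q else op_zero L.B)"
    if "r \<in> S" "s \<in> S" "s' \<in> S" "q \<in> S" for r s s' q
  proof -
    have "K.kmul (Suc n) (K.kunit r s) (K.kunit s' q) j k = (if s = s' then K.kunit r q j k else 0)" for j k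
    proof -
      have "K.kmul (Suc n) (K.kunit r s) (K.kunit s' q) j k =
        (\<Sum>l\<in>S. if l = s then (if s = s' then K.kunit r q j k else 0) else 0)"
        unfolding K.kmul_def S_def by (intro sum.cong) (auto simp: K.kunit_def)
      then show ?thesis using that finS by simp
    qed
    then have eq: "K.kmul (Suc n) (K.kunit r s) (K.kunit s' q) = (\<lambda>j k. if s = s' then K.kunit r q j k else 0)"
      by (intro ext)
    have "op_mult L.B (f r s) (f s' q) = \<phi> (K.Op (Suc n) (\<lambda>j k. if s = s' then K.kunit r q j k else 0))"
      unfolding f_def by (simp add: \<phi>_mult[OF OpA OpA, symmetric] K.Op_mult eq)
    then show ?thesis by (cases "s = s'") (simp_all add: f_def K.Op_zero \<phi>_zero)
  qed
  define K1 where "K1 = C * Gn + 1"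
  \<comment> \<open>Accuracy of the approximation of matrix units: \<open>Nn * \<delta>\<close>
    bounds the error in \<phi>(1), \<open>Nn^2 * (2 * K1 + 1) * \<delta>\<close> the multiplicative
    error after compression, and both are to be at most 1/16. That \<open>\<delta> \<le> 1\<close>
    accounts for the summand 1 in \<open>K1\<close>.\<close>
  define \<delta> where "\<delta> = 1 / (32 * Nn\<^sup>2 * (K1 + 1))"
  have CG: "1 \<le> C * Gn" using C(1) Gn mult_mono[of 1 C 1 Gn] by simp
  have K1: "2 \<le> K1" "K1 \<le> 2 * (C * Gn)" using CG by (auto simp: K1_def)
  have Nn2: "Nn \<le> Nn\<^sup>2" "1 \<le> Nn\<^sup>2" using Nn by (auto simp: power2_eq_square mult_le_cancel_left1 intro: order_trans)
  have \<delta>: "0 < \<delta>" "\<delta> \<le> 1" "Nn * \<delta> \<le> 1/16" "Nn\<^sup>2 * ((2 * K1 + 1) * \<delta>) \<le> 1/16"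
  proof -
    have D: "1 \<le> Nn\<^sup>2 * (K1 + 1)" using mult_mono[of 1 "Nn\<^sup>2" 1 "K1 + 1"] Nn2 K1 by simp
    then show d0: "0 < \<delta>" "\<delta> \<le> 1" by (auto simp: \<delta>_def mult.assoc divide_le_eq)
    have eq: "Nn\<^sup>2 * ((K1 + 1) * \<delta>) = 1/32" using Nn K1 by (simp add: \<delta>_def)
    have "Nn * \<delta> \<le> Nn\<^sup>2 * ((K1 + 1) * \<delta>)"
      using Nn2 K1 d0 by (intro mult_mono) auto
    then show "Nn * \<delta> \<le> 1/16" using eq by simp
    have "Nn\<^sup>2 * ((2 * K1 + 1) * \<delta>) \<le> Nn\<^sup>2 * ((2 * (K1 + 1)) * \<delta>)"
      using d0 by (intro mult_left_mono mult_right_mono) auto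
    also have "\<dots> = 2 * (Nn\<^sup>2 * ((K1 + 1) * \<delta>))" by simp
    finally show "Nn\<^sup>2 * ((2 * K1 + 1) * \<delta>) \<le> 1/16" using eq by simp
  qed
  have "\<exists>m a. op_dist L.B (f r s) (L.Op m a) < \<delta>" for r s
  proof -
    have "f r s \<in> ?A'" unfolding f_def by (rule \<phi>_in[OF OpA])
    then obtain T where T: "T \<in> L.Ops" "op_dist L.B (f r s) T < \<delta>" using \<delta>(1) unfolding L.LP.op_closure_def by blast
    then obtain m a where "T = L.Op m a" by (elim L.OpsE)
    then show ?thesis using T(2) by blast
  qed
  then obtain mm aa where ma: "\<And>r s. op_dist L.B (f r s) (L.Op (mm r s) (aa r s)) < \<delta>" by metis
  \<comment> \<open>A common level for all approximants and for \<open>g\<close>; there is no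
    control over its size.\<close>
  define m where "m = n + (\<Sum>r\<in>S. \<Sum>s\<in>S. mm r s)"
  have nm: "n \<le> m" by (simp add: m_def)
  have mm_le: "mm r s \<le> m" if "r \<in> S" "s \<in> S" for r s
  proof -
    have "mm r s \<le> (\<Sum>s\<in>S. mm r s)" using that finS by (intro member_le_sum) auto
    also have "\<dots> \<le> (\<Sum>r\<in>S. \<Sum>s\<in>S. mm r s)" using that finS by (intro member_le_sum[of r S "\<lambda>r. \<Sum>s\<in>S. mm r s"]) auto
    finally show ?thesis by (simp add: m_def)
  qed
  define b where "b r s = K.klift (mm r s) m (aa r s)" for r s
  have b_dist: "op_dist L.B (f r s) (L.Op m (b r s)) < \<delta>" if "r \<in> S" "s \<in> S" for r s
    using ma[of r s] L.Op_lift[OF mm_le[OF that], of "aa r s"] by (simp add: b_def)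
  have b_norm: "op_norm L.B (L.Op m (b r s)) \<le> K1" if "r \<in> S" "s \<in> S" for r s
    using L.LP.op_norm_le_dist[OF L.Op_in f_b, of m "b r s" r s] f_norm[OF that] b_dist[OF that] \<delta>(2)
    by (simp add: K1_def L.LP.op_dist_commute)
  have norm_diff: "op_norm L.B (L.Op m (\<lambda>j k. a1 j k - a2 j k)) = op_dist L.B (L.Op m a1) (L.Op m a2)" for a1 a2
    by (simp add: op_dist_def L.Op_scale L.Op_add)
  \<comment> \<open>Replacing the two factors one after the other costs \<open>K1 * \<delta>\<close>
    each, and replacing the product \<open>f r q\<close> costs another
    \<open>\<delta>\<close>.\<close>
  have b_mult: "op_norm L.B (L.Op m (\<lambda>j k. K.kmul m (b r s) (b s' q) j k - (if s = s' then b r q j k else 0))) \<le> (2 * K1 + 1) * \<delta>"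
    if rs: "r \<in> S" "s \<in> S" "s' \<in> S" "q \<in> S" for r s s' q
  proof -
    let ?b' = "\<lambda>j k. if s = s' then b r q j k else 0"
    have "op_dist L.B (L.Op m (K.kmul m (b r s) (b s' q))) (L.Op m ?b') \<le>
      op_dist L.B (op_mult L.B (L.Op m (b r s)) (L.Op m (b s' q))) (op_mult L.B (f r s) (f s' q)) +
      op_dist L.B (op_mult L.B (f r s) (f s' q)) (L.Op m ?b')"
      unfolding L.Op_mult[symmetric] using f_b by (intro L.LP.op_dist_triangle) auto
    also have "op_dist L.B (op_mult L.B (L.Op m (b r s)) (L.Op m (b s' q))) (op_mult L.B (f r s) (f s' q)) \<le>
      op_dist L.B (L.Op m (b r s)) (f r s) * op_norm L.B (L.Op m (b s' q)) + op_norm L.B (f r s) * op_dist L.B (L.Op m (b s' q)) (f s' q)"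
      using f_b by (intro L.LP.op_dist_mult) auto
    also have "\<dots> \<le> \<delta> * K1 + K1 * \<delta>"
      using b_dist[OF rs(1,2)] b_dist[OF rs(3,4)] b_norm[OF rs(3,4)] f_norm[OF rs(1,2)] \<delta>(1) K1 CG
      by (intro add_mono mult_mono) (auto simp: L.LP.op_dist_commute K1_def L.LP.op_norm_nonneg f_b)
    also have "op_dist L.B (op_mult L.B (f r s) (f s' q)) (L.Op m ?b') \<le> \<delta>"
      unfolding f_mult[OF rs] using b_dist[OF rs(1,4)] \<delta>(1) by (cases "s = s'") (simp_all add: L.Op_zero L.LP.op_dist_self)
    finally show ?thesis unfolding norm_diff by (simp add: algebra_simps)
  qed
  have e_dist: "op_dist L.B e (L.Op m (\<lambda>j k. \<Sum>r\<in>S. b r r j k)) \<le> Nn * \<delta>"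
  proof -
    have "op_dist L.B (\<phi> (K.Op (Suc n) (\<lambda>j k. \<Sum>r\<in>S'. K.kunit r r j k))) (L.Op m (\<lambda>j k. \<Sum>r\<in>S'. b r r j k)) \<le> real (card S') * \<delta>"
      if "finite S'" "S' \<subseteq> S" for S'
      using that
    proof (induction S')
      case empty
      then show ?case by (simp add: K.Op_zero L.Op_zero \<phi>_zero L.LP.op_dist_self)
    next
      case (insert r S')
      have "op_dist L.B (op_add L.B (f r r) (\<phi> (K.Op (Suc n) (\<lambda>j k. \<Sum>r\<in>S'. K.kunit r r j k))))
          (op_add L.B (L.Op m (b r r)) (L.Op m (\<lambda>j k. \<Sum>r\<in>S'. b r r j k))) \<le> \<delta> + real (card S') * \<delta>"
        using insert b_dist[of r r] by (intro order_trans[OF L.LP.op_dist_add] add_mono f_b \<phi>_b OpA) auto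
      then show ?case
        using insert by (simp add: f_def \<phi>_add[OF OpA OpA, symmetric] K.Op_add L.Op_add algebra_simps)
    qed
    from this[OF finS subset_refl] have "op_dist L.B (\<phi> (K.Op (Suc n) (\<lambda>j k. \<Sum>r\<in>S. K.kunit r r j k))) (L.Op m (\<lambda>j k. \<Sum>r\<in>S. b r r j k)) \<le> Nn * \<delta>"
      by (simp add: Nn_def)
    moreover have "K.Op (Suc n) (\<lambda>j k. \<Sum>r\<in>S. K.kunit r r j k) = op_one K.B"
      unfolding K.Op_one[of "Suc n", symmetric]
    proof (rule K.Op_cong)
      fix j k assume "j \<in> K.Idx (Suc n)" "k \<in> K.Idx (Suc n)"
      moreover have "(\<Sum>r\<in>S. K.kunit r r j k) = (\<Sum>r\<in>S. if r = j then (if j = k then 1 else 0) else 0)"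
        by (intro sum.cong) (auto simp: K.kunit_def)
      ultimately show "(\<Sum>r\<in>S. K.kunit r r j k) = (if j = k then 1 else 0)" using finS by (simp add: S_def)
    qed
    ultimately show ?thesis by (simp add: e_def)
  qed
  define gm where "gm = K.klift n m g"
  have gm: "L.Op m gm = L.Op m0 g0" unfolding gm_def g[symmetric] by (rule L.Op_lift[OF nm])
  have g_dist: "op_norm L.B (L.Op m (\<lambda>j k. gm j k - (\<Sum>r\<in>S. b r r j k))) \<le> 1/4 + 1/16"
    unfolding norm_diff gm
    using L.LP.op_dist_triangle[OF L.Op_in[of m0 g0] e_b L.Op_in[of m "\<lambda>j k. \<Sum>r\<in>S. b r r j k"]] e_dist g0 \<delta>(3)
    by (simp add: L.LP.op_dist_commute)
  \<comment> \<open>An integer, because the diagonal matrices have rational entries. As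
    \<open>\<gamma>2 n\<close> is at least 1, rounding down at most halves it.\<close>
  define c where "c = real (nat \<lfloor>\<gamma>2 n\<rfloor>)"
  have c: "1 \<le> c" "c \<le> \<gamma>2 n" "\<gamma>2 n \<le> 2 * c" "c \<in> \<rat>"
  proof -
    have "1 \<le> \<lfloor>\<gamma>2 n\<rfloor>" using L.\<gamma>[of n] by simp
    then have ceq: "c = of_int \<lfloor>\<gamma>2 n\<rfloor>" by (simp add: c_def)
    then show "1 \<le> c" "c \<le> \<gamma>2 n" using \<open>1 \<le> \<lfloor>\<gamma>2 n\<rfloor>\<close> by (simp_all add: of_int_floor_le)
    then show "\<gamma>2 n \<le> 2 * c" using ceq real_of_int_floor_add_one_gt[of "\<gamma>2 n"] by linarith
    show "c \<in> \<rat>" by (simp add: c_def)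
  qed
  \<comment> \<open>Conjugation by \<open>vr\<close> instead of \<open>vc\<close> multiplies the entries of a row in \<open>Z\<close> outside \<open>Z\<close> by at least \<open>c\<close>.\<close>
  define Z where "Z = {J \<in> K.Idx m. \<forall>i\<in>{n..<m}. J i = 0}"
  define vc where "vc = (\<lambda>i\<in>{..<m}. if i < n then v0 i else mat_diag (d i) (\<lambda>j. of_real 1))"
  define vr where "vr = (\<lambda>i\<in>{..<m}. if i < n then v0 i else mat_diag (d i) (\<lambda>j. of_real (if j = 0 then c else 1)))"
  define t where "t J = (\<Prod>i\<in>{n..<m}. if J i = 0 then 1 else c)" for J :: "nat \<Rightarrow> nat"
  define \<omega> where "\<omega> = L.wv m vc"
  have v0i: "v0 i \<in> L.V i" if "i < n" for i using v0 that by (auto simp: L.Vs_def dest: PiE_mem)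
  have vc: "vc \<in> L.Vs m"
  proof -
    have "mat_diag (d i) (\<lambda>j. of_real 1) \<in> L.V i" for i
      unfolding L.V_def using L.\<gamma>[of i] by (intro mat_diag_in_diag_index) auto
    then show ?thesis unfolding vc_def L.Vs_def restrict_PiE_iff using v0i by auto
  qed
  have vr: "vr \<in> L.Vs m"
    unfolding vr_def L.Vs_def restrict_PiE_iff
  proof
    fix i assume "i \<in> {..<m}"
    show "(if i < n then v0 i else mat_diag (d i) (\<lambda>j. of_real (if j = 0 then c else 1))) \<in> L.V i"
    proof (cases "i < n")
      case False
      \<comment> \<open>Monotonicity makes the entry \<open>c\<close>, chosen for factor
        \<open>n\<close>, admissible in all later factors.\<close>
      then have "\<gamma>2 n \<le> \<gamma>2 i" using mono by (auto simp: mono_def)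
      then have "mat_diag (d i) (\<lambda>j. complex_of_real (if j = 0 then c else 1)) \<in> L.V i"
        unfolding L.V_def using c L.\<gamma>[of i] by (intro mat_diag_in_diag_index) auto
      then show ?thesis using False by simp
    qed (simp add: v0i)
  qed
  have Ji: "J i < d i" if "J \<in> K.Idx m" "i < m" for J i using that by (auto simp: K.Idx_def dest: PiE_mem)
  have rvc: "restrict vc {..<n} = v0" "restrict vr {..<n} = v0"
    using nm v0 by (auto simp: vc_def vr_def L.Vs_def fun_eq_iff PiE_iff extensional_def)
  have \<omega>_eq: "\<omega> J = L.wv n v0 (restrict J {..<n})" if J: "J \<in> K.Idx m" for J
  proof -
    have "(\<Prod>i\<in>{n..<m}. ent (vc i) (J i)) = 1"
      using Ji[OF J] by (intro prod.neutral) (auto simp: vc_def ent_mat_diag[of _ _ "\<lambda>_. 1", simplified])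
    then show ?thesis unfolding \<omega>_def L.wv_split[OF nm] rvc by simp
  qed
  \<comment> \<open>Up to the constant \<open>c ^ (m - n)\<close>, which cancels in every quotient,
    the weights of \<open>vr\<close> are \<open>\<omega> / t\<close>. So the norm bound on the fibre
    over \<open>vr\<close> is the row hypothesis of \<open>compressed_matrix_units\<close>, and the
    one over \<open>vc\<close> the column hypothesis.\<close>
  have wr_eq: "L.wv m vr J = \<omega> J / t J * c ^ (m - n)" if J: "J \<in> K.Idx m" for J
  proof -
    have "(\<Prod>i\<in>{n..<m}. ent (vr i) (J i)) = (\<Prod>i\<in>{n..<m}. if J i = 0 then c else 1)"
      using Ji[OF J] by (intro prod.cong) (auto simp: vr_def ent_mat_diag)
    moreover have "(\<Prod>i\<in>{n..<m}. if J i = 0 then c else 1) * t J = c ^ (m - n)"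
    proof -
      have "(\<Prod>i\<in>{n..<m}. if J i = 0 then c else 1) * t J = (\<Prod>i\<in>{n..<m}. c)"
        unfolding t_def prod.distrib[symmetric] by (intro prod.cong) auto
      then show ?thesis by simp
    qed
    moreover have "t J \<noteq> 0" using c(1) by (auto simp: t_def)
    ultimately have "(\<Prod>i\<in>{n..<m}. ent (vr i) (J i)) = c ^ (m - n) / t J" by (simp add: field_simps)
    then show ?thesis unfolding L.wv_split[OF nm] rvc using \<omega>_eq[OF J] by simp
  qed
  have t1: "t J = 1" if "J \<in> Z" for J using that by (simp add: t_def Z_def)
  have tc: "c \<le> t J" if "J \<in> K.Idx m" "J \<notin> Z" for J
  proof -
    obtain i where i: "i \<in> {n..<m}" "J i \<noteq> 0" using \<open>J \<in> K.Idx m\<close> \<open>J \<notin> Z\<close> unfolding Z_def by blast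
    have "t J = c * (\<Prod>i\<in>{n..<m} - {i}. if J i = 0 then 1 else c)"
      unfolding t_def using i by (subst prod.remove[of _ i]) auto
    moreover have "1 \<le> (\<Prod>i\<in>{n..<m} - {i}. if J i = 0 then 1 else c)"
      using c(1) by (intro prod_ge_1) auto
    ultimately show ?thesis using c(1) by simp
  qed
  define zero where "zero = (\<lambda>i\<in>{..<m}. 0::nat)"
  have zero: "zero \<in> K.Idx m" using K.d_pos by (auto simp: zero_def K.Idx_def restrict_PiE_iff)
  \<comment> \<open>The block is a copy of \<open>Idx n\<close>: its coordinates from
    \<open>n\<close> on are frozen at 0.\<close>
  have bijZ: "bij_betw (K.glue n m zero) (K.Idx n) Z"
  proof -
    have "{L \<in> K.Idx m. \<forall>i\<in>{n..<m}. zero i = L i} = Z"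
      unfolding Z_def by (auto simp: zero_def)
    then show ?thesis using K.glue_bij[OF zero nm] by simp
  qed
  have cardZ: "card Z < card S" using bij_betw_same_card[OF bijZ] cardIdx by simp
  have ZI: "Z \<subseteq> K.Idx m" by (auto simp: Z_def)
  have pnormZ: "pnorm p (count_space (K.Idx m)) (\<lambda>J. if J \<in> Z then h (restrict J {..<n}) else 0) = pnorm p (count_space (K.Idx n)) h" for h
  proof -
    have "(\<Sum>J\<in>K.Idx m. norm (if J \<in> Z then h (restrict J {..<n}) else 0) powr p) = (\<Sum>J\<in>Z. norm (h (restrict J {..<n})) powr p)"
      using ZI by (intro sum.mono_neutral_cong_right) auto
    also have "\<dots> = (\<Sum>j\<in>K.Idx n. norm (h (restrict (K.glue n m zero j) {..<n})) powr p)"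
      by (rule sum.reindex_bij_betw[OF bijZ, symmetric])
    also have "\<dots> = (\<Sum>j\<in>K.Idx n. norm (h j) powr p)"
      using nm by (intro sum.cong refl) (simp add: K.glue_restrict)
    finally have eq: "pnorm p (count_space (K.Idx m)) (\<lambda>J. if J \<in> Z then h (restrict J {..<n}) else 0) powr p = pnorm p (count_space (K.Idx n)) h powr p"
      using p by (simp add: pnorm_finite_powr)
    show ?thesis
      by (rule antisym; rule iffD1[OF powr_le_iff[OF p pnorm_nonneg[OF p] pnorm_nonneg[OF p]]]) (simp_all only: eq order_refl)
  qed
  \<comment> \<open>The test vector of level \<open>n\<close>, carried over to the block. The lift
    \<open>gm\<close> preserves the coordinates from \<open>n\<close> on, hence the block, and acts
    there as \<open>g\<close> on the fibre over \<open>v0\<close>.\<close>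
  define \<xi> where "\<xi> J = (if J \<in> Z then \<xi>0 (restrict J {..<n}) else 0)" for J
  let ?n = "pnorm p (count_space (K.Idx m))"
  have \<xi>_norm: "?n \<xi> = pnorm p (count_space (K.Idx n)) \<xi>0" unfolding \<xi>_def[abs_def] by (rule pnormZ)
  have g_act: "kact (K.Idx m) \<omega> gm \<xi> J = kact (K.Idx n) (L.wv n v0) g \<xi>0 (restrict J {..<n})" if J: "J \<in> Z" for J
  proof -
    have JI: "J \<in> K.Idx m" using J ZI by auto
    have "kact (K.Idx m) \<omega> gm \<xi> J = (\<Sum>L\<in>K.Idx m. K.klift n m g J L * (of_real (\<omega> J / \<omega> L) * \<xi> L))"
      by (simp add: kact_def gm_def mult.assoc)
    also have "\<dots> = (\<Sum>k\<in>K.Idx n. g (restrict J {..<n}) k * (of_real (\<omega> J / \<omega> (K.glue n m J k)) * \<xi> (K.glue n m J k)))"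
      by (rule K.sum_klift[OF JI nm])
    also have "\<dots> = (\<Sum>k\<in>K.Idx n. g (restrict J {..<n}) k * of_real (L.wv n v0 (restrict J {..<n}) / L.wv n v0 k) * \<xi>0 k)"
    proof (intro sum.cong refl)
      fix k assume k: "k \<in> K.Idx n"
      have gl: "K.glue n m J k \<in> K.Idx m" by (rule K.glue_in[OF JI k nm])
      moreover have "K.glue n m J k \<in> Z" using J gl by (auto simp: Z_def K.glue_def)
      ultimately show "g (restrict J {..<n}) k * (of_real (\<omega> J / \<omega> (K.glue n m J k)) * \<xi> (K.glue n m J k)) =
         g (restrict J {..<n}) k * of_real (L.wv n v0 (restrict J {..<n}) / L.wv n v0 k) * \<xi>0 k"
        using JI by (simp add: \<omega>_eq \<xi>_def K.glue_restrict[OF k nm])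
    qed
    finally show ?thesis by (simp add: kact_def)
  qed
  let ?sb = "\<lambda>j k. \<Sum>r\<in>S. b r r j k"
  let ?P = "\<lambda>h J. if J \<in> Z then h J else (0::complex)"
  have big: "1/2 * ?n \<xi> < ?n (?P (kact (K.Idx m) \<omega> gm \<xi>))"
  proof -
    have "?P (kact (K.Idx m) \<omega> gm \<xi>) = (\<lambda>J. if J \<in> Z then kact (K.Idx n) (L.wv n v0) g \<xi>0 (restrict J {..<n}) else 0)"
      using g_act by auto
    then show ?thesis using \<xi>0 by (simp only: pnormZ \<xi>_norm)
  qed
  have \<omega>_pos: "0 < \<omega> k" if "k \<in> K.Idx m" for k unfolding \<omega>_def using L.wv_bounds(3)[OF vc] that by simp
  have fin: "finite (K.Idx m)" by simp
  have small: "?n (?P (kact (K.Idx m) \<omega> ?sb \<xi>)) \<le> (real (card S))\<^sup>2 * (K1\<^sup>2 / c + (2 * K1 + 1) * \<delta>) * ?n \<xi>"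
  proof (rule compressed_matrix_units[where b = b, OF p fin ZI \<omega>_pos t1 tc _ finS cardZ])
    fix r s assume rs: "r \<in> S" "s \<in> S"
    have "kbound p (K.Idx m) \<omega> (b r s) (op_norm L.B (L.Op m (b r s)))"
      using L.fib_op_norm[OF vc] by (simp add: L.fib_def \<omega>_def)
    then show "kbound p (K.Idx m) \<omega> (b r s) K1" by (rule kbound_mono[OF p _ b_norm[OF rs]])
    have "kbound p (K.Idx m) (L.wv m vr) (b r s) (op_norm L.B (L.Op m (b r s)))"
      using L.fib_op_norm[OF vr] by (simp add: L.fib_def)
    then have "kbound p (K.Idx m) (L.wv m vr) (b r s) K1" by (rule kbound_mono[OF p _ b_norm[OF rs]])
    moreover have "kbound p (K.Idx m) (L.wv m vr) (b r s) K1 \<longleftrightarrow> kbound p (K.Idx m) (\<lambda>J. \<omega> J / t J * c ^ (m - n)) (b r s) K1"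
      by (rule kbound_weight_cong) (rule wr_eq)
    ultimately have "kbound p (K.Idx m) (\<lambda>J. \<omega> J / t J * c ^ (m - n)) (b r s) K1" by blast
    then show "kbound p (K.Idx m) (\<lambda>J. \<omega> J / t J) (b r s) K1"
      by (rule iffD1[OF kbound_scale_weight[of "c ^ (m - n)" p "K.Idx m" "\<lambda>J. \<omega> J / t J"], rotated]) (use c(1) in simp)
  next
    fix r s s' q assume rs: "r \<in> S" "s \<in> S" "s' \<in> S" "q \<in> S"
    have "kbound p (K.Idx m) \<omega> (\<lambda>j k. K.kmul m (b r s) (b s' q) j k - (if s = s' then b r q j k else 0))
       (op_norm L.B (L.Op m (\<lambda>j k. K.kmul m (b r s) (b s' q) j k - (if s = s' then b r q j k else 0))))"
      using L.fib_op_norm[OF vc] by (simp add: L.fib_def \<omega>_def)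
    then show "kbound p (K.Idx m) \<omega> (\<lambda>j k. (\<Sum>l\<in>K.Idx m. b r s j l * b s' q l k) - (if s = s' then b r q j k else 0)) ((2 * K1 + 1) * \<delta>)"
      unfolding K.kmul_def by (rule kbound_mono[OF p _ b_mult[OF rs, unfolded K.kmul_def]])
  qed (use K1 \<delta> c in \<open>auto simp: \<xi>_def\<close>)
  have diff: "?n (?P (kact (K.Idx m) \<omega> (\<lambda>j k. gm j k - ?sb j k) \<xi>)) \<le> (1/4 + 1/16) * ?n \<xi>"
  proof -
    have "kbound p (K.Idx m) \<omega> (\<lambda>j k. gm j k - ?sb j k) (op_norm L.B (L.Op m (\<lambda>j k. gm j k - ?sb j k)))"
      using L.fib_op_norm[OF vc] by (simp add: L.fib_def \<omega>_def)
    then have kb: "kbound p (K.Idx m) \<omega> (\<lambda>j k. gm j k - ?sb j k) (1/4 + 1/16)" by (rule kbound_mono[OF p _ g_dist])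
    have "?n (?P (kact (K.Idx m) \<omega> (\<lambda>j k. gm j k - ?sb j k) \<xi>)) \<le> ?n (kact (K.Idx m) \<omega> (\<lambda>j k. gm j k - ?sb j k) \<xi>)"
      by (intro pnorm_finite_mono[OF p fin]) auto
    also have "\<dots> \<le> (1/4 + 1/16) * ?n \<xi>" by (rule kboundD[OF kb])
    finally show ?thesis .
  qed
  have cK: "Nn\<^sup>2 * (K1\<^sup>2 / c) \<le> 1/16"
  proof -
    have "128 * C\<^sup>2 * (Nn\<^sup>2 * Gn\<^sup>2) \<le> real (Suc n) * (Nn\<^sup>2 * Gn\<^sup>2)"
      using n(2) by (intro mult_right_mono) auto
    also have "\<dots> \<le> 2 * c" using n(3) c(3) by (simp add: Nn_eq Gn_eq mult.assoc)
    finally have "64 * (C\<^sup>2 * Nn\<^sup>2 * Gn\<^sup>2) \<le> c" by (simp add: mult_ac)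
    moreover have "K1\<^sup>2 \<le> (2 * (C * Gn))\<^sup>2" using K1 by (intro power_mono) auto
    then have "Nn\<^sup>2 * K1\<^sup>2 \<le> Nn\<^sup>2 * (2 * (C * Gn))\<^sup>2" by (intro mult_left_mono) auto
    then have "Nn\<^sup>2 * K1\<^sup>2 \<le> 4 * (C\<^sup>2 * Nn\<^sup>2 * Gn\<^sup>2)" by (simp add: power_mult_distrib mult_ac)
    ultimately have "Nn\<^sup>2 * K1\<^sup>2 \<le> 1/16 * c" by simp
    then show ?thesis using c(1) by (simp add: divide_le_eq)
  qed
  have coeff: "(real (card S))\<^sup>2 * (K1\<^sup>2 / c + (2 * K1 + 1) * \<delta>) \<le> 1/16 + 1/16"
    using cK \<delta>(4) unfolding Nn_def[symmetric] distrib_left[of "Nn\<^sup>2"] by linarith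
  have "?n (?P (kact (K.Idx m) \<omega> gm \<xi>)) =
    ?n (\<lambda>J. ?P (kact (K.Idx m) \<omega> (\<lambda>j k. gm j k - ?sb j k) \<xi>) J + ?P (kact (K.Idx m) \<omega> ?sb \<xi>) J)"
    by (intro pnorm_finite_cong) (simp add: kact_diff_kernel)
  also have "\<dots> \<le> ?n (?P (kact (K.Idx m) \<omega> (\<lambda>j k. gm j k - ?sb j k) \<xi>)) + ?n (?P (kact (K.Idx m) \<omega> ?sb \<xi>))"
    by (intro pnorm_add[OF p] Lp_fun_finite fin)
  also have "\<dots> \<le> (1/4 + 1/16) * ?n \<xi> + (1/16 + 1/16) * ?n \<xi>"
    using small mult_right_mono[OF coeff pnorm_nonneg[OF p, of "count_space (K.Idx m)" \<xi>]]
    by (intro add_mono diff) linarith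
  also have "\<dots> \<le> 1/2 * ?n \<xi>" using pnorm_nonneg[OF p, of "count_space (K.Idx m)" \<xi>] by simp
  finally show False using big by linarith
qed

end

theorem theorem5p14:
  fixes p :: real and d :: "nat \<Rightarrow> nat" and w :: "nat \<Rightarrow> real \<Rightarrow> complex mat \<Rightarrow> real"
  assumes "1 \<le> p"
    and "\<And>n. 2 \<le> d n"
    and "\<And>m g. 1 \<le> m \<Longrightarrow> 1 \<le> g \<Longrightarrow> weight m g (w m g)"
  shows "\<exists>\<gamma> :: nat rel set \<Rightarrow> nat \<Rightarrow> real.
    (\<forall>\<kappa>\<in>countable_ordinals. mono (\<gamma> \<kappa>) \<and> (\<forall>n. 1 \<le> \<gamma> \<kappa> n)) \<and>
    (\<forall>\<kappa>\<in>countable_ordinals. \<forall>\<mu>\<in>countable_ordinals. ordinal_less \<kappa> \<mu> \<longrightarrow>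
      (\<nexists>\<phi>. continuous_hom (B_space w p d (\<gamma> \<kappa>)) (B_alg w p d (\<gamma> \<kappa>))
                          (B_space w p d (\<gamma> \<mu>)) (B_alg w p d (\<gamma> \<mu>)) \<phi> \<and>
           nonzero_hom (B_alg w p d (\<gamma> \<kappa>)) (B_space w p d (\<gamma> \<mu>)) \<phi>) \<and>
      (\<exists>\<phi>. continuous_hom (B_space w p d (\<gamma> \<mu>)) (B_alg w p d (\<gamma> \<mu>))
                          (B_space w p d (\<gamma> \<kappa>)) (B_alg w p d (\<gamma> \<kappa>)) \<phi> \<and>
           unital_hom (B_space w p d (\<gamma> \<mu>)) (B_space w p d (\<gamma> \<kappa>)) \<phi> \<and>
           dense_range (B_alg w p d (\<gamma> \<mu>)) (B_space w p d (\<gamma> \<kappa>)) (B_alg w p d (\<gamma> \<kappa>)) \<phi>))"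
proof -
  \<comment> \<open>The products run over \<open>n + 1\<close> factors, the level of the matrix
    units, while the bound is imposed on the larger sequence at \<open>n\<close>, the first factor
    frozen by the compression.\<close>
  define F where "F g n = real (Suc n) * (real (\<Prod>i<Suc n. d i))\<^sup>2 * (\<Prod>i<Suc n. g i)\<^sup>2"
    for g :: "nat \<Rightarrow> real" and n
  obtain \<gamma> :: "nat rel set \<Rightarrow> nat \<Rightarrow> real" where
    \<gamma>: "\<And>\<kappa>. \<kappa> \<in> countable_ordinals \<Longrightarrow> mono (\<gamma> \<kappa>) \<and> (\<forall>n. 1 \<le> \<gamma> \<kappa> n)"
    and less: "\<And>\<kappa> \<mu>. \<kappa> \<in> countable_ordinals \<Longrightarrow> \<mu> \<in> countable_ordinals \<Longrightarrow> ordinal_less \<kappa> \<mu> \<Longrightarrow>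
      \<forall>\<^sub>F n in sequentially. F (\<gamma> \<kappa>) n \<le> \<gamma> \<mu> n \<and> \<gamma> \<kappa> n \<le> \<gamma> \<mu> n"
    using ordinal_family[of F] by blast
  have tower: "tower p d (\<gamma> \<kappa>) w" if "\<kappa> \<in> countable_ordinals" for \<kappa>
  proof
    fix n
    have "1 \<le> d n" using assms(2)[of n] by linarith
    then show "weight (d n) (\<gamma> \<kappa> n) (w (d n) (\<gamma> \<kappa> n))" using assms(3) \<gamma>[OF that] by blast
  qed (use assms \<gamma>[OF that] in auto)
  show ?thesis
  proof (intro exI[of _ \<gamma>] conjI ballI impI)
    fix \<kappa> \<mu> assume km: "\<kappa> \<in> countable_ordinals" "\<mu> \<in> countable_ordinals" "ordinal_less \<kappa> \<mu>"
    interpret two_towers p d "\<gamma> \<kappa>" "\<gamma> \<mu>" w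
      by (rule two_towers.intro[OF tower[OF km(1)] tower[OF km(2)]])
    have ev: "\<forall>\<^sub>F n in sequentially. F (\<gamma> \<kappa>) n \<le> \<gamma> \<mu> n" "\<forall>\<^sub>F n in sequentially. \<gamma> \<kappa> n \<le> \<gamma> \<mu> n"
      using less[OF km] by (auto simp: eventually_conj_iff)
    show "\<nexists>\<phi>. continuous_hom (B_space w p d (\<gamma> \<kappa>)) (B_alg w p d (\<gamma> \<kappa>)) (B_space w p d (\<gamma> \<mu>)) (B_alg w p d (\<gamma> \<mu>)) \<phi> \<and>
        nonzero_hom (B_alg w p d (\<gamma> \<kappa>)) (B_space w p d (\<gamma> \<mu>)) \<phi>"
      using no_hom ev(1) \<gamma>[OF km(2)] unfolding F_def by blast
    obtain n0 where "\<And>n. n0 \<le> n \<Longrightarrow> \<gamma> \<kappa> n \<le> \<gamma> \<mu> n"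
      using ev(2) unfolding eventually_sequentially by blast
    then show "\<exists>\<phi>. continuous_hom (B_space w p d (\<gamma> \<mu>)) (B_alg w p d (\<gamma> \<mu>)) (B_space w p d (\<gamma> \<kappa>)) (B_alg w p d (\<gamma> \<kappa>)) \<phi> \<and>
        unital_hom (B_space w p d (\<gamma> \<mu>)) (B_space w p d (\<gamma> \<kappa>)) \<phi> \<and>
        dense_range (B_alg w p d (\<gamma> \<mu>)) (B_space w p d (\<gamma> \<kappa>)) (B_alg w p d (\<gamma> \<kappa>)) \<phi>"
      by (rule dense_hom_exists)
  qed (use \<gamma> in auto)
qed

end
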